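(* For each of the following eight rules, the vector space $\mathbb V/J$ becomes a $\square_q$-module on which the generators $x_0,x_1,x_2,x_3$ act respectively as (the operators induced on $\mathbb V/J$ by) the four listed maps: \begin{itemize} \item I: $\;A_L,\; Q(A^*_\ell-B^*_rK),\; B_L,\; Q(B^*_\ell-A^*_rK^{-1})$; \item IS: $\;A_R,\; Q(A^*_r-B^*_\ell K),\; B_R,\; Q(B^*_r-A^*_\ell K^{-1})$; \item IT: $\;B_L,\; Q(B^*_\ell-A^*_rK^{-1}),\; A_L,\; Q(A^*_\ell-B^*_rK)$; \item IST: $\;B_R,\; Q(B^*_r-A^*_\ell K^{-1}),\; A_R,\; Q(A^*_r-B^*_\ell K)$; \item II: $\;Q(A_L-KB_R),\; A^*_\ell,\; Q(B_L-K^{-1}A_R),\; B^*_\ell$; \item IIS: $\;Q(A_R-KB_L),\; A^*_r,\; Q(B_R-K^{-1}A_L),\; B^*_r$; \item IIT: $\;Q(B_L-K^{-1}A_R),\; B^*_\ell,\; Q(A_L-KB_R),\; A^*_\ell$; \item IIST: $\;Q(B_R-K^{-1}A_L),\; B^*_r,\; Q(A_R-KB_L),\; A^*_r$. \end{itemize} Each of these eight $\square_q$-modules is isomorphic to $\mathbf U$, the NIL $\square_q$-module (unique up to isomorphism).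
   Context: Throughout, $\mathbb F$ is a field and $q\in\mathbb F$ is nonzero and not a root of unity. All vector spaces and algebras are over $\mathbb F$; algebras are associative with multiplicative identity. $[3]_q=(q^3-q^{-3})/(q-q^{-1})$ and $Q=1-q^2$. The algebra $\square_q$ is defined by generators $\{x_i\}_{i\in\mathbb Z_4}$ ($\mathbb Z_4=\mathbb Z/4\mathbb Z$) and relations, for $i\in\mathbb Z_4$: $\frac{q x_ix_{i+1}-q^{-1}x_{i+1}x_i}{q-q^{-1}}=1$ and $x_i^3x_{i+2}-[3]_q x_i^2x_{i+2}x_i+[3]_q x_ix_{i+2}x_i^2-x_{i+2}x_i^3=0$. For a $\square_q$-module $V$, a vector $\xi\in V$ is called NIL if $x_1\xi=0$, $x_3\xi=0$ and $\xi\neq0$. $V$ is called NIL if it is generated by a NIL vector (no proper submodule contains that vector). Up to isomorphism there is exactly one NIL $\square_q$-module; it is denoted $\mathbf U$. Let $\mathbb V$ be the free algebra on two generators $A,B$. A word of length $n$ is a product $v_1v_2\cdots v_n$ with each $v_i\in\{A,B\}$ (the word of length $0$ is $1$); the words form the standard basis of $\mathbb V$. Let $(\,,\,)$ be the bilinear form on $\mathbb V$ for which the words are orthonormal. ${\rm End}(\mathbb V)$ is the algebra of $\mathbb F$-linear maps $\mathbb V\to\mathbb V$ whose matrix with respect to the standard basis has finitely many nonzero entries in each row; each $X\in{\rm End}(\mathbb V)$ has a unique adjoint $X^*\in{\rm End}(\mathbb V)$ with $(Xu,v)=(u,X^*v)$ for all $u,v\in\mathbb V$. $K$ is the automorphism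 of the free algebra $\mathbb V$ with $A\mapsto q^2A$, $B\mapsto q^{-2}B$. Define $A_L(v)=Av$, $B_L(v)=Bv$, $A_R(v)=vA$, $B_R(v)=vB$ for $v\in\mathbb V$. Put $\langle A,A\rangle=\langle B,B\rangle=2$, $\langle A,B\rangle=\langle B,A\rangle=-2$. The $q$-shuffle product $\star$ on $\mathbb V$ satisfies $1\star v=v\star1=v$ and, for $X\in\{A,B\}$ and a nontrivial word $v=v_1\cdots v_n$, $X\star v=\sum_{i=0}^n v_1\cdots v_iXv_{i+1}\cdots v_n\,q^{\langle v_1,X\rangle+\cdots+\langle v_i,X\rangle}$ and $v\star X=\sum_{i=0}^n v_1\cdots v_iXv_{i+1}\cdots v_n\,q^{\langle v_n,X\rangle+\langle v_{n-1},X\rangle+\cdots+\langle v_{i+1},X\rangle}$. Define $A_\ell(v)=A\star v$, $B_\ell(v)=B\star v$, $A_r(v)=v\star A$, $B_r(v)=v\star B$ for $v\in\mathbb V$. $J$ is the 2-sided ideal of the free algebra $\mathbb V$ generated by $A^3B-[3]_qA^2BA+[3]_qABA^2-BA^3$ and $B^3A-[3]_qB^2AB+[3]_qBAB^2-AB^3$. The ideal $J$ is invariant under $K^{\pm1},A_L,B_L,A_R,B_R,A^*_\ell,B^*_\ell,A^*_r,B^*_r$, so these maps act on $\mathbb V/J$. *)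

theory Defs
  imports
    "HOL-Algebra.Algebra"
    "HOL-Algebra.Algebraic_Closure_Type"
    "HOL-Library.Poly_Mapping"
    "HOL-Library.Numeral_Type"
begin

section \<open>Free algebras\<close>

text \<open>
  Lists form the free monoid under concatenation. With this instance, \<open>'g list \<Rightarrow>\<^sub>0 'k\<close> with the
  multiplication provided by \<^theory>\<open>HOL-Library.Poly_Mapping\<close> is the monoid algebra of the free
  monoid, i.e. the free associative unital algebra over \<open>'k\<close> on the generating set \<open>'g\<close>, with
  the words as standard basis.
\<close>

instantiation list :: (type) monoid_add
begin

definition zero_list :: "'a list" where "zero_list = []"

definition plus_list :: "'a list \<Rightarrow> 'a list \<Rightarrow> 'a list" where "plus_list = (@)"

instance by standard (simp_all add: zero_list_def plus_list_def)

end

type_synonym ('g, 'k) free_alg = "'g list \<Rightarrow>\<^sub>0 'k"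

definition word :: "'g list \<Rightarrow> ('g, 'k::field) free_alg"
  where "word w = Poly_Mapping.single w 1"

definition gen :: "'g \<Rightarrow> ('g, 'k::field) free_alg"
  where "gen g = word [g]"

definition const :: "'k::field \<Rightarrow> ('g, 'k) free_alg"
  where "const c = Poly_Mapping.single [] c"

definition scale :: "'k::field \<Rightarrow> ('g, 'k) free_alg \<Rightarrow> ('g, 'k) free_alg"  (infixr \<open>\<cdot>\<close> 75)
  where "c \<cdot> v = const c * v"

text \<open>The algebra homomorphism that sends each generator \<open>g\<close> to \<open>h g\<close>.\<close>

definition subst_hom ::
    "('g \<Rightarrow> ('h, 'k::field) free_alg) \<Rightarrow> ('g, 'k) free_alg \<Rightarrow> ('h, 'k) free_alg"
  where "subst_hom h p = (\<Sum>w\<in>Poly_Mapping.keys p. Poly_Mapping.lookup p w \<cdot> prod_list (map h w))"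

definition qthree :: "'k::field \<Rightarrow> 'k"
  where "qthree q = (q powi 3 - q powi (-3)) / (q - q powi (-1))"

definition qSerre ::
    "'k::field \<Rightarrow> ('g, 'k) free_alg \<Rightarrow> ('g, 'k) free_alg \<Rightarrow> ('g, 'k) free_alg"
  where "qSerre q x y =
    x^3 * y - qthree q \<cdot> (x^2 * y * x) + qthree q \<cdot> (x * y * x^2) - y * x^3"


section \<open>Left modules over a noncommutative ring\<close>

text \<open>The axioms are those of the library locale \<^locale>\<open>module\<close>, which requires a commutative ring.\<close>

locale left_module = R?: ring R + M?: abelian_group M
  for R :: "('a, 'r) ring_scheme" (structure) and M :: "('a, 'b, 'm) module_scheme" (structure) +
  assumes smult_closed:
      "\<lbrakk>a \<in> carrier R; x \<in> carrier M\<rbrakk> \<Longrightarrow> a \<odot>\<^bsub>M\<^esub> x \<in> carrier M"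
    and smult_l_distr:
      "\<lbrakk>a \<in> carrier R; b \<in> carrier R; x \<in> carrier M\<rbrakk> \<Longrightarrow>
        (a \<oplus>\<^bsub>R\<^esub> b) \<odot>\<^bsub>M\<^esub> x = a \<odot>\<^bsub>M\<^esub> x \<oplus>\<^bsub>M\<^esub> b \<odot>\<^bsub>M\<^esub> x"
    and smult_r_distr:
      "\<lbrakk>a \<in> carrier R; x \<in> carrier M; y \<in> carrier M\<rbrakk> \<Longrightarrow>
        a \<odot>\<^bsub>M\<^esub> (x \<oplus>\<^bsub>M\<^esub> y) = a \<odot>\<^bsub>M\<^esub> x \<oplus>\<^bsub>M\<^esub> a \<odot>\<^bsub>M\<^esub> y"
    and smult_assoc1:
      "\<lbrakk>a \<in> carrier R; b \<in> carrier R; x \<in> carrier M\<rbrakk> \<Longrightarrow>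
        (a \<otimes>\<^bsub>R\<^esub> b) \<odot>\<^bsub>M\<^esub> x = a \<odot>\<^bsub>M\<^esub> (b \<odot>\<^bsub>M\<^esub> x)"
    and smult_one:
      "x \<in> carrier M \<Longrightarrow> \<one>\<^bsub>R\<^esub> \<odot>\<^bsub>M\<^esub> x = x"

definition module_isomorphic ::
    "('r, 's) ring_scheme \<Rightarrow> ('r, 'a, 'm) module_scheme \<Rightarrow> ('r, 'b, 'n) module_scheme \<Rightarrow> bool"
  where "module_isomorphic R M N \<longleftrightarrow>
    (\<exists>f. bij_betw f (carrier M) (carrier N) \<and>
      (\<forall>x\<in>carrier M. \<forall>y\<in>carrier M. f (x \<oplus>\<^bsub>M\<^esub> y) = f x \<oplus>\<^bsub>N\<^esub> f y) \<and>
      (\<forall>a\<in>carrier R. \<forall>x\<in>carrier M. f (a \<odot>\<^bsub>M\<^esub> x) = a \<odot>\<^bsub>N\<^esub> f x))"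


section \<open>The algebra \<open>\<box>\<^sub>q\<close> and its NIL modules\<close>

text \<open>The generators are indexed by the type \<^typ>\<open>4\<close>, whose addition is modulo 4.\<close>

definition box_relators :: "'k::field \<Rightarrow> (4, 'k) free_alg set"
  where "box_relators q =
    (\<Union>i. {(1 / (q - q powi (-1))) \<cdot>
             (q \<cdot> (gen i * gen (i + 1)) - q powi (-1) \<cdot> (gen (i + 1) * gen i)) - 1,
          qSerre q (gen i) (gen (i + 2))})"

definition box_ideal :: "'k::field \<Rightarrow> (4, 'k) free_alg set"
  where "box_ideal q = Idl\<^bsub>ring_of_type_algebra\<^esub> (box_relators q)"

definition box :: "'k::field \<Rightarrow> (4, 'k) free_alg set ring"
  where "box q = ring_of_type_algebra Quot (box_ideal q)"

definition box_class :: "'k::field \<Rightarrow> (4, 'k) free_alg \<Rightarrow> (4, 'k) free_alg set"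
  where "box_class q a = box_ideal q +>\<^bsub>ring_of_type_algebra\<^esub> a"

text \<open>
  A \<open>\<box>\<^sub>q\<close>-module is a left module over the ring \<^term>\<open>box q\<close>; its vector space structure is the one
  obtained by restriction to the central scalars \<^term>\<open>box_class q (const c)\<close>.
\<close>

abbreviation box_module :: "'k::field \<Rightarrow> ((4, 'k) free_alg set, 'v, 'm) module_scheme \<Rightarrow> bool"
  where "box_module q M \<equiv> left_module (box q) M"

definition NIL_vector :: "'k::field \<Rightarrow> ((4, 'k) free_alg set, 'v, 'm) module_scheme \<Rightarrow> 'v \<Rightarrow> bool"
  where "NIL_vector q M \<xi> \<longleftrightarrow> \<xi> \<in> carrier M \<and>
    box_class q (gen 1) \<odot>\<^bsub>M\<^esub> \<xi> = \<zero>\<^bsub>M\<^esub> \<and> box_class q (gen 3) \<odot>\<^bsub>M\<^esub> \<xi> = \<zero>\<^bsub>M\<^esub> \<and> \<xi> \<noteq> \<zero>\<^bsub>M\<^esub>"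

definition NIL_module :: "'k::field \<Rightarrow> ((4, 'k) free_alg set, 'v, 'm) module_scheme \<Rightarrow> bool"
  where "NIL_module q M \<longleftrightarrow> box_module q M \<and>
    (\<exists>\<xi>. NIL_vector q M \<xi> \<and> (\<forall>W. submodule W (box q) M \<and> \<xi> \<in> W \<longrightarrow> W = carrier M))"


section \<open>The free algebra on two generators and its operators\<close>

datatype letter = LA | LB

type_synonym 'k VV = "(letter, 'k) free_alg"

definition word_form :: "'k::field VV \<Rightarrow> 'k VV \<Rightarrow> 'k"
  where "word_form u v =
    (\<Sum>w\<in>Poly_Mapping.keys u. Poly_Mapping.lookup u w * Poly_Mapping.lookup v w)"

text \<open>Column \<open>u\<close> of the matrix of \<open>T\<close> lists the coefficients of \<^term>\<open>T (word u)\<close>.\<close>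

definition EndV :: "('k::field VV \<Rightarrow> 'k VV) set"
  where "EndV = {T. (\<forall>u v. T (u + v) = T u + T v) \<and> (\<forall>c v. T (c \<cdot> v) = c \<cdot> T v) \<and>
    (\<forall>w. finite {u. Poly_Mapping.lookup (T (word u)) w \<noteq> 0})}"

definition adj :: "('k::field VV \<Rightarrow> 'k VV) \<Rightarrow> ('k VV \<Rightarrow> 'k VV)"
  where "adj T = (THE Y. Y \<in> EndV \<and> (\<forall>u v. word_form (T u) v = word_form u (Y v)))"

definition K :: "'k::field \<Rightarrow> 'k VV \<Rightarrow> 'k VV"
  where "K q = subst_hom (\<lambda>x. case x of LA \<Rightarrow> q powi 2 \<cdot> gen LA | LB \<Rightarrow> q powi (-2) \<cdot> gen LB)"

definition Kinv :: "'k::field \<Rightarrow> 'k VV \<Rightarrow> 'k VV"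
  where "Kinv q = inv_into UNIV (K q)"

definition mulL :: "letter \<Rightarrow> 'k::field VV \<Rightarrow> 'k VV"
  where "mulL x v = gen x * v"

definition mulR :: "letter \<Rightarrow> 'k::field VV \<Rightarrow> 'k VV"
  where "mulR x v = v * gen x"

definition pairing :: "letter \<Rightarrow> letter \<Rightarrow> int"
  where "pairing x y = (if x = y then 2 else -2)"

text \<open>
  The \<open>q\<close>-shuffle product of two words, by the standard recursion on their first letters; the
  lemmas \<open>shuffle_letter_word\<close> and \<open>shuffle_word_letter\<close> below give the closed formulas for the
  product with a single letter.
\<close>

fun shuffle_words :: "'k::field \<Rightarrow> letter list \<Rightarrow> letter list \<Rightarrow> 'k VV"
  where
    "shuffle_words q [] v = word v"
  | "shuffle_words q (x # u) [] = word (x # u)"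
  | "shuffle_words q (x # u) (y # v) =
       gen x * shuffle_words q u (y # v) +
       q powi (\<Sum>z\<leftarrow>x # u. pairing z y) \<cdot> (gen y * shuffle_words q (x # u) v)"

definition shuffle :: "'k::field \<Rightarrow> 'k VV \<Rightarrow> 'k VV \<Rightarrow> 'k VV"
  where "shuffle q u v =
    (\<Sum>a\<in>Poly_Mapping.keys u. \<Sum>b\<in>Poly_Mapping.keys v.
      (Poly_Mapping.lookup u a * Poly_Mapping.lookup v b) \<cdot> shuffle_words q a b)"

definition shL :: "'k::field \<Rightarrow> letter \<Rightarrow> 'k VV \<Rightarrow> 'k VV"
  where "shL q x v = shuffle q (gen x) v"

definition shR :: "'k::field \<Rightarrow> letter \<Rightarrow> 'k VV \<Rightarrow> 'k VV"
  where "shR q x v = shuffle q v (gen x)"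

lemma scale_add: "c \<cdot> (u + v) = c \<cdot> u + c \<cdot> v"
  by (simp add: scale_def distrib_left)

lemma scale_zero: "c \<cdot> 0 = 0"
  by (simp add: scale_def)

lemma scale_sum: "c \<cdot> (\<Sum>i\<in>I. f i) = (\<Sum>i\<in>I. c \<cdot> f i)"
  by (simp add: scale_def sum_distrib_left)

lemma scale_scale: "c \<cdot> d \<cdot> v = (c * d) \<cdot> v"
  by (simp add: scale_def const_def mult.assoc[symmetric] mult_single plus_list_def)

lemma scale_one: "1 \<cdot> v = v"
  by (simp add: scale_def const_def flip: zero_list_def)

lemma gen_word: "gen x * word v = word (x # v)"
  by (simp add: gen_def word_def mult_single plus_list_def)

lemma gen_scale: "gen x * (c \<cdot> v) = c \<cdot> (gen x * v)"
  by (simp add: gen_def word_def scale_def const_def mult.assoc[symmetric] mult_single plus_list_def)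

lemma gen_scale_word: "gen x * (c \<cdot> word v) = c \<cdot> word (x # v)"
  by (simp add: gen_scale gen_word)

lemma shuffle_words_word: "shuffle q (word u) (word v) = shuffle_words q u v"
  by (simp add: shuffle_def word_def scale_one)

lemma shuffle_one: "shuffle q 1 v = v" "shuffle q v 1 = v"
proof -
  have one: "(1 :: 'a VV) = word []"
    by (metis single_one word_def zero_list_def)
  have "shuffle_words q b [] = word b" for b
    by (cases b) auto
  moreover have "(\<Sum>b\<in>Poly_Mapping.keys v. Poly_Mapping.lookup v b \<cdot> word b) = v"
    by (intro poly_mapping_eqI)
      (simp add: scale_def const_def word_def mult_single plus_list_def lookup_sum lookup_single
        when_def in_keys_iff)
  ultimately show "shuffle q 1 v = v" "shuffle q v 1 = v"
    unfolding one by (simp_all add: shuffle_def word_def)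
qed

lemma shuffle_letter_word:
  assumes "q \<noteq> 0"
  shows "shuffle q (gen x) (word v) =
    (\<Sum>i=0..length v. q powi (\<Sum>y\<leftarrow>take i v. pairing y x) \<cdot> word (take i v @ x # drop i v))"
proof -
  have "shuffle_words q [x] v =
    (\<Sum>i=0..length v. q powi (\<Sum>y\<leftarrow>take i v. pairing y x) \<cdot> word (take i v @ x # drop i v))"
  proof (induction v)
    case Nil
    then show ?case by (simp add: scale_one)
  next
    case (Cons y v)
    have "pairing x y = pairing y x" by (simp add: pairing_def)
    with Cons assms show ?case
      by (simp add: sum.atLeast0_atMost_Suc_shift gen_word scale_one scale_sum sum_distrib_left
          gen_scale_word scale_scale power_int_add del: sum.cl_ivl_Suc)
  qed
  then show ?thesis
    by (simp add: gen_def shuffle_words_word)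
qed

lemma shuffle_word_letter:
  assumes "q \<noteq> 0"
  shows "shuffle q (word v) (gen x) =
    (\<Sum>i=0..length v. q powi (\<Sum>y\<leftarrow>drop i v. pairing y x) \<cdot> word (take i v @ x # drop i v))"
proof -
  have "shuffle_words q v [x] =
    (\<Sum>i=0..length v. q powi (\<Sum>y\<leftarrow>drop i v. pairing y x) \<cdot> word (take i v @ x # drop i v))"
  proof (induction v)
    case Nil
    then show ?case by (simp add: scale_one)
  next
    case (Cons y v)
    with assms show ?case
      by (simp add: sum.atLeast0_atMost_Suc_shift gen_word scale_one scale_sum sum_distrib_left
          gen_scale_word scale_scale add.commute del: sum.cl_ivl_Suc)
  qed
  then show ?thesis
    by (simp add: gen_def shuffle_words_word)
qed


section \<open>The quotient \<open>\<V>/J\<close> as a \<open>\<box>\<^sub>q\<close>-module\<close>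

definition J :: "'k::field \<Rightarrow> 'k VV set"
  where "J q = Idl\<^bsub>ring_of_type_algebra\<^esub>
    {qSerre q (gen LA) (gen LB), qSerre q (gen LB) (gen LA)}"

definition VJ :: "'k::field \<Rightarrow> 'k VV set ring"
  where "VJ q = ring_of_type_algebra Quot (J q)"

definition VJ_class :: "'k::field \<Rightarrow> 'k VV \<Rightarrow> 'k VV set"
  where "VJ_class q v = J q +>\<^bsub>ring_of_type_algebra\<^esub> v"

text \<open>
  \<open>M\<close> is a \<open>\<box>\<^sub>q\<close>-module whose underlying vector space is \<open>\<V>/J\<close> and on which each \<open>x\<^sub>i\<close> acts as the
  map that \<open>X\<^sub>i\<close> induces on cosets; as the last four equations range over all representatives \<open>v\<close>,
  they can hold only if each \<open>X\<^sub>i\<close> does induce a map on \<open>\<V>/J\<close>.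
\<close>

definition box_module_on_VJ ::
    "'k::field \<Rightarrow> ('k VV \<Rightarrow> 'k VV) \<Rightarrow> ('k VV \<Rightarrow> 'k VV) \<Rightarrow> ('k VV \<Rightarrow> 'k VV) \<Rightarrow> ('k VV \<Rightarrow> 'k VV) \<Rightarrow>
      ((4, 'k) free_alg set, 'k VV set) module \<Rightarrow> bool"
  where "box_module_on_VJ q X0 X1 X2 X3 M \<longleftrightarrow> box_module q M \<and>
    carrier M = carrier (VJ q) \<and> ring.add M = ring.add (VJ q) \<and> \<zero>\<^bsub>M\<^esub> = \<zero>\<^bsub>VJ q\<^esub> \<and>
    (\<forall>c v. box_class q (const c) \<odot>\<^bsub>M\<^esub> VJ_class q v = VJ_class q (c \<cdot> v)) \<and>
    (\<forall>v. box_class q (gen 0) \<odot>\<^bsub>M\<^esub> VJ_class q v = VJ_class q (X0 v)) \<and>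
    (\<forall>v. box_class q (gen 1) \<odot>\<^bsub>M\<^esub> VJ_class q v = VJ_class q (X1 v)) \<and>
    (\<forall>v. box_class q (gen 2) \<odot>\<^bsub>M\<^esub> VJ_class q v = VJ_class q (X2 v)) \<and>
    (\<forall>v. box_class q (gen 3) \<odot>\<^bsub>M\<^esub> VJ_class q v = VJ_class q (X3 v))"

end

theory Submission
  imports Defs
begin

text \<open>
  The adjoint of \<open>A\<^sub>\<ell>\<close> is the skew derivation \<open>dl q LA\<close>, and likewise for the other operators; all relations
  between these operators follow from their commutation with the multiplications by letters.

  The main point is nondegeneracy: an element of \<open>\<V>/J\<close> of positive degree that is killed by both left skew
  derivations is zero. In a minimal degree such an element \<open>v\<close> is also killed by the right ones. If its content
  \<open>(a, b)\<close> has \<open>a < b\<close>, then \<open>v\<close> lies in the subalgebra generated by \<open>A\<close>, \<open>ad B A\<close>, \<open>(ad B)\<^sup>2 A\<close>, on which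
  \<open>ad B\<close> is locally nilpotent, whereas the derivation \<open>B\<^sub>\<ell>\<^sup>*\<close> shows that \<open>(ad B)\<^sup>m v \<noteq> 0\<close> for all \<open>m\<close>. If \<open>a = b\<close>, then
  \<open>v\<close> is primitive for the braided coproduct, so the antipode acts on it as \<open>- 1\<close>, but the square of the
  antipode acts on this content by a power of \<open>q\<close> with nonzero exponent.

  A rotation argument on words deduces from this that the NIL vectors of rule I are the multiples of \<open>1\<close>,
  so that the module of rule I, which is universal among the NIL modules, is simple; the same rotation shows
  that \<open>1\<close> generates the module of rule II.
\<close>

text \<open>Only rules I and II carry content. All statements are made for a letter \<open>X\<close>
  and its partner \<open>other X\<close>, which yields the T-variants, and word reversal preserves
  \<open>J\<close> and exchanges left with right operators, which yields the S-variants. For rule II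
  the Serre relation between x_0 and x_2 holds only modulo \<open>J\<close>. It is obtained by
  differentiating the defect, so nondegeneracy is needed even to know that the operators define a
  module. Uniqueness of the NIL module comes from the annihilator of a NIL vector. Moving x_1 and
  x_3 to the right across words in x_0 and x_2 reproduces the operators of rule I in every NIL
  module, so this left ideal is determined as soon as rule I on \<V>/J has no NIL vectors besides
  the scalars. That \<open>q\<close> is not a root of unity enters through scalars 1 - q^n: in the
  q-integers of the filtration by powers of a letter, in the coefficient \<open>\<mu>\<close> of the
  raising argument, in the square of the antipode, and in the double rotation of a word.\<close>

no_notation ideal_prod (infixl \<open>\<cdot>\<index>\<close> 80)
no_notation Polynomials.var (\<open>X\<index>\<close>)

abbreviation "lookup \<equiv> Poly_Mapping.lookup"
abbreviation "keys \<equiv> Poly_Mapping.keys"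

section \<open>Linear maps on a free algebra\<close>

lemma word_mult: "word u * word v = (word (u @ v) :: ('g, 'k::field) free_alg)"
  by (simp add: word_def mult_single plus_list_def)

lemma one_word: "(1 :: ('g, 'k::field) free_alg) = word []"
  by (metis single_one word_def zero_list_def)

lemma lookup_word: "lookup (word u :: ('g, 'k::field) free_alg) w = (if u = w then 1 else 0)"
  by (simp add: word_def lookup_single when_def)

lemma scale_left_add: "(c + d) \<cdot> v = c \<cdot> v + d \<cdot> v"
  by (simp add: scale_def const_def single_add distrib_right)

lemma lookup_scale [simp]: "lookup (c \<cdot> v) w = c * lookup v w"
  by (simp add: scale_def const_def Poly_Mapping.map.rep_eq when_def
      flip: zero_list_def mult_map_scale_conv_mult)

lemma scale_zero_left [simp]: "0 \<cdot> v = 0"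
  by (rule poly_mapping_eqI) simp

lemma scale_minus: "(- c) \<cdot> v = - (c \<cdot> v)"
  by (simp add: poly_mapping_eq_iff fun_eq_iff)

lemma scale_diff: "c \<cdot> (u - v) = c \<cdot> u - c \<cdot> v" "(c - d) \<cdot> v = c \<cdot> v - d \<cdot> v"
  by (simp_all add: poly_mapping_eq_iff fun_eq_iff lookup_minus algebra_simps)

declare scale_one [simp] scale_zero [simp]

interpretation free_alg: vector_space "scale :: 'k::field \<Rightarrow> ('g, 'k) free_alg \<Rightarrow> ('g, 'k) free_alg"
  by unfold_locales (simp_all add: scale_add scale_left_add scale_scale)

abbreviation subspace :: "('g, 'k::field) free_alg set \<Rightarrow> bool" where "subspace \<equiv> free_alg.subspace"
abbreviation span :: "('g, 'k::field) free_alg set \<Rightarrow> ('g, 'k) free_alg set" where "span \<equiv> free_alg.span"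

lemmas subspace_add = free_alg.subspace_add
  and subspace_diff = free_alg.subspace_diff
  and subspace_scale = free_alg.subspace_scale
  and subspace_neg = free_alg.subspace_neg
  and subspace_0 = free_alg.subspace_0
  and subspace_sum = free_alg.subspace_sum

lemma word_expansion: "v = (\<Sum>w\<in>keys v. lookup v w \<cdot> word w)"
  by (rule poly_mapping_eqI)
     (simp add: lookup_sum lookup_word if_distrib if_distribR in_keys_iff cong: if_cong)

lemma subspace_UNIV_I:
  assumes "subspace S" "\<And>w. word w \<in> S"
  shows "v \<in> S"
  by (subst word_expansion) (intro subspace_sum subspace_scale assms)

lemma scale_mult_left [simp]: "(c \<cdot> u) * v = c \<cdot> (u * v)"
  by (simp add: scale_def mult.assoc)

lemma mult_scale_right [simp]: "u * (c \<cdot> v) = c \<cdot> (u * v)"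
proof -
  have "word w * const c = const c * word w" for w :: "'a list"
    by (simp add: word_def const_def mult_single plus_list_def)
  then have w: "word w * (c \<cdot> v) = c \<cdot> (word w * v)" for w
    unfolding scale_def by (metis mult.assoc)
  have "subspace {u. u * (c \<cdot> v) = c \<cdot> (u * v)}"
    by (simp add: free_alg.subspace_def distrib_right scale_add scale_scale mult.commute[of c])
  from subspace_UNIV_I[OF this] w show ?thesis by simp
qed

definition lin :: "(('g, 'k::field) free_alg \<Rightarrow> ('h, 'k) free_alg) \<Rightarrow> bool"
  where "lin T \<longleftrightarrow> (\<forall>u v. T (u + v) = T u + T v) \<and> (\<forall>c v. T (c \<cdot> v) = c \<cdot> T v)"

lemma linI: "(\<And>u v. T (u + v) = T u + T v) \<Longrightarrow> (\<And>c v. T (c \<cdot> v) = c \<cdot> T v) \<Longrightarrow> lin T"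
  by (simp add: lin_def)

lemma lin_iff_linear: "lin T \<longleftrightarrow> Vector_Spaces.linear scale scale T"
  by (simp add: lin_def Vector_Spaces.linear_iff free_alg.vector_space_axioms)

lemma
  assumes "lin T"
  shows lin_add: "T (u + v) = T u + T v" and lin_scale: "T (c \<cdot> v) = c \<cdot> T v"
    and lin_zero: "T 0 = 0" and lin_neg: "T (- v) = - T v" and lin_diff: "T (u - v) = T u - T v"
proof -
  show a: "T (u + v) = T u + T v" and s: "T (c \<cdot> v) = c \<cdot> T v" for u v c
    using assms by (auto simp: lin_def)
  show "T 0 = 0" using s[of 0] by simp
  show n: "T (- v) = - T v" for v using s[of "-1" v] by (simp add: scale_minus)
  show "T (u - v) = T u - T v" using a[of u "- v"] by (simp add: n)
qed

lemma lin_sum: "lin T \<Longrightarrow> T (\<Sum>i\<in>I. f i) = (\<Sum>i\<in>I. T (f i))"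
  by (induction I rule: infinite_finite_induct) (simp_all add: lin_zero[of T] lin_add[of T])

lemma lin_eqI:
  assumes "lin S" "lin T" "\<And>w. S (word w) = T (word w)"
  shows "S v = T v"
  by (subst (1 2) word_expansion)
     (simp add: lin_sum[OF assms(1)] lin_sum[OF assms(2)] lin_scale[OF assms(1)] lin_scale[OF assms(2)] assms(3))

lemma lin_id: "lin (\<lambda>v. v)" and lin_const_zero: "lin (\<lambda>v. 0)"
  by (simp_all add: lin_def)

lemma lin_mult_left: "lin T \<Longrightarrow> lin (\<lambda>v. u * T v)" and lin_mult_right: "lin T \<Longrightarrow> lin (\<lambda>v. T v * u)"
  by (simp_all add: lin_def distrib_left distrib_right)

lemma lin_scale_map: "lin T \<Longrightarrow> lin (\<lambda>v. c \<cdot> T v)"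
  by (simp add: lin_def scale_add scale_scale mult.commute)

lemma lin_plus: "lin S \<Longrightarrow> lin T \<Longrightarrow> lin (\<lambda>v. S v + T v)"
  and lin_minus: "lin S \<Longrightarrow> lin T \<Longrightarrow> lin (\<lambda>v. S v - T v)"
  by (simp_all add: lin_def scale_add scale_diff)

lemma lin_comp: "lin S \<Longrightarrow> lin T \<Longrightarrow> lin (\<lambda>v. S (T v))"
  by (simp add: lin_def)

lemma lin_sum_map: "(\<And>i. i \<in> I \<Longrightarrow> lin (T i)) \<Longrightarrow> lin (\<lambda>v. \<Sum>i\<in>I. T i v)"
  by (induction I rule: infinite_finite_induct) (auto simp: lin_const_zero intro!: lin_plus)

lemma lin_coeff_scale: "lin (\<lambda>v. lookup v w \<cdot> u)"
  by (rule linI) (simp_all add: lookup_add scale_left_add scale_scale)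

lemmas lin_intros = lin_id lin_const_zero lin_mult_left lin_mult_right lin_scale_map lin_plus lin_minus
  lin_sum_map lin_coeff_scale

definition lin_ext :: "('g list \<Rightarrow> ('h, 'k::field) free_alg) \<Rightarrow> ('g, 'k) free_alg \<Rightarrow> ('h, 'k) free_alg"
  where "lin_ext f v = (\<Sum>w\<in>keys v. lookup v w \<cdot> f w)"

lemma lin_ext_superset:
  "finite S \<Longrightarrow> keys v \<subseteq> S \<Longrightarrow> lin_ext f v = (\<Sum>w\<in>S. lookup v w \<cdot> f w)"
  unfolding lin_ext_def by (rule sum.mono_neutral_left) (auto simp: in_keys_iff)

lemma lin_lin_ext: "lin (lin_ext f)"
proof (rule linI)
  fix u v c
  have "lin_ext f (u + v) = (\<Sum>w\<in>keys u \<union> keys v. lookup (u + v) w \<cdot> f w)"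
    by (intro lin_ext_superset) (auto simp: in_keys_iff lookup_add)
  also have "\<dots> = lin_ext f u + lin_ext f v"
    by (simp add: lookup_add scale_left_add sum.distrib lin_ext_superset[of "keys u \<union> keys v"])
  finally show "lin_ext f (u + v) = lin_ext f u + lin_ext f v" .
  have "lin_ext f (c \<cdot> v) = (\<Sum>w\<in>keys v. lookup (c \<cdot> v) w \<cdot> f w)"
    by (intro lin_ext_superset) (auto simp: in_keys_iff)
  then show "lin_ext f (c \<cdot> v) = c \<cdot> lin_ext f v"
    by (simp add: lin_ext_def scale_sum scale_scale)
qed

lemma keys_word [simp]: "keys (word w :: ('g, 'k::field) free_alg) = {w}"
  by (simp add: word_def)

lemma lin_ext_word [simp]: "lin_ext f (word w) = f w"
  by (simp add: lin_ext_def lookup_word)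

lemma word_Cons: "word (x # w) = gen x * word w" and word_snoc: "word (w @ [x]) = word w * gen x"
  by (simp_all add: gen_def word_mult)

text \<open>Most operators below are controlled by how they pass left multiplication by a letter, so
  this induction replaces computation on words.\<close>

lemma mult_induct_left:
  assumes "lin S" "lin T" "S 1 = T 1"
    and "\<And>x v. S v = T v \<Longrightarrow> S (gen x * v) = T (gen x * v)"
  shows "S v = T v"
proof (rule lin_eqI[OF assms(1,2)])
  fix w show "S (word w) = T (word w)"
    by (induction w) (use assms in \<open>auto simp: word_Cons simp flip: one_word\<close>)
qed

lemma subspace_vimage: "lin T \<Longrightarrow> subspace S \<Longrightarrow> subspace {v. T v \<in> S}"
  by (simp add: free_alg.subspace_def lin_zero[of T] lin_add[of T] lin_scale[of T])

lemma mult_closed_right: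
  assumes "subspace S" "\<And>x v. v \<in> S \<Longrightarrow> v * gen x \<in> S" "v \<in> S"
  shows "v * u \<in> S"
proof -
  have "v * word w \<in> S" for w
    by (induction w rule: rev_induct)
       (use assms in \<open>auto simp: word_snoc simp flip: one_word mult.assoc\<close>)
  then show ?thesis
    using subspace_UNIV_I[OF subspace_vimage[OF lin_mult_left[OF lin_id] assms(1)], of v u] by simp
qed

lemma mult_closed_left:
  assumes "subspace S" "\<And>x v. v \<in> S \<Longrightarrow> gen x * v \<in> S" "v \<in> S"
  shows "u * v \<in> S"
proof -
  have "word w * v \<in> S" for w
    by (induction w) (use assms in \<open>auto simp: word_Cons mult.assoc simp flip: one_word\<close>)
  then show ?thesis
    using subspace_UNIV_I[OF subspace_vimage[OF lin_mult_right[OF lin_id] assms(1)], of v u] by simp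
qed

section \<open>Ideals of a free algebra\<close>

lemma ring_rta: "ring (ring_of_type_algebra :: ('g, 'k::field) free_alg ring)"
proof -
  have "\<exists>y. x + y = 0" for x :: "('g, 'k) free_alg"
    by (rule exI[of _ "- x"]) simp
  then show ?thesis
    unfolding ring_of_type_algebra_def using add.right_inverse
    by unfold_locales (auto simp: algebra_simps Units_def)
qed

definition is_ideal :: "('g, 'k::field) free_alg set \<Rightarrow> bool"
  where "is_ideal I \<longleftrightarrow> subspace I \<and> (\<forall>u v. v \<in> I \<longrightarrow> u * v \<in> I \<and> v * u \<in> I)"

lemma is_ideal_iff: "is_ideal I \<longleftrightarrow> ideal I ring_of_type_algebra"
proof
  assume I: "is_ideal I"
  show "ideal I ring_of_type_algebra"
  proof (rule idealI[OF ring_rta])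
    have "a_inv (ring_of_type_algebra :: ('a, 'b) free_alg ring) x = - x" for x :: "('a, 'b) free_alg"
      using ring_rta[where ?'g = 'a and ?'k = 'b]
      by (intro abelian_group.minus_equality[OF ring.is_abelian_group]) (auto simp: ring_of_type_algebra_def)
    then show "subgroup I (add_monoid ring_of_type_algebra)"
      using I abelian_group.a_group[OF ring.is_abelian_group[OF ring_rta]]
      by (intro group.subgroupI)
         (auto simp: is_ideal_def ring_of_type_algebra_def subspace_add subspace_neg a_inv_def
           dest: subspace_0)
  qed (use I in \<open>auto simp: is_ideal_def ring_of_type_algebra_def\<close>)
next
  assume "ideal I ring_of_type_algebra"
  then interpret ideal I "ring_of_type_algebra :: ('a, 'b) free_alg ring" .
  have m: "u * v \<in> I" "v * u \<in> I" if "v \<in> I" for u v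
    using I_l_closed[OF that] I_r_closed[OF that] by (auto simp: ring_of_type_algebra_def)
  have "c \<cdot> v \<in> I" if "v \<in> I" for c v
    using m[OF that] by (simp add: scale_def)
  then show "is_ideal I"
    using m additive_subgroup.a_closed[OF is_additive_subgroup] additive_subgroup.zero_closed[OF is_additive_subgroup]
    by (simp add: is_ideal_def free_alg.subspace_def ring_of_type_algebra_def)
qed

abbreviation gen_ideal :: "('g, 'k::field) free_alg set \<Rightarrow> ('g, 'k) free_alg set"
  where "gen_ideal S \<equiv> genideal ring_of_type_algebra S"

lemma is_ideal_gen_ideal: "is_ideal (gen_ideal S)"
  unfolding is_ideal_iff by (rule ring.genideal_ideal[OF ring_rta]) (simp add: ring_of_type_algebra_def)

lemma gen_ideal_superset: "S \<subseteq> gen_ideal S"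
  by (rule ring.genideal_self[OF ring_rta]) (simp add: ring_of_type_algebra_def)

lemma gen_ideal_minimal: "is_ideal I \<Longrightarrow> S \<subseteq> I \<Longrightarrow> gen_ideal S \<subseteq> I"
  by (simp add: is_ideal_iff ring.genideal_minimal[OF ring_rta])

section \<open>Skew derivations of the free algebra on two letters\<close>

abbreviation pw :: "'k::field \<Rightarrow> letter \<Rightarrow> letter \<Rightarrow> 'k" where "pw q X Y \<equiv> q powi pairing X Y"

primrec other :: "letter \<Rightarrow> letter" where "other LA = LB" | "other LB = LA"

lemma other_other [simp]: "other (other X) = X" and other_neq [simp]: "other X \<noteq> X" "X \<noteq> other X"
  by (cases X; simp)+

lemma letter_cases: "Y = X \<or> Y = other X"
  by (cases X; cases Y) auto

lemma pairing_commute: "pairing X Y = pairing Y X"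
  by (simp add: pairing_def)

lemma pairing_other: "pairing (other X) Y = - pairing X Y" "pairing Y (other X) = - pairing Y X"
  by (cases X; cases Y; simp add: pairing_def)+

lemma pw_simps [simp]: "pw q X X = q\<^sup>2" "pw q X (other X) = inverse (q\<^sup>2)" "pw q (other X) X = inverse (q\<^sup>2)"
  by (simp_all add: pairing_def power_int_minus)

definition weight :: "letter \<Rightarrow> letter list \<Rightarrow> int" where "weight X w = (\<Sum>y\<leftarrow>w. pairing X y)"

lemma weight_simps [simp]:
  "weight X [] = 0" "weight X (x # w) = pairing X x + weight X w" "weight X (u @ w) = weight X u + weight X w"
  "weight X (rev w) = weight X w"
  by (simp_all add: weight_def rev_map[symmetric])

lemma weight_other [simp]: "weight (other X) w = - weight X w"
  by (induction w) (auto simp: pairing_other)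

definition diag :: "(letter list \<Rightarrow> 'k) \<Rightarrow> 'k::field VV \<Rightarrow> 'k VV"
  where "diag f = lin_ext (\<lambda>w. f w \<cdot> word w)"

text \<open>Indexing by a letter absorbs the inverse: \<open>weight (other X)\<close> is
  \<open>- weight X\<close>, so \<open>Kx q LA\<close> is K and \<open>Kx q LB\<close> is its
  inverse.\<close>

definition Kx :: "'k::field \<Rightarrow> letter \<Rightarrow> 'k VV \<Rightarrow> 'k VV"
  where "Kx q X = diag (\<lambda>w. q powi weight X w)"

definition revV :: "'k::field VV \<Rightarrow> 'k VV" where "revV = lin_ext (\<lambda>w. word (rev w))"

text \<open>The left skew derivation in the sense of Lusztig: it sends \<open>X\<close> to 1 and the
  other letter to 0, and each letter passed contributes \<open>pw q X x\<close>.\<close>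

primrec dl_word :: "'k::field \<Rightarrow> letter \<Rightarrow> letter list \<Rightarrow> 'k VV"
  where "dl_word q X [] = 0"
  | "dl_word q X (x # w) = (if x = X then word w else 0) + pw q X x \<cdot> (gen x * dl_word q X w)"

definition dl :: "'k::field \<Rightarrow> letter \<Rightarrow> 'k VV \<Rightarrow> 'k VV" where "dl q X = lin_ext (dl_word q X)"

text \<open>As the reversal of \<open>dl\<close>, the right derivation inherits every rule: what
  \<open>dl\<close> does under right multiplication becomes \<open>dr_L\<close>.\<close>

definition dr :: "'k::field \<Rightarrow> letter \<Rightarrow> 'k VV \<Rightarrow> 'k VV" where "dr q X v = revV (dl q X (revV v))"

lemma lin_diag: "lin (diag f)" and lin_Kx: "lin (Kx q X)" and lin_revV: "lin revV" and lin_dl: "lin (dl q X)"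
  by (simp_all add: diag_def Kx_def revV_def dl_def lin_lin_ext)

lemma lin_dr: "lin (dr q X)"
  unfolding dr_def by (intro lin_comp[OF lin_revV] lin_comp[OF lin_dl] lin_revV)

lemmas lin_comps = lin_comp[OF lin_diag] lin_comp[OF lin_Kx] lin_comp[OF lin_revV] lin_comp[OF lin_dl]
  lin_comp[OF lin_dr]

lemmas lin_rules = lin_diag lin_Kx lin_revV lin_dl lin_dr lin_intros lin_comps

lemmas lin_simps [simp] = lin_add[OF lin_diag] lin_add[OF lin_Kx] lin_add[OF lin_revV] lin_add[OF lin_dl] lin_add[OF lin_dr]
  lin_scale[OF lin_diag] lin_scale[OF lin_Kx] lin_scale[OF lin_revV] lin_scale[OF lin_dl] lin_scale[OF lin_dr]
  lin_zero[OF lin_diag] lin_zero[OF lin_Kx] lin_zero[OF lin_revV] lin_zero[OF lin_dl] lin_zero[OF lin_dr]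
  lin_neg[OF lin_diag] lin_neg[OF lin_Kx] lin_neg[OF lin_revV] lin_neg[OF lin_dl] lin_neg[OF lin_dr]
  lin_diff[OF lin_diag] lin_diff[OF lin_Kx] lin_diff[OF lin_revV] lin_diff[OF lin_dl] lin_diff[OF lin_dr]

lemma diag_word [simp]: "diag f (word w) = f w \<cdot> word w"
  and Kx_word [simp]: "Kx q X (word w) = q powi weight X w \<cdot> word w"
  and revV_word [simp]: "revV (word w) = word (rev w)"
  and dl_word_eq [simp]: "dl q X (word w) = dl_word q X w"
  by (simp_all add: diag_def Kx_def revV_def dl_def)

lemma one_images [simp]: "Kx q X 1 = 1" "revV 1 = 1" "dl q X 1 = 0" "dr q X 1 = 0"
  by (simp_all add: one_word dr_def lin_zero[OF lin_revV])

lemma revV_revV [simp]: "revV (revV v) = v"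
  by (rule lin_eqI) (auto intro!: lin_rules)

lemma revV_L: "revV (gen x * v) = revV v * gen x"
  by (rule lin_eqI) (auto intro!: lin_rules simp: gen_def word_mult)

lemma revV_R: "revV (v * gen x) = gen x * revV v"
  by (rule lin_eqI) (auto intro!: lin_rules simp: gen_def word_mult)

lemma revV_mult: "revV (u * v) = revV v * revV u"
  by (rule mult_induct_left[where v = u]) (auto intro!: lin_rules simp: mult.assoc revV_L)

lemma revV_Kx: "revV (Kx q X v) = Kx q X (revV v)"
  by (rule lin_eqI) (auto intro!: lin_rules simp: lin_simps)

lemma dl_L: "dl q X (gen x * v) = (if x = X then v else 0) + pw q X x \<cdot> (gen x * dl q X v)"
proof -
  have "lin (\<lambda>v. (if x = X then v else 0) + pw q X x \<cdot> (gen x * dl q X v))"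
    by (cases "x = X") (auto intro!: lin_rules)
  then show ?thesis
    by (rule lin_eqI[where S = "\<lambda>v. dl q X (gen x * v)", rotated])
       (auto intro!: lin_rules simp flip: word_Cons)
qed

context
  fixes q :: "'k::field"
  assumes q0: "q \<noteq> 0"
begin

lemma Kx_L: "Kx q X (gen x * v) = pw q X x \<cdot> (gen x * Kx q X v)"
  by (rule lin_eqI[where v = v]) (use q0 in \<open>auto intro!: lin_rules simp: scale_scale power_int_add simp flip: word_Cons\<close>)

lemma Kx_other: "Kx q (other X) (Kx q X v) = v" "Kx q X (Kx q (other X) v) = v"
  by (rule lin_eqI[where v = v];
      use q0 in \<open>auto intro!: lin_rules simp: scale_scale power_int_minus lin_simps\<close>)+

lemma Kx_mult: "Kx q X (u * v) = Kx q X u * Kx q X v"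
  by (rule mult_induct_left[where v = u])
     (auto intro!: lin_rules lin_mult_left[OF lin_Kx] simp: mult.assoc Kx_L)

lemma dl_Kx: "dl q X (Kx q Y v) = pw q X Y \<cdot> Kx q Y (dl q X v)"
proof (rule mult_induct_left[where v = v])
  fix x v assume IH: "dl q X (Kx q Y v) = pw q X Y \<cdot> Kx q Y (dl q X v)"
  show "dl q X (Kx q Y (gen x * v)) = pw q X Y \<cdot> Kx q Y (dl q X (gen x * v))"
    using q0 by (simp add: Kx_L dl_L lin_simps IH scale_scale scale_add mult_ac pairing_commute)
qed (auto intro!: lin_rules)

text \<open>The last letter is reached only after all of \<open>v\<close> has been passed, so the
  scalar twists accumulate to \<open>Kx q X v\<close>.\<close>

lemma dl_R: "dl q X (v * gen x) = dl q X v * gen x + (if x = X then Kx q X v else 0)"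
proof (rule mult_induct_left[where v = v])
  show "lin (\<lambda>v. dl q X v * gen x + (if x = X then Kx q X v else 0))"
    by (cases "x = X") (auto intro!: lin_rules)
  fix y v assume IH: "dl q X (v * gen x) = dl q X v * gen x + (if x = X then Kx q X v else 0)"
  show "dl q X ((gen y * v) * gen x) = dl q X (gen y * v) * gen x + (if x = X then Kx q X (gen y * v) else 0)"
    by (simp add: mult.assoc dl_L IH Kx_L distrib_left distrib_right scale_add)
qed (use dl_L[of q X x 1] in \<open>auto intro!: lin_rules\<close>)

lemma dr_R: "dr q X (v * gen x) = (if x = X then v else 0) + pw q X x \<cdot> (dr q X v * gen x)"
  by (simp add: dr_def revV_R revV_L dl_L lin_simps)

lemma dr_L: "dr q X (gen x * v) = gen x * dr q X v + (if x = X then Kx q X v else 0)"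
  by (simp add: dr_def revV_R revV_L dl_R lin_simps revV_Kx)

lemma dr_Kx: "dr q X (Kx q Y v) = pw q X Y \<cdot> Kx q Y (dr q X v)"
  by (simp add: dr_def revV_Kx dl_Kx lin_simps)

text \<open>The delicate case is \<open>x = Y\<close>: \<open>dl_Kx\<close> extracts
  \<open>pw q X Y\<close> from the term \<open>Kx q Y v\<close> of \<open>dr_L\<close>, which is the
  scalar that \<open>dl_L\<close> puts in front of the same term in the other order.\<close>

lemma dl_dr: "dl q X (dr q Y v) = dr q Y (dl q X v)"
proof (rule mult_induct_left[where v = v])
  fix x v assume IH: "dl q X (dr q Y v) = dr q Y (dl q X v)"
  show "dl q X (dr q Y (gen x * v)) = dr q Y (dl q X (gen x * v))"
    by (auto simp: dr_L dl_L lin_simps IH dl_Kx scale_add algebra_simps)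
qed (auto intro!: lin_rules)

subsection \<open>The adjoints of multiplication by a letter in the shuffle algebra\<close>

lemma lookup_gen_mult:
  fixes v :: "('g, 'a::field) free_alg"
  shows "lookup (gen x * v) w = (case w of [] \<Rightarrow> 0 | y # w' \<Rightarrow> if x = y then lookup v w' else 0)"
proof -
  have "subspace {v. lookup (gen x * v) w = (case w of [] \<Rightarrow> 0 | y # w' \<Rightarrow> if x = y then lookup v w' else 0)}"
    by (cases w) (auto simp: free_alg.subspace_def distrib_left lookup_add)
  from subspace_UNIV_I[OF this, of v] show ?thesis
    by (auto simp: lookup_word simp flip: word_Cons split: list.splits)
qed

text \<open>Inserting \<open>x\<close> before or behind the first letter corresponds to deleting the
  first letter or a later one, with the same power of \<open>q\<close>; so the two matrices are
  transposes of each other.\<close>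

lemma shuffle_words_letter: "lookup (shuffle_words q [x] u) w = lookup (dl_word q x w) u"
proof (induction u arbitrary: w)
  case Nil
  have "lookup (dl_word q x w) [] = (if w = [x] then 1 else 0)"
    by (cases w) (auto simp: lookup_add lookup_word lookup_gen_mult)
  then show ?case by (simp add: lookup_word)
next
  case (Cons y u)
  show ?case
    using Cons by (cases w) (auto simp: lookup_add lookup_word lookup_gen_mult)
qed

lemma dr_word_Nil [simp]: "dr q X (word []) = 0"
  by (simp flip: one_word)

lemma dr_word_Cons: "dr q X (word (x # w)) = gen x * dr q X (word w) + (if x = X then Kx q X (word w) else 0)"
  by (simp add: word_Cons dr_L del: Kx_word)

lemma shuffle_words_letter_right: "lookup (shuffle_words q u [x]) w = lookup (dr q x (word w)) u"
proof (induction u arbitrary: w)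
  case Nil
  have "lookup (dr q x (word w)) [] = (if w = [x] then 1 else 0)"
    by (cases w) (auto simp: lookup_add lookup_word lookup_gen_mult dr_word_Cons)
  then show ?case by (simp add: lookup_word)
next
  case (Cons y u)
  have "(\<Sum>z\<leftarrow>u. pairing z x) = weight x u"
    by (simp add: weight_def pairing_commute)
  then show ?case
    using Cons by (cases w)
      (auto simp: lookup_add lookup_word lookup_gen_mult dr_word_Cons pairing_commute)
qed

lemma word_form_word: "word_form (word u) v = lookup v u"
  by (simp add: word_form_def lookup_word)

lemma word_form_superset: "finite S \<Longrightarrow> keys u \<subseteq> S \<Longrightarrow> word_form u v = (\<Sum>w\<in>S. lookup u w * lookup v w)"
  unfolding word_form_def by (rule sum.mono_neutral_left) (auto simp: in_keys_iff)

lemma word_form_add: "word_form (u + v) w = word_form u w + word_form v w"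
proof -
  have "word_form (u + v) w = (\<Sum>x\<in>keys u \<union> keys v. lookup (u + v) x * lookup w x)"
    by (intro word_form_superset) (auto simp: in_keys_iff lookup_add)
  then show ?thesis
    by (simp add: lookup_add distrib_right sum.distrib word_form_superset[of "keys u \<union> keys v"])
qed

lemma word_form_scale: "word_form (c \<cdot> u) w = c * word_form u w"
proof -
  have "word_form (c \<cdot> u) w = (\<Sum>x\<in>keys u. lookup (c \<cdot> u) x * lookup w x)"
    by (intro word_form_superset) (auto simp: in_keys_iff)
  then show ?thesis
    by (simp add: word_form_def sum_distrib_left mult.assoc)
qed

lemma word_form_sum: "word_form (\<Sum>i\<in>I. f i) w = (\<Sum>i\<in>I. word_form (f i) w)"
  by (induction I rule: infinite_finite_induct) (auto simp: word_form_add, simp_all add: word_form_def)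

text \<open>As \<open>adj\<close> is a definite description, existence and uniqueness must both be
  supplied. Uniqueness holds because pairing with a word reads off a coefficient, membership in
  \<open>EndV\<close> because row \<open>w\<close> of the matrix of \<open>Y\<close> is the finitely
  supported vector \<open>t w\<close>.\<close>

lemma adj_eqI:
  assumes T: "\<And>u. T (word u) = t u" "lin T" and Y: "lin Y"
    and tY: "\<And>u w. lookup (t u) w = lookup (Y (word w)) u"
  shows "adj T = Y"
proof -
  have form: "word_form (T u) v = word_form u (Y v)" for u v
  proof -
    have Yv: "Y v = (\<Sum>x\<in>keys v. lookup v x \<cdot> Y (word x))"
      by (subst word_expansion) (simp add: lin_sum[OF Y] lin_scale[OF Y])
    have "lookup (Y v) w = word_form (T (word w)) v" for w
    proof -
      have "lookup (Y v) w = (\<Sum>x\<in>keys v. lookup (t w) x * lookup v x)"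
        by (simp add: Yv lookup_sum tY mult.commute)
      also have "\<dots> = (\<Sum>x\<in>keys (t w) \<union> keys v. lookup (t w) x * lookup v x)"
        by (rule sum.mono_neutral_left) (auto simp: in_keys_iff)
      finally show ?thesis
        by (simp add: T(1) word_form_superset[of "keys (t w) \<union> keys v"])
    qed
    then show ?thesis
      by (subst (1) word_expansion[of u], subst (2) word_form_def)
         (simp add: lin_sum[OF T(2)] lin_scale[OF T(2)] word_form_sum word_form_scale)
  qed
  have "finite {u. lookup (Y (word u)) w \<noteq> 0}" for w
  proof -
    have "{u. lookup (Y (word u)) w \<noteq> 0} = keys (t w)"
      by (auto simp: in_keys_iff tY)
    then show ?thesis by simp
  qed
  then have YE: "Y \<in> EndV"
    using Y by (auto simp: EndV_def lin_def)
  show ?thesis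
    unfolding adj_def
  proof (rule the_equality)
    fix Z assume Z: "Z \<in> EndV \<and> (\<forall>u v. word_form (T u) v = word_form u (Z v))"
    show "Z = Y"
    proof (intro ext poly_mapping_eqI)
      fix v w
      show "lookup (Z v) w = lookup (Y v) w"
        using Z form[of "word w" v] by (simp flip: word_form_word)
    qed
  qed (simp add: form YE)
qed

lemma shuffle_expand: "shuffle q u v = (\<Sum>a\<in>keys u. lookup u a \<cdot> (lin_ext (shuffle_words q a) v))"
  unfolding shuffle_def lin_ext_def by (simp add: scale_sum scale_scale)

lemma adj_shL: "adj (shL q x) = dl q x"
proof (rule adj_eqI)
  have *: "shL q x v = lin_ext (shuffle_words q [x]) v" for v
    by (simp add: shL_def shuffle_expand gen_def lookup_word)
  show "lin (shL q x)"
    by (simp add: *[abs_def] lin_lin_ext)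
  show "shL q x (word u) = shuffle_words q [x] u" for u
    by (simp add: *)
qed (simp_all add: lin_dl shuffle_words_letter)

lemma adj_shR: "adj (shR q x) = dr q x"
proof (rule adj_eqI)
  have *: "shR q x v = lin_ext (\<lambda>u. shuffle_words q u [x]) v" for v
    by (simp add: shR_def shuffle_expand gen_def lin_ext_def lookup_word)
  show "lin (shR q x)"
    by (simp add: *[abs_def] lin_lin_ext)
  show "shR q x (word u) = shuffle_words q u [x]" for u
    by (simp add: *)
qed (simp_all add: lin_dr shuffle_words_letter_right)

lemma K_eq: "K q = Kx q LA"
proof
  fix v :: "'k VV"
  let ?h = "\<lambda>x. case x of LA \<Rightarrow> q powi 2 \<cdot> gen LA | LB \<Rightarrow> q powi (-2) \<cdot> gen LB"
  have "prod_list (map ?h w) = q powi weight LA w \<cdot> word w" for w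
    using q0
    by (induction w)
       (auto simp: one_word[symmetric] word_Cons scale_scale power_int_add pairing_def mult.commute split: letter.splits)
  then show "K q v = Kx q LA v"
    unfolding K_def subst_hom_def Kx_def diag_def lin_ext_def by (simp only:)
qed

lemma Kinv_eq: "Kinv q = Kx q LB"
proof -
  have "inv_into UNIV (Kx q LA) = Kx q LB"
    by (rule inv_equality) (use Kx_other[of LA] in simp_all)
  then show ?thesis by (simp add: Kinv_def K_eq)
qed

end

section \<open>The ideal generated by the \<open>q\<close>-Serre relations\<close>

definition supported :: "('g list \<Rightarrow> bool) \<Rightarrow> ('g, 'k::field) free_alg set"
  where "supported P = {v. \<forall>w. lookup v w \<noteq> 0 \<longrightarrow> P w}"

lemma subspace_supported: "subspace (supported P)"
  by (auto simp: supported_def free_alg.subspace_def lookup_add) (metis add_0)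

lemma word_in_supported [simp]: "word w \<in> (supported P :: ('g, 'k::field) free_alg set) \<longleftrightarrow> P w"
  by (auto simp: supported_def lookup_word)

lemma supported_induct:
  assumes "v \<in> supported P" "subspace S" "lin T" "\<And>w. P w \<Longrightarrow> T (word w) \<in> S"
  shows "T v \<in> S"
  using assms(1)
  by (subst word_expansion)
     (auto simp: lin_sum[OF assms(3)] lin_scale[OF assms(3)] supported_def in_keys_iff
       intro!: subspace_sum[OF assms(2)] subspace_scale[OF assms(2)] assms(4))

definition content :: "letter \<Rightarrow> nat \<Rightarrow> nat \<Rightarrow> letter list \<Rightarrow> bool"
  where "content X a b w \<longleftrightarrow> count_list w X = a \<and> count_list w (other X) = b"

lemma content_other: "content (other X) a b w \<longleftrightarrow> content X b a w"
  by (auto simp: content_def)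

lemma content_length: "content X a b w \<Longrightarrow> length w = a + b"
proof (induction w arbitrary: a b)
  case (Cons x w)
  then show ?case
    using letter_cases[of x X] Cons.IH by (auto simp: content_def split: if_splits)
qed (simp add: content_def)

lemma content_append: "content X a b u \<Longrightarrow> content X c d w \<Longrightarrow> content X (a + c) (b + d) (u @ w)"
  by (simp add: content_def)

lemma weight_content: "content X a b w \<Longrightarrow> weight X w = 2 * (int a - int b)"
proof (induction w arbitrary: a b)
  case (Cons x w)
  then show ?case
    using letter_cases[of x X] Cons.IH by (auto simp: content_def pairing_def)
qed (simp add: content_def)

abbreviation homog :: "letter \<Rightarrow> nat \<Rightarrow> nat \<Rightarrow> 'k::field VV set"
  where "homog X a b \<equiv> supported (content X a b)"

lemma homog_other: "homog (other X) a b = homog X b a"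
  by (simp add: supported_def content_other)

lemma homog_L: "v \<in> homog X a b \<Longrightarrow> gen X * v \<in> homog X (Suc a) b"
  and homog_L_other: "v \<in> homog X a b \<Longrightarrow> gen (other X) * v \<in> homog X a (Suc b)"
  and homog_R: "v \<in> homog X a b \<Longrightarrow> v * gen X \<in> homog X (Suc a) b"
  and homog_R_other: "v \<in> homog X a b \<Longrightarrow> v * gen (other X) \<in> homog X a (Suc b)"
  by (rule supported_induct, assumption, rule subspace_supported,
      (rule lin_rules)+, simp add: content_def flip: word_Cons word_snoc)+

lemma homog_mult: "u \<in> homog X a b \<Longrightarrow> v \<in> homog X c d \<Longrightarrow> u * v \<in> homog X (a + c) (b + d)"
proof (rule supported_induct[where T = "\<lambda>u. u * v" and v = u])
  fix w assume "content X a b w" "v \<in> homog X c d"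
  then show "word w * v \<in> homog X (a + c) (b + d)"
    by (intro supported_induct[OF _ subspace_supported lin_mult_left[OF lin_id], where v = v and P = "content X c d"])
       (auto intro: content_append simp: word_mult)
qed (auto intro!: lin_rules subspace_supported)

lemma one_homog [simp]: "1 \<in> homog X 0 0"
  by (simp add: one_word content_def)

lemma gen_homog [simp]: "gen X \<in> homog X 1 0" "gen (other X) \<in> homog X 0 1"
  by (simp_all add: gen_def content_def)

lemma diag_eigen:
  assumes "v \<in> supported P" "\<And>w. P w \<Longrightarrow> f w = c"
  shows "diag f v = c \<cdot> v"
proof -
  have "diag f v - c \<cdot> v \<in> {0}"
    by (rule supported_induct[OF assms(1), where T = "\<lambda>v. diag f v - c \<cdot> v"])
       (auto intro!: lin_rules simp: assms(2))
  then show ?thesis by simp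
qed

lemma Kx_homog: "v \<in> homog X a b \<Longrightarrow> Kx q X v = q powi (2 * (int a - int b)) \<cdot> v"
  unfolding Kx_def by (erule diag_eigen) (simp add: weight_content)

lemma homog_Kx: "v \<in> homog X a b \<Longrightarrow> Kx q Y v \<in> homog X a b"
  by (rule supported_induct, assumption, rule subspace_supported)
     (auto intro!: lin_rules subspace_scale subspace_supported)

lemma revV_homog: "v \<in> homog X a b \<Longrightarrow> revV v \<in> homog X a b"
  by (rule supported_induct, assumption, rule subspace_supported)
     (auto intro!: lin_rules simp: content_def)

definition proj :: "letter \<Rightarrow> nat \<Rightarrow> nat \<Rightarrow> 'k::field VV \<Rightarrow> 'k VV"
  where "proj X a b = diag (\<lambda>w. if content X a b w then 1 else 0)"

lemma lin_proj: "lin (proj X a b)"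
  by (simp add: proj_def lin_diag)

lemma proj_word: "proj X a b (word w) = (if content X a b w then word w else 0)"
  by (simp add: proj_def)

lemma proj_id: "v \<in> homog X a b \<Longrightarrow> proj X a b v = v"
  using diag_eigen[of v "content X a b" "\<lambda>w. if content X a b w then 1 else 0" 1] by (simp add: proj_def)

lemma proj_other: "v \<in> homog X a b \<Longrightarrow> (a, b) \<noteq> (c, d) \<Longrightarrow> proj X c d v = 0"
  unfolding proj_def by (subst diag_eigen[where c = 0 and P = "content X a b"]) (auto simp: content_def)

lemma proj_homog: "proj X a b v \<in> homog X a b"
proof -
  have "v \<in> {v. proj X a b v \<in> homog X a b}"
    by (rule subspace_UNIV_I)
       (auto simp: proj_word subspace_0 subspace_supported intro!: subspace_vimage lin_proj)
  then show ?thesis by simp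
qed

lemma proj_sum:
  fixes v :: "'k::field VV"
  assumes "finite S" "\<And>w. lookup v w \<noteq> 0 \<Longrightarrow> (count_list w X, count_list w (other X)) \<in> S"
  shows "v = (\<Sum>(a, b)\<in>S. proj X a b v)"
proof -
  let ?T = "\<lambda>v :: 'k VV. v - (\<Sum>p\<in>S. proj X (fst p) (snd p) v)"
  have "?T v \<in> {0}"
  proof (rule supported_induct[where T = ?T and v = v])
    show "v \<in> supported (\<lambda>w. (count_list w X, count_list w (other X)) \<in> S)"
      using assms by (simp add: supported_def)
    fix w assume "(count_list w X, count_list w (other X)) \<in> S"
    moreover have "proj X (fst p) (snd p) (word w :: 'k VV) =
        (if p = (count_list w X, count_list w (other X)) then word w else 0)" for p
      by (cases p) (auto simp: proj_word content_def)
    ultimately have "(\<Sum>p\<in>S. proj X (fst p) (snd p) (word w :: 'k VV)) = word w"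
      using assms(1) by (subst sum.cong[OF refl]) (assumption, simp)
    then show "?T (word w) \<in> {0}" by simp
  qed (auto intro!: lin_rules lin_proj)
  then show ?thesis
    by (simp add: case_prod_beta)
qed

lemma dl_word_homog:
  "content X a b w \<Longrightarrow> (case a of 0 \<Rightarrow> dl_word q X w = 0 | Suc a' \<Rightarrow> dl_word q X w \<in> homog X a' b)"
proof (induction w arbitrary: a b)
  case Nil
  then show ?case by (auto simp: content_def)
next
  case (Cons x w)
  show ?case
  proof (cases "x = X")
    case True
    then obtain a' where [simp]: "a = Suc a'" and c: "content X a' b w"
      using Cons.prems by (auto simp: content_def)
    show ?thesis
      using Cons.IH[OF c] c True
      by (auto intro!: subspace_add subspace_supported subspace_scale homog_L split: nat.splits)
  next
    case False
    then have [simp]: "x = other X" using letter_cases by blast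
    then obtain b' where [simp]: "b = Suc b'" and c: "content X a b' w"
      using Cons.prems by (cases b) (auto simp: content_def)
    show ?thesis
      using Cons.IH[OF c]
      by (auto intro!: subspace_add subspace_supported subspace_scale homog_L_other split: nat.splits)
  qed
qed

lemma dl_homog: "v \<in> homog X (Suc a) b \<Longrightarrow> dl q X v \<in> homog X a b"
  by (rule supported_induct[where T = "dl q X"], assumption, rule subspace_supported)
     (auto intro!: lin_rules dest: dl_word_homog)

lemma dl_homog_0: "v \<in> homog X 0 b \<Longrightarrow> dl q X v = 0"
proof -
  assume v: "v \<in> homog X 0 b"
  have "dl q X v \<in> {0}"
    by (rule supported_induct[OF v]) (auto intro!: lin_rules dest: dl_word_homog)
  then show ?thesis by simp
qed

lemma dr_homog: "v \<in> homog X (Suc a) b \<Longrightarrow> dr q X v \<in> homog X a b"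
  unfolding dr_def by (intro revV_homog dl_homog)

lemma dl_proj:
  fixes v :: "'k::field VV"
  shows "dl q X (proj X a b v) = (case a of 0 \<Rightarrow> 0 | Suc a' \<Rightarrow> proj X a' b (dl q X v))"
proof -
  have L: "lin (\<lambda>v. case a of 0 \<Rightarrow> 0 | Suc a' \<Rightarrow> proj X a' b (dl q X v))"
    by (cases a) (auto intro!: lin_rules lin_comp[OF lin_proj])
  have W: "dl q X (proj X a b (word w)) = (case a of 0 \<Rightarrow> 0 | Suc a' \<Rightarrow> proj X a' b (dl q X (word w)))" for w
  proof -
    obtain c d where c: "content X c d w" by (simp add: content_def)
    then have w: "(word w :: 'k VV) \<in> homog X c d" by simp
    show ?thesis
    proof (cases "(c, d) = (a, b)")
      case True
      then show ?thesis
        using w dl_homog_0[of "word w" X d q] dl_homog[of "word w" X _ d q]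
        by (cases a) (auto simp: proj_id simp del: dl_word_eq)
    next
      case False
      show ?thesis
      proof (cases c)
        case 0
        with w have "dl q X (word w) = 0" by (intro dl_homog_0) simp
        then show ?thesis
          using proj_other[OF w False] by (auto simp: lin_zero[OF lin_proj] simp del: dl_word_eq split: nat.splits)
      next
        case (Suc c')
        with w have "dl q X (word w) \<in> homog X c' d" by (intro dl_homog) simp
        from proj_other[OF this] show ?thesis
          using proj_other[OF w False] False Suc by (auto simp del: dl_word_eq split: nat.splits)
      qed
    qed
  qed
  show ?thesis
    by (rule lin_eqI[OF lin_comp[OF lin_dl lin_proj] L W])
qed

abbreviation eps :: "'k::field VV \<Rightarrow> 'k" where "eps v \<equiv> lookup v []"

lemma eps_mult_gen [simp]: "eps (gen x * v) = 0" "eps (v * gen x) = 0"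
proof -
  show "eps (gen x * v) = 0" by (subst lookup_gen_mult[of 1]) simp_all
  have "subspace {v. eps (v * gen x) = 0}"
    by (auto simp: free_alg.subspace_def distrib_right lookup_add)
  from subspace_UNIV_I[OF this, of v] show "eps (v * gen x) = 0"
    by (simp add: lookup_word flip: word_snoc)
qed

lemma eps_supported: "v \<in> supported (\<lambda>w. w = []) \<Longrightarrow> v = eps v \<cdot> 1"
  by (rule poly_mapping_eqI) (auto simp: supported_def one_word lookup_word)

section \<open>Stability of the ideal \<open>J\<close> under the operators\<close>

abbreviation serre :: "'k::field \<Rightarrow> letter \<Rightarrow> 'k VV" where "serre q X \<equiv> qSerre q (gen X) (gen (other X))"

lemma serre_eq: "serre q X = word [X, X, X, other X] - qthree q \<cdot> word [X, X, other X, X] +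
    qthree q \<cdot> word [X, other X, X, X] - word [other X, X, X, X]"
  by (simp add: qSerre_def gen_def word_mult power2_eq_square power3_eq_cube)

lemma J_eq: "J q = gen_ideal (range (serre q))"
proof -
  have *: "UNIV = {LA, LB}"
    using letter.exhaust by blast
  show ?thesis unfolding J_def * by simp
qed

lemma is_ideal_J: "is_ideal (J q)"
  unfolding J_eq by (rule is_ideal_gen_ideal)

lemma subspace_J [simp]: "subspace (J q)"
  using is_ideal_J[of q] by (simp add: is_ideal_def)

lemma J_mult [simp]: "v \<in> J q \<Longrightarrow> u * v \<in> J q" "v \<in> J q \<Longrightarrow> v * u \<in> J q"
  using is_ideal_J[of q] by (auto simp: is_ideal_def)

lemma J_add: "u \<in> J q \<Longrightarrow> v \<in> J q \<Longrightarrow> u + v \<in> J q"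
  and J_diff: "u \<in> J q \<Longrightarrow> v \<in> J q \<Longrightarrow> u - v \<in> J q"
  and J_scale: "v \<in> J q \<Longrightarrow> c \<cdot> v \<in> J q"
  and J_neg: "v \<in> J q \<Longrightarrow> - v \<in> J q"
  and J_zero [simp]: "0 \<in> J q"
  and J_sum: "(\<And>i. i \<in> I \<Longrightarrow> f i \<in> J q) \<Longrightarrow> (\<Sum>i\<in>I. f i) \<in> J q"
  by (intro subspace_add subspace_diff subspace_scale subspace_neg subspace_0 subspace_sum subspace_J; assumption)+

lemma J_scale_iff: "c \<noteq> 0 \<Longrightarrow> c \<cdot> v \<in> J q \<longleftrightarrow> v \<in> J q"
  using J_scale[of "c \<cdot> v" q "inverse c"] J_scale[of v q c] by (auto simp: scale_scale)

lemma serre_in_J [simp]: "serre q X \<in> J q"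
  unfolding J_eq by (rule subsetD[OF gen_ideal_superset rangeI])

text \<open>The span of the multiples \<open>word u * serre q X * word w\<close> absorbs a letter on
  either side, hence is an ideal and contains \<open>J\<close>.\<close>

lemma J_induct:
  assumes "v \<in> J q" "lin T" "subspace S" "\<And>u X w. T (word u * serre q X * word w) \<in> S"
  shows "T v \<in> S"
proof -
  define B where "B = {word u * serre q X * word w | u X w. True}"
  have gens: "gen x * b \<in> B" "b * gen x \<in> B" if "b \<in> B" for b x
  proof -
    from that obtain u X w where b: "b = word u * serre q X * word w"
      unfolding B_def by blast
    have "gen x * b = word (x # u) * serre q X * word w" "b * gen x = word u * serre q X * word (w @ [x])"
      by (simp_all only: b word_Cons word_snoc mult.assoc)
    then show "gen x * b \<in> B" "b * gen x \<in> B"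
      unfolding B_def by blast+
  qed
  have left: "gen x * v \<in> span B" if "v \<in> span B" for x v
  proof -
    have "span B \<subseteq> {v. gen x * v \<in> span B}"
      by (intro free_alg.span_minimal subspace_vimage lin_rules free_alg.subspace_span subsetI CollectI
          free_alg.span_base gens)
    with that show ?thesis by auto
  qed
  have right: "v * gen x \<in> span B" if "v \<in> span B" for x v
  proof -
    have "span B \<subseteq> {v. v * gen x \<in> span B}"
      by (intro free_alg.span_minimal subspace_vimage lin_rules free_alg.subspace_span subsetI CollectI
          free_alg.span_base gens)
    with that show ?thesis by auto
  qed
  have "is_ideal (span B)"
    unfolding is_ideal_def
    using mult_closed_left[OF free_alg.subspace_span left] mult_closed_right[OF free_alg.subspace_span right]
      free_alg.subspace_span[of B] by auto
  moreover have "range (serre q) \<subseteq> span B"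
  proof (intro image_subsetI free_alg.span_base)
    fix X show "serre q X \<in> B"
      unfolding B_def by (intro CollectI exI[of _ "[]"] exI[of _ X]) (simp flip: one_word)
  qed
  ultimately have "J q \<subseteq> span B"
    unfolding J_eq by (rule gen_ideal_minimal)
  also have "\<dots> \<subseteq> {v. T v \<in> S}"
    using assms(4) unfolding B_def by (intro free_alg.span_minimal subspace_vimage assms) auto
  finally show ?thesis using assms(1) by auto
qed

text \<open>The four words of a Serre element have the same letters, so an operator whose eigenvalue
  depends only on letter counts is a scalar on each spanning element of \<open>J\<close>.\<close>

lemma J_diag:
  assumes "v \<in> J q" and f: "\<And>u w. (\<And>X. count_list u X = count_list w X) \<Longrightarrow> f u = f w"
  shows "diag f v \<in> J q"
proof (rule J_induct[OF assms(1) lin_diag])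
  fix u X w
  show "diag f (word u * serre q X * word w) \<in> J q"
  proof -
    have "word u * serre q X * word w \<in>
        supported (\<lambda>z. \<forall>Y. count_list z Y = count_list (u @ [X, X, X, other X] @ w) Y)"
      unfolding serre_eq
      by (auto simp: distrib_left left_diff_distrib right_diff_distrib distrib_right word_mult
          intro!: subspace_add subspace_diff subspace_scale subspace_supported)
    then have "diag f (word u * serre q X * word w) =
        f (u @ [X, X, X, other X] @ w) \<cdot> (word u * serre q X * word w)"
      by (rule diag_eigen) (auto intro: f)
    then show ?thesis by (simp add: J_scale)
  qed
qed simp

lemma J_Kx: "v \<in> J q \<Longrightarrow> Kx q X v \<in> J q"
  unfolding Kx_def
proof (rule J_diag)
  fix u w :: "letter list" assume "\<And>X. count_list u X = count_list w X"
  then have "content X (count_list u X) (count_list u (other X)) u"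
    "content X (count_list u X) (count_list u (other X)) w"
    by (simp_all add: content_def)
  then show "q powi weight X u = q powi weight X w"
    by (simp add: weight_content)
qed

lemma J_proj: "v \<in> J q \<Longrightarrow> proj X a b v \<in> J q"
  unfolding proj_def by (rule J_diag) (auto simp: content_def)

lemma J_revV: "v \<in> J q \<Longrightarrow> revV v \<in> J q"
proof (rule J_induct[OF _ lin_revV])
  fix u X w
  have "revV (serre q X) = - serre q X"
    unfolding serre_eq by simp
  then have "revV (word u * serre q X * word w) = - (word (rev w) * serre q X * word (rev u))"
    by (simp add: revV_mult mult.assoc)
  then show "revV (word u * serre q X * word w) \<in> J q"
    by (simp add: J_neg)
qed simp_all

lemma eps_J: "v \<in> J q \<Longrightarrow> eps v = 0"
proof -
  assume v: "v \<in> J q"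
  have "v \<in> {v. eps v = 0}"
  proof (rule J_induct[OF v lin_id])
    show "subspace {v. eps v = (0::'a)}"
      by (auto simp: free_alg.subspace_def lookup_add)
    fix u X w
    show "word u * serre q X * word w \<in> {v. eps v = 0}"
      unfolding serre_eq
      by (simp add: distrib_left left_diff_distrib right_diff_distrib distrib_right word_mult lookup_add
          lookup_minus lookup_word)
  qed
  then show ?thesis by simp
qed

lemma one_notin_J: "1 \<notin> J q"
  using eps_J[of 1] by (auto simp: one_word lookup_word)

lemma const_in_J_iff: "c \<cdot> 1 \<in> J q \<longleftrightarrow> c = 0"
  using one_notin_J J_scale_iff[of c 1] by auto

locale generic_q =
  fixes q :: "'k::field"
  assumes q0: "q \<noteq> 0" and not_root: "\<And>n. n > 0 \<Longrightarrow> q ^ n \<noteq> 1"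
begin

lemma q2: "q\<^sup>2 \<noteq> 1" using not_root[of 2] by simp

lemma qthree_eq: "qthree q = q\<^sup>2 + 1 + inverse (q\<^sup>2)"
proof -
  have "q - inverse q \<noteq> 0"
    using q0 q2 by (auto simp: field_simps power2_eq_square)
  then show ?thesis
    using q0 by (simp add: qthree_def power_int_minus field_simps) (simp add: power_numeral_reduce algebra_simps)
qed

lemma powi_eq_1_iff: "q powi n = 1 \<longleftrightarrow> n = 0"
proof
  assume *: "q powi n = 1"
  show "n = 0"
  proof (rule ccontr)
    assume "n \<noteq> 0"
    then have "q ^ nat \<bar>n\<bar> = 1"
      using * q0 by (cases "n > 0") (auto simp: power_int_def field_simps)
    with not_root[of "nat \<bar>n\<bar>"] \<open>n \<noteq> 0\<close> show False by simp
  qed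
qed simp

text \<open>With \<open>qthree q\<close> equal to q^2 + 1 + q^(-2) the terms cancel identically, not
  merely modulo \<open>J\<close>.\<close>

lemma dl_serre: "dl q X (serre q Y) = 0"
proof -
  have 1: "other Y = X \<or> Y = X" using letter_cases by metis
  show ?thesis
    unfolding serre_eq
    using 1 q0
    by (auto simp: qthree_eq gen_word scale_add scale_diff scale_scale algebra_simps,
        (auto simp: poly_mapping_eq_iff fun_eq_iff lookup_add lookup_minus lookup_word field_simps)[])
qed

text \<open>The elements of \<open>J\<close> whose derivative stays in \<open>J\<close> form an
  ideal, because the undifferentiated terms in \<open>dl_L\<close> and \<open>dl_R\<close> are
  \<open>v\<close> and \<open>Kx q X v\<close>; the generators belong to it by
  \<open>dl_serre\<close>.\<close>

lemma J_dl: "v \<in> J q \<Longrightarrow> dl q X v \<in> J q"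
proof -
  assume v: "v \<in> J q"
  let ?I = "{v \<in> J q. dl q X v \<in> J q}"
  have S: "subspace ?I"
    by (auto simp: free_alg.subspace_def intro!: J_add J_scale)
  have L: "gen x * v \<in> ?I" and R: "v * gen x \<in> ?I" if "v \<in> ?I" for x v
    using that by (auto simp: dl_L dl_R q0 intro!: J_add J_scale J_Kx)
  have "is_ideal ?I"
    unfolding is_ideal_def using S mult_closed_left[OF S L] mult_closed_right[OF S R] by simp
  then have "J q \<subseteq> ?I"
    unfolding J_eq[of q] by (rule gen_ideal_minimal) (auto simp: dl_serre simp flip: J_eq)
  with v show ?thesis by blast
qed

lemma J_dr: "v \<in> J q \<Longrightarrow> dr q X v \<in> J q"
  by (simp add: dr_def J_revV J_dl)

end

section \<open>Singular vectors of unequal content\<close>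

lemma J_diff_cancel: "u - v \<in> J q \<Longrightarrow> v \<in> J q \<Longrightarrow> u \<in> J q" "u - v \<in> J q \<Longrightarrow> u \<in> J q \<Longrightarrow> v \<in> J q"
  using J_add[of "u - v" q v] J_diff[of u q "u - v"] by simp_all

context generic_q
begin

declare q0 [simp]

section \<open>The braided adjoint action of a letter\<close>

lemma dr_mult: "dr q X (u * v) = u * dr q X v + dr q X u * Kx q X v"
  by (rule mult_induct_left[where v = u])
     (auto intro!: lin_rules simp: mult.assoc dr_L Kx_mult distrib_left distrib_right)

text \<open>The twist in this braided commutator makes \<open>ad_mult\<close> a skew Leibniz rule
  and cancels the undifferentiated terms in \<open>dr_ad\<close>, so that \<open>ad Y\<close>
  preserves the kernel of \<open>dr q Y\<close>.\<close>

definition ad :: "letter \<Rightarrow> 'k VV \<Rightarrow> 'k VV"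
  where "ad Y v = gen Y * v - Kx q Y v * gen Y"

lemma lin_ad: "lin (ad Y)"
  unfolding ad_def by (intro lin_rules)

lemmas lin_ad_simps [simp] = lin_add[OF lin_ad] lin_scale[OF lin_ad] lin_diff[OF lin_ad] lin_zero[OF lin_ad]

lemma ad_mult: "ad Y (u * v) = ad Y u * v + Kx q Y u * ad Y v"
  by (simp add: ad_def Kx_mult algebra_simps)

lemma ad_one [simp]: "ad Y 1 = 0"
  by (simp add: ad_def)

lemma ad_J: "v \<in> J q \<Longrightarrow> ad Y v \<in> J q"
  by (simp add: ad_def J_diff J_Kx)

lemma ad_homog: "v \<in> homog Y a b \<Longrightarrow> ad Y v \<in> homog Y (Suc a) b"
  unfolding ad_def by (intro subspace_diff subspace_supported homog_L homog_R homog_Kx)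

lemma dr_ad: "dr q Y (ad Y v) = gen Y * dr q Y v - q ^ 4 \<cdot> (Kx q Y (dr q Y v) * gen Y)"
  by (simp add: ad_def dr_L dr_R dr_Kx scale_scale flip: power_add)

text \<open>On a vector of fixed weight the first two terms form a scalar multiple of it, so
  \<open>dl q Y\<close> lowers what \<open>ad Y\<close> raises, much as in a representation of
  quantum sl_2. This keeps the iterates of \<open>ad Y\<close> on a singular vector from
  vanishing.\<close>

lemma dl_ad: "dl q Y (ad Y v) = v - Kx q Y (Kx q Y v) + q\<^sup>2 \<cdot> ad Y (dl q Y v)"
  by (simp add: ad_def dl_L dl_R dl_Kx scale_diff)

definition adpow :: "letter \<Rightarrow> nat \<Rightarrow> 'k VV" where "adpow Y k = (ad Y ^^ k) (gen (other Y))"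

lemma adpow_0: "adpow Y 0 = gen (other Y)" and adpow_Suc: "ad Y (adpow Y k) = adpow Y (Suc k)"
  by (simp_all add: adpow_def)

lemma adpow_homog: "adpow Y k \<in> homog Y k 1"
  by (induction k) (use gen_homog(2)[of Y] in \<open>auto simp: adpow_0 ad_homog simp flip: adpow_Suc\<close>)

lemma Kx_adpow: "Kx q Y (adpow Y k) = q powi (2 * (int k - 1)) \<cdot> adpow Y k"
  using Kx_homog[OF adpow_homog, of q Y k] by simp

lemma dr_adpow: "dr q Y (adpow Y k) = 0"
proof (induction k)
  case 0
  show ?case using dr_L[OF q0, of Y "other Y" 1] by (simp add: adpow_0)
next
  case (Suc k)
  then show ?case by (simp add: dr_ad flip: adpow_Suc)
qed

text \<open>This is why the Serre relation matters here: modulo \<open>J\<close> only the iterates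
  with \<open>k \<le> 2\<close> remain.\<close>

lemma adpow_3: "adpow Y 3 = serre q Y"
proof -
  have 1: "adpow Y 1 = word [Y, other Y] - inverse (q\<^sup>2) \<cdot> word [other Y, Y]"
    using adpow_Suc[of Y 0, symmetric] by (simp add: ad_def adpow_0 gen_def word_mult pairing_def power_int_minus)
  have 2: "adpow Y 2 = gen Y * adpow Y 1 - adpow Y 1 * gen Y"
    using adpow_Suc[of Y 1, symmetric] Kx_adpow[of Y 1] by (simp add: ad_def numeral_2_eq_2)
  have 3: "adpow Y 3 = gen Y * adpow Y 2 - q\<^sup>2 \<cdot> (adpow Y 2 * gen Y)"
    using adpow_Suc[of Y 2, symmetric] Kx_adpow[of Y 2] by (simp add: ad_def numeral_3_eq_3 numeral_2_eq_2)
  show ?thesis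
    unfolding 3 2 1 serre_eq qthree_eq
    by (simp add: gen_def word_mult algebra_simps scale_add scale_left_add scale_diff scale_scale)
qed

lemma adpow_J: "k \<ge> 3 \<Longrightarrow> adpow Y k \<in> J q"
proof (induction k rule: dec_induct)
  case base
  show ?case by (simp add: adpow_3)
next
  case (step k)
  then show ?case by (simp add: ad_J flip: adpow_Suc)
qed

text \<open>The subalgebra \<open>C\<close> generated modulo \<open>J\<close> by the \<open>adpow Y k\<close> lies in the kernel of \<open>dr q Y\<close>, and
  \<open>\<V> = \<Sum> Y^i C + J\<close>; hence every element of that kernel lies in \<open>C\<close> modulo \<open>J\<close>.\<close>

definition adalg :: "letter \<Rightarrow> 'k VV set"
  where "adalg Y = span ({prod_list (map (adpow Y) ks) | ks. set ks \<subseteq> {..2}} \<union> J q)"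

lemma subspace_adalg [simp]: "subspace (adalg Y)"
  by (simp add: adalg_def free_alg.subspace_span)

lemma adalg_prod: "set ks \<subseteq> {..2} \<Longrightarrow> prod_list (map (adpow Y) ks) \<in> adalg Y"
  unfolding adalg_def by (intro free_alg.span_base) auto

lemma adalg_J: "v \<in> J q \<Longrightarrow> v \<in> adalg Y"
  unfolding adalg_def by (intro free_alg.span_base) auto

lemma adalg_induct:
  assumes "v \<in> adalg Y" "lin T" "subspace S" "\<And>v. v \<in> J q \<Longrightarrow> T v \<in> S"
    "\<And>ks. set ks \<subseteq> {..2} \<Longrightarrow> T (prod_list (map (adpow Y) ks)) \<in> S"
  shows "T v \<in> S"
proof -
  have "adalg Y \<subseteq> {v. T v \<in> S}"
    unfolding adalg_def using assms(4,5) by (intro free_alg.span_minimal subspace_vimage assms) auto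
  with assms(1) show ?thesis by auto
qed

lemma adalg_mult: "v \<in> adalg Y \<Longrightarrow> adpow Y k * v \<in> adalg Y"
proof (cases "k \<le> 2")
  case True
  assume v: "v \<in> adalg Y"
  show ?thesis
  proof (rule adalg_induct[OF v])
    fix ks :: "nat list" assume "set ks \<subseteq> {..2}"
    then show "adpow Y k * prod_list (map (adpow Y) ks) \<in> adalg Y"
      using adalg_prod[of "k # ks" Y] True by simp
  qed (auto intro!: lin_rules adalg_J)
next
  case False
  then show ?thesis by (intro adalg_J J_mult adpow_J) simp
qed

lemma adalg_Kx: "v \<in> adalg Y \<Longrightarrow> Kx q Y v \<in> adalg Y"
proof (rule adalg_induct[OF _ lin_Kx])
  fix ks :: "nat list" assume "set ks \<subseteq> {..2}"
  then show "Kx q Y (prod_list (map (adpow Y) ks)) \<in> adalg Y"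
  proof (induction ks)
    case Nil
    then show ?case using adalg_prod[of "[]"] by simp
  next
    case (Cons k ks)
    then show ?case
      by (auto simp: Kx_mult Kx_adpow intro!: subspace_scale adalg_mult)
  qed
qed (auto intro: adalg_J J_Kx)

lemma adalg_ad: "v \<in> adalg Y \<Longrightarrow> ad Y v \<in> adalg Y"
proof (rule adalg_induct[OF _ lin_ad])
  fix ks :: "nat list" assume "set ks \<subseteq> {..2}"
  then show "ad Y (prod_list (map (adpow Y) ks)) \<in> adalg Y"
  proof (induction ks)
    case Nil
    then show ?case by (simp add: subspace_0)
  next
    case (Cons k ks)
    then show ?case
      by (auto simp: ad_mult Kx_adpow adpow_Suc intro!: subspace_add subspace_scale adalg_mult adalg_prod)
  qed
qed (auto intro: adalg_J ad_J)

lemma adalg_dr: "v \<in> adalg Y \<Longrightarrow> dr q Y v \<in> J q"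
proof (rule adalg_induct[OF _ lin_dr])
  fix ks :: "nat list"
  have "dr q Y (prod_list (map (adpow Y) ks)) = 0"
    by (induction ks) (auto simp: dr_mult dr_adpow)
  then show "dr q Y (prod_list (map (adpow Y) ks)) \<in> J q" by simp
qed (auto intro: J_dr)

text \<open>A factor \<open>adpow Y k\<close> with \<open>k \<le> 2\<close> contains the other
  letter once and \<open>Y\<close> at most twice. This is the source of the local nilpotency of
  \<open>ad Y\<close>.\<close>

lemma adalg_proj:
  assumes "v \<in> adalg Y" "b > 2 * a"
  shows "proj Y b a v \<in> J q"
proof (rule adalg_induct[OF assms(1) lin_proj])
  fix ks :: "nat list" assume ks: "set ks \<subseteq> {..2}"
  have "prod_list (map (adpow Y) ks) \<in> homog Y (sum_list ks) (length ks)"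
    by (induction ks) (use homog_mult[OF adpow_homog] in force)+
  moreover have "sum_list ks \<le> 2 * length ks"
    using ks by (induction ks) auto
  ultimately have "proj Y b a (prod_list (map (adpow Y) ks)) = 0"
    using assms(2) by (intro proj_other) auto
  then show "proj Y b a (prod_list (map (adpow Y) ks)) \<in> J q" by simp
qed (auto intro: J_proj)

section \<open>The filtration by left powers of a letter and the kernel of
  \<open>dr q Y\<close>\<close>

definition adfilt :: "letter \<Rightarrow> nat \<Rightarrow> 'k VV set"
  where "adfilt Y m = span {gen Y ^ i * x | i x. i \<le> m \<and> x \<in> adalg Y}"

lemma subspace_adfilt [simp]: "subspace (adfilt Y m)"
  by (simp add: adfilt_def free_alg.subspace_span)

lemma adfilt_base: "i \<le> m \<Longrightarrow> x \<in> adalg Y \<Longrightarrow> gen Y ^ i * x \<in> adfilt Y m"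
  unfolding adfilt_def by (intro free_alg.span_base) auto

lemma adfilt_induct:
  assumes "v \<in> adfilt Y m" "lin T" "subspace S" "\<And>i x. i \<le> m \<Longrightarrow> x \<in> adalg Y \<Longrightarrow> T (gen Y ^ i * x) \<in> S"
  shows "T v \<in> S"
proof -
  have "adfilt Y m \<subseteq> {v. T v \<in> S}"
    unfolding adfilt_def using assms(4) by (intro free_alg.span_minimal subspace_vimage assms) auto
  with assms(1) show ?thesis by auto
qed

lemma adfilt_mono: "v \<in> adfilt Y m \<Longrightarrow> m \<le> n \<Longrightarrow> v \<in> adfilt Y n"
  by (rule adfilt_induct[OF _ lin_id]) (auto intro: adfilt_base)

lemma adfilt_0: "v \<in> adfilt Y 0 \<Longrightarrow> v \<in> adalg Y"
  by (rule adfilt_induct[OF _ lin_id]) auto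

lemma adfilt_L: "v \<in> adfilt Y m \<Longrightarrow> gen Y * v \<in> adfilt Y (Suc m)"
proof (rule adfilt_induct[where T = "\<lambda>v. gen Y * v"])
  fix i x assume "i \<le> m" "x \<in> adalg Y"
  then show "gen Y * (gen Y ^ i * x) \<in> adfilt Y (Suc m)"
    using adfilt_base[of "Suc i" "Suc m" x Y] by (simp add: mult.assoc)
qed (auto intro!: lin_rules)

text \<open>By the definition of \<open>ad\<close>, a letter \<open>Y\<close> passes
  \<open>adpow Y k\<close> from right to left at the price of a term with
  \<open>adpow Y (Suc k)\<close>. Hence \<open>k\<close> stays arbitrary in the induction; the terms
  with \<open>k \<ge> 3\<close> lie in \<open>J\<close>.\<close>

lemma adpow_power: "x \<in> adalg Y \<Longrightarrow> adpow Y k * (gen Y ^ i * x) \<in> adfilt Y i"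
proof (induction i arbitrary: k)
  case 0
  then show ?case using adfilt_base[of 0 0 "adpow Y k * x"] by (simp add: adalg_mult)
next
  case (Suc i)
  define c where "c = q powi (2 * (int k - 1))"
  have "c \<cdot> (adpow Y k * gen Y) = gen Y * adpow Y k - adpow Y (Suc k)"
    using adpow_Suc[of Y k] by (simp add: ad_def Kx_adpow c_def algebra_simps)
  then have "c \<cdot> (adpow Y k * (gen Y ^ Suc i * x)) =
      gen Y * (adpow Y k * (gen Y ^ i * x)) - adpow Y (Suc k) * (gen Y ^ i * x)"
    by (metis (no_types, opaque_lifting) left_diff_distrib mult.assoc power_Suc scale_mult_left)
  also have "\<dots> \<in> adfilt Y (Suc i)"
    by (rule subspace_diff[OF subspace_adfilt adfilt_L[OF Suc.IH[OF Suc.prems]]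
          adfilt_mono[OF Suc.IH[OF Suc.prems]]]) simp
  finally have "inverse c \<cdot> c \<cdot> (adpow Y k * (gen Y ^ Suc i * x)) \<in> adfilt Y (Suc i)"
    by (rule subspace_scale[OF subspace_adfilt])
  moreover have "c \<noteq> 0" by (simp add: c_def)
  ultimately show ?case by (simp only: scale_scale) (simp add: scale_one)
qed

lemma adfilt_exhaust: "\<exists>m. v \<in> adfilt Y m"
proof -
  have S: "subspace {v. \<exists>m. v \<in> adfilt Y m}"
    unfolding free_alg.subspace_def
  proof (intro conjI ballI allI)
    fix u v assume "u \<in> {v. \<exists>m. v \<in> adfilt Y m}" "v \<in> {v. \<exists>m. v \<in> adfilt Y m}"
    then obtain m n where "u \<in> adfilt Y m" "v \<in> adfilt Y n" by auto
    then have "u + v \<in> adfilt Y (max m n)"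
      by (intro subspace_add) (auto intro: adfilt_mono)
    then show "u + v \<in> {v. \<exists>m. v \<in> adfilt Y m}" by auto
  qed (auto intro: subspace_0 subspace_scale subspace_adfilt)
  have W: "\<exists>m. word w \<in> adfilt Y m" for w
  proof (induction w)
    case Nil
    have "1 \<in> adfilt Y 0"
      using adfilt_base[of 0 0 1 Y] adalg_prod[of "[]" Y] by simp
    then show ?case by (auto simp flip: one_word)
  next
    case (Cons x w)
    then obtain m where m: "word w \<in> adfilt Y m" by auto
    show ?case
    proof (cases "x = Y")
      case True
      then show ?thesis using adfilt_L[OF m] by (auto simp: word_Cons)
    next
      case False
      then have x: "x = other Y" using letter_cases by blast
      have "adpow Y 0 * word w \<in> adfilt Y m"
      proof (rule adfilt_induct[OF m, where T = "\<lambda>v. adpow Y 0 * v"])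
        fix i x assume "i \<le> m" "x \<in> adalg Y"
        then show "adpow Y 0 * (gen Y ^ i * x) \<in> adfilt Y m"
          by (intro adfilt_mono[OF adpow_power])
      qed (auto intro!: lin_rules)
      then show ?thesis by (auto simp: word_Cons x adpow_0)
    qed
  qed
  have "v \<in> {v. \<exists>m. v \<in> adfilt Y m}"
    by (rule subspace_UNIV_I[OF S]) (simp add: W)
  then show ?thesis by simp
qed

text \<open>The q-integer that \<open>dr q Y\<close> produces from \<open>gen Y ^ n\<close>.\<close>

definition qsum :: "nat \<Rightarrow> 'k" where "qsum n = (\<Sum>j<n. q ^ (2 * j))"

lemma qsum_nonzero: "n > 0 \<Longrightarrow> qsum n \<noteq> 0"
proof -
  assume "n > 0"
  have "(1 - q\<^sup>2) * qsum n = 1 - q ^ (2 * n)"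
    unfolding qsum_def by (simp add: power_mult one_diff_power_eq)
  then show ?thesis using not_root[of "2 * n"] \<open>n > 0\<close> by auto
qed

lemma dr_gen_power: "dr q Y (gen Y ^ Suc i) = qsum (Suc i) \<cdot> gen Y ^ i"
proof (induction i)
  case 0
  show ?case using dr_L[OF q0, of Y Y 1] by (simp add: qsum_def)
next
  case (Suc i)
  have "qsum (Suc (Suc i)) = 1 + q\<^sup>2 * qsum (Suc i)"
    unfolding qsum_def by (subst sum.lessThan_Suc_shift) (simp add: sum_distrib_left power_add power2_eq_square algebra_simps)
  moreover have "dr q Y (gen Y ^ Suc (Suc i)) = gen Y ^ Suc i + q\<^sup>2 \<cdot> (dr q Y (gen Y ^ Suc i) * gen Y)"
    by (subst power_Suc2) (simp add: dr_R del: power_Suc)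
  ultimately show ?case
    using Suc by (simp add: scale_left_add scale_scale power_commutes)
qed

lemma dr_power: "x \<in> adalg Y \<Longrightarrow> dr q Y (gen Y ^ Suc i * x) - qsum (Suc i) \<cdot> (gen Y ^ i * Kx q Y x) \<in> J q"
  by (simp add: dr_mult dr_gen_power adalg_dr del: power_Suc)

lemma Kx_J_iff: "Kx q Y v \<in> J q \<longleftrightarrow> v \<in> J q"
  using J_Kx[of "Kx q Y v" q "other Y"] J_Kx[of v q Y] by (auto simp: Kx_other)

lemma dr_pow_J: "v \<in> J q \<Longrightarrow> (dr q Y ^^ m) v \<in> J q"
  by (induction m) (auto intro: J_dr)

lemma lin_dr_pow: "lin (dr q Y ^^ m)"
  by (induction m) (auto simp: o_def intro!: lin_id[unfolded id_def] lin_comps simp: id_def)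

lemma dr_pow_adfilt: "v \<in> adfilt Y m \<Longrightarrow> (dr q Y ^^ Suc m) v \<in> J q"
proof (induction m arbitrary: v)
  case 0
  then show ?case by (simp add: adalg_dr adfilt_0)
next
  case (Suc m)
  show ?case
  proof (rule adfilt_induct[OF Suc.prems lin_dr_pow subspace_J])
    fix i x assume i: "i \<le> Suc m" and x: "x \<in> adalg Y"
    show "(dr q Y ^^ Suc (Suc m)) (gen Y ^ i * x) \<in> J q"
    proof (cases i)
      case 0
      then show ?thesis
        using dr_pow_J[OF adalg_dr[OF x], of "Suc m"] by (simp add: funpow_swap1)
    next
      case (Suc j)
      have "(dr q Y ^^ Suc m) (dr q Y (gen Y ^ i * x) - qsum (Suc j) \<cdot> (gen Y ^ j * Kx q Y x)) \<in> J q"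
        using dr_power[OF x, of j] Suc by (intro dr_pow_J) simp
      moreover have "(dr q Y ^^ Suc m) (gen Y ^ j * Kx q Y x) \<in> J q"
        using Suc i x by (intro Suc.IH adfilt_base adalg_Kx) auto
      ultimately have "(dr q Y ^^ Suc m) (dr q Y (gen Y ^ i * x)) \<in> J q"
        unfolding lin_diff[OF lin_dr_pow] lin_scale[OF lin_dr_pow] by (blast intro: J_diff_cancel J_scale)
      then show ?thesis
        by (simp only: funpow_Suc_right o_apply)
    qed
  qed
qed

text \<open>On \<open>gen Y ^ i * x\<close> the map \<open>dr q Y\<close> is a q-derivative in
  \<open>Y\<close> modulo \<open>J\<close>, so \<open>m\<close> steps leave a nonzero multiple of a
  \<open>Kx\<close> image of \<open>x\<close>.\<close>

lemma dr_pow_top: "x \<in> adalg Y \<Longrightarrow> (dr q Y ^^ m) (gen Y ^ m * x) \<in> J q \<Longrightarrow> x \<in> J q"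
proof (induction m arbitrary: x)
  case (Suc m)
  have "(dr q Y ^^ m) (dr q Y (gen Y ^ Suc m * x) - qsum (Suc m) \<cdot> (gen Y ^ m * Kx q Y x)) \<in> J q"
    by (intro dr_pow_J dr_power Suc.prems)
  moreover have "(dr q Y ^^ m) (dr q Y (gen Y ^ Suc m * x)) \<in> J q"
    using Suc.prems(2) by (simp only: funpow_Suc_right o_apply)
  ultimately have "qsum (Suc m) \<cdot> (dr q Y ^^ m) (gen Y ^ m * Kx q Y x) \<in> J q"
    unfolding lin_diff[OF lin_dr_pow] lin_scale[OF lin_dr_pow] by (rule J_diff_cancel)
  then have "(dr q Y ^^ m) (gen Y ^ m * Kx q Y x) \<in> J q"
    using qsum_nonzero[of "Suc m"] by (simp add: J_scale_iff)
  then show ?case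
    using Suc.IH[OF adalg_Kx[OF Suc.prems(1)]] by (simp add: Kx_J_iff)
qed simp

lemma adfilt_split: "v \<in> adfilt Y (Suc m) \<Longrightarrow> \<exists>x\<in>adalg Y. v - gen Y ^ Suc m * x \<in> adfilt Y m"
proof -
  let ?S = "{v. \<exists>x\<in>adalg Y. v - gen Y ^ Suc m * x \<in> adfilt Y m}"
  assume v: "v \<in> adfilt Y (Suc m)"
  have "v \<in> ?S"
  proof (rule adfilt_induct[OF v lin_id])
    show "subspace ?S"
      unfolding free_alg.subspace_def
    proof (intro conjI ballI allI CollectI)
      show "\<exists>x\<in>adalg Y. 0 - gen Y ^ Suc m * x \<in> adfilt Y m"
        by (rule bexI[of _ 0]) (auto intro: subspace_0)
    next
      fix u v assume "u \<in> ?S" "v \<in> ?S"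
      then obtain x y where xy: "x \<in> adalg Y" "y \<in> adalg Y"
        "u - gen Y ^ Suc m * x \<in> adfilt Y m" "v - gen Y ^ Suc m * y \<in> adfilt Y m"
        by blast
      then have "u + v - gen Y ^ Suc m * (x + y) \<in> adfilt Y m"
        using subspace_add[OF subspace_adfilt xy(3,4)] by (simp add: algebra_simps del: power_Suc)
      then show "\<exists>x\<in>adalg Y. u + v - gen Y ^ Suc m * x \<in> adfilt Y m"
        using subspace_add[OF subspace_adalg xy(1,2)] by blast
    next
      fix c v assume "v \<in> ?S"
      then obtain x where x: "x \<in> adalg Y" "v - gen Y ^ Suc m * x \<in> adfilt Y m"
        by blast
      then have "c \<cdot> v - gen Y ^ Suc m * (c \<cdot> x) \<in> adfilt Y m"
        using subspace_scale[OF subspace_adfilt x(2), of c] by (simp add: scale_diff del: power_Suc)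
      then show "\<exists>x\<in>adalg Y. c \<cdot> v - gen Y ^ Suc m * x \<in> adfilt Y m"
        using subspace_scale[OF subspace_adalg x(1)] by blast
    qed
    fix i x assume i: "i \<le> Suc m" and x: "x \<in> adalg Y"
    show "gen Y ^ i * x \<in> ?S"
    proof (cases "i = Suc m")
      case True
      then show ?thesis using x by (auto intro!: bexI[of _ x] subspace_0 simp del: power_Suc)
    next
      case False
      then show ?thesis
        using i adfilt_base[of i m x Y] x by (auto intro!: bexI[of _ 0] subspace_0 simp del: power_Suc)
    qed
  qed
  then show ?thesis by simp
qed

text \<open>The power \<open>Suc m\<close> of \<open>dr q Y\<close> sends both \<open>v\<close> and
  everything below its leading term into \<open>J\<close>. So the leading coefficient lies in
  \<open>J\<close>, and the filtration degree of \<open>v\<close> drops.\<close>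

lemma adfilt_descend: "v \<in> adfilt Y m \<Longrightarrow> dr q Y v \<in> J q \<Longrightarrow> v \<in> adalg Y"
proof (induction m)
  case 0
  then show ?case by (simp add: adfilt_0)
next
  case (Suc m)
  from adfilt_split[OF Suc.prems(1)] obtain x where x: "x \<in> adalg Y" and f: "v - gen Y ^ Suc m * x \<in> adfilt Y m"
    by blast
  have "(dr q Y ^^ Suc m) (v - gen Y ^ Suc m * x) \<in> J q"
    by (rule dr_pow_adfilt[OF f])
  moreover have "(dr q Y ^^ Suc m) v \<in> J q"
    using dr_pow_J[OF Suc.prems(2), of m] by (simp add: funpow_swap1)
  ultimately have "(dr q Y ^^ Suc m) (gen Y ^ Suc m * x) \<in> J q"
    unfolding lin_diff[OF lin_dr_pow] by (rule J_diff_cancel)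
  then have "x \<in> J q" by (rule dr_pow_top[OF x])
  then have "gen Y ^ Suc m * x \<in> adfilt Y m"
    using adfilt_base[of 0 m "gen Y ^ Suc m * x" Y] by (simp add: adalg_J del: power_Suc)
  with f have "v \<in> adfilt Y m"
    using subspace_add[OF subspace_adfilt f, of "gen Y ^ Suc m * x"] by simp
  then show ?case by (rule Suc.IH) fact
qed

lemma singular_unequal:
  assumes v: "v \<in> homog Y b a" and ab: "b > a" and "dl q Y v \<in> J q" "dr q Y v \<in> J q"
  shows "v \<in> J q"
proof -
  define x where "x m = (ad Y ^^ m) v" for m
  have x_Suc: "x (Suc m) = ad Y (x m)" for m by (simp add: x_def)
  have hom: "x m \<in> homog Y (b + m) a" for m
    by (induction m) (use v in \<open>auto simp: x_Suc ad_homog\<close>, simp add: x_def)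
  have "v \<in> adalg Y"
    using adfilt_exhaust adfilt_descend assms(4) by blast
  then have alg: "x m \<in> adalg Y" for m
    by (induction m) (auto simp: x_Suc adalg_ad, simp add: x_def)
  \<comment> \<open>This iterate has \<open>b + 2 * a\<close> letters \<open>Y\<close> against
    \<open>a\<close> of the other kind, beyond the bound of \<open>adalg_proj\<close> because
    \<open>b > 0\<close>.\<close>
  have van: "x (2 * a) \<in> J q"
    using adalg_proj[OF alg, of a "b + 2 * a" "2 * a"] proj_id[OF hom, of "2 * a"] ab by simp
  define d where "d = b - a"
  have KK: "Kx q Y (Kx q Y (x m)) = q ^ (4 * (d + m)) \<cdot> x m" for m
  proof -
    have "q powi (2 * (int (b + m) - int a)) = q ^ (2 * (d + m))"
      using ab by (simp add: d_def power_int_def nat_diff_distrib of_nat_diff algebra_simps)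
         (metis (no_types, opaque_lifting) nat_int of_nat_add of_nat_diff of_nat_mult of_nat_numeral)
    then show ?thesis
      using Kx_homog[OF hom, of q m] by (simp add: scale_scale flip: power_add)
  qed
  \<comment> \<open>Closed solution of the recurrence that \<open>dl_ad\<close> imposes, with
    \<open>\<mu> 0 = 0\<close>. The factored form exhibits the zeros: for index \<open>Suc m\<close>
    they are those of \<open>1 - q ^ (2 * Suc m)\<close> and \<open>1 - q ^ (4 * d + 2 * m)\<close>,
    and \<open>d > 0\<close> keeps the second exponent positive even at
    \<open>m = 0\<close>.\<close>
  define \<mu> where "\<mu> m = (1 - q ^ (2 * m)) * (q\<^sup>2 - q ^ (4 * d + 2 * m)) / ((1 - q\<^sup>2) * q\<^sup>2)" for m :: nat
  have \<mu>_Suc: "\<mu> (Suc m) = 1 - q ^ (4 * (d + m)) + q\<^sup>2 * \<mu> m" for m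
  proof -
    have "1 - q\<^sup>2 \<noteq> 0" using q2 by simp
    then show ?thesis
      by (simp add: \<mu>_def field_simps power_add power_mult power2_eq_square)
         (simp add: algebra_simps power_numeral_reduce)
  qed
  have \<mu>_nz: "\<mu> (Suc m) \<noteq> 0" for m
  proof -
    have "q ^ (4 * d + 2 * Suc m) = q\<^sup>2 * q ^ (4 * d + 2 * m)"
      by (simp add: power_add power2_eq_square)
    moreover have "q ^ (4 * d + 2 * m) \<noteq> 1" "q ^ (2 * Suc m) \<noteq> 1"
      using ab by (intro not_root; simp add: d_def)+
    ultimately show ?thesis using q2 by (auto simp: \<mu>_def)
  qed
  have dl_x: "dl q Y (x (Suc m)) - \<mu> (Suc m) \<cdot> x m \<in> J q" for m
  proof (induction m)
    case 0
    have "\<mu> 0 = 0" by (simp add: \<mu>_def)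
    then have "dl q Y (x (Suc 0)) - \<mu> (Suc 0) \<cdot> x 0 = q\<^sup>2 \<cdot> ad Y (dl q Y v)"
      by (simp add: x_Suc dl_ad KK \<mu>_Suc scale_diff) (simp add: x_def)
    then show ?case using assms(3) by (simp add: J_scale ad_J)
  next
    case (Suc m)
    have "dl q Y (x (Suc (Suc m))) - \<mu> (Suc (Suc m)) \<cdot> x (Suc m) =
        q\<^sup>2 \<cdot> ad Y (dl q Y (x (Suc m)) - \<mu> (Suc m) \<cdot> x m)"
      by (simp add: x_Suc[of "Suc m"] dl_ad KK \<mu>_Suc[of "Suc m"] scale_diff scale_left_add scale_scale)
         (simp add: x_Suc scale_diff scale_scale)
    then show ?case using Suc by (simp add: J_scale ad_J del: lin_ad_simps)
  qed
  \<comment> \<open>Each application of \<open>dl q Y\<close> goes down one rung, from the vanishing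
    iterate back to \<open>v\<close>.\<close>
  have "x m \<in> J q \<Longrightarrow> x 0 \<in> J q" for m
  proof (induction m)
    case (Suc m)
    have "\<mu> (Suc m) \<cdot> x m \<in> J q"
      by (rule J_diff_cancel(2)[OF dl_x J_dl[OF Suc.prems]])
    then show ?case using \<mu>_nz Suc.IH by (simp add: J_scale_iff)
  qed
  from this[OF van] show ?thesis by (simp add: x_def)
qed

end

section \<open>The braided coproduct and singular vectors of equal content\<close>

abbreviation tot :: "nat \<Rightarrow> 'k::field VV set" where "tot n \<equiv> supported (\<lambda>w. length w = n)"

lemma homog_tot: "v \<in> homog X a b \<Longrightarrow> v \<in> tot (a + b)"
  by (auto simp: supported_def dest: content_length)

lemma dl_tot: "v \<in> tot (Suc n) \<Longrightarrow> dl q X v \<in> tot n" and dl_tot_0: "v \<in> tot 0 \<Longrightarrow> dl q X v = 0"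
proof -
  have *: "case length w of 0 \<Rightarrow> dl_word q X w = 0 | Suc n \<Rightarrow> dl_word q X w \<in> tot n" for w
  proof -
    obtain a b where c: "content X a b w" by (simp add: content_def)
    show ?thesis
      using dl_word_homog[OF c, of q] content_length[OF c] homog_tot[of "dl_word q X w" X _ b]
      by (auto simp: subspace_0[OF subspace_supported] split: nat.splits)
  qed
  show "dl q X v \<in> tot n" if "v \<in> tot (Suc n)"
  proof (rule supported_induct[OF that subspace_supported lin_dl])
    fix w :: "letter list" assume "length w = Suc n"
    then show "dl q X (word w) \<in> tot n" using *[of w] by simp
  qed
  show "dl q X v = 0" if "v \<in> tot 0"
  proof -
    have "dl q X v \<in> {0}"
      by (rule supported_induct[OF that _ lin_dl]) auto
    then show ?thesis by simp
  qed
qed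

lemma finite_words: "finite {ys :: letter list. length ys = n}"
proof -
  have "UNIV \<subseteq> {LA, LB}" using letter.exhaust by blast
  then have "finite (UNIV :: letter set)" by (rule finite_subset) simp
  from finite_lists_length_eq[OF this, of n] show ?thesis by simp
qed

lemma eps_one [simp]: "eps 1 = 1"
  by (simp add: one_word lookup_word)

text \<open>The tensor square of the free algebra is not constructed: its elements are represented
  by their images under bilinear maps.\<close>

definition bilin :: "('k::field VV \<Rightarrow> 'k VV \<Rightarrow> 'k VV) \<Rightarrow> bool"
  where "bilin g \<longleftrightarrow> (\<forall>r. lin (\<lambda>l. g l r)) \<and> (\<forall>l. lin (g l))"

lemma bilin_comp: "bilin g \<Longrightarrow> lin S \<Longrightarrow> lin T \<Longrightarrow> bilin (\<lambda>l r. g (S l) (T r))"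
  by (auto simp: bilin_def lin_def)

lemma bilin_left: "bilin g \<Longrightarrow> lin S \<Longrightarrow> bilin (\<lambda>l r. g (S l) r)"
  using bilin_comp[OF _ _ lin_id] .

lemma bilin_mult: "bilin (*)"
  by (simp add: bilin_def lin_def distrib_left distrib_right)

lemma bilin_eps: "lin h \<Longrightarrow> bilin (\<lambda>l r. eps l \<cdot> h r)" "lin h \<Longrightarrow> bilin (\<lambda>l r. eps r \<cdot> h l)"
  by (auto simp: bilin_def lin_def lookup_add scale_left_add scale_add scale_scale mult.commute)

lemma bilin_diff: "bilin g \<Longrightarrow> bilin h \<Longrightarrow> bilin (\<lambda>l r. g l r - h l r)"
  by (auto simp: bilin_def intro: lin_minus)

lemma bilin_sum: "(\<And>i. i \<in> I \<Longrightarrow> bilin (g i)) \<Longrightarrow> bilin (\<lambda>l r. \<Sum>i\<in>I. g i l r)"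
  by (auto simp: bilin_def intro: lin_sum_map)

context generic_q
begin

text \<open>\<open>coprod_word g w\<close> is the image of the braided coproduct of the word \<open>w\<close> under the bilinear map \<open>g\<close>.\<close>

primrec coprod_word :: "('k VV \<Rightarrow> 'k VV \<Rightarrow> 'k VV) \<Rightarrow> letter list \<Rightarrow> 'k VV"
  where "coprod_word g [] = g 1 1"
  | "coprod_word g (x # w) =
      coprod_word (\<lambda>l r. g (gen x * l) r) w + coprod_word (\<lambda>l r. g (Kx q x l) (gen x * r)) w"

definition coprod :: "('k VV \<Rightarrow> 'k VV \<Rightarrow> 'k VV) \<Rightarrow> 'k VV \<Rightarrow> 'k VV"
  where "coprod g = lin_ext (coprod_word g)"

lemma lin_coprod: "lin (coprod g)"
  by (simp add: coprod_def lin_lin_ext)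

lemma coprod_word_eq [simp]: "coprod g (word w) = coprod_word g w"
  by (simp add: coprod_def)

lemma coprod_L:
  "coprod g (gen x * v) = coprod (\<lambda>l r. g (gen x * l) r) v + coprod (\<lambda>l r. g (Kx q x l) (gen x * r)) v"
  by (rule lin_eqI[where S = "\<lambda>v. coprod g (gen x * v)"])
     (auto intro!: lin_rules lin_comp[OF lin_coprod] lin_coprod simp flip: word_Cons)

lemma coprod_word_lin: "lin T \<Longrightarrow> coprod_word (\<lambda>l r. T (g l r)) w = T (coprod_word g w)"
  by (induction w arbitrary: g) (simp_all add: lin_add[of T])

lemma coprod_word_diff: "coprod_word (\<lambda>l r. g l r - h l r) w = coprod_word g w - coprod_word h w"
  by (induction w arbitrary: g h) simp_all

lemma coprod_word_zero: "coprod_word (\<lambda>l r. 0) w = 0"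
  by (induction w) simp_all

lemma coprod_word_add: "coprod_word (\<lambda>l r. g l r + h l r) w = coprod_word g w + coprod_word h w"
  by (induction w arbitrary: g h) simp_all

lemma coprod_word_sum: "coprod_word (\<lambda>l r. \<Sum>i\<in>I. g i l r) w = (\<Sum>i\<in>I. coprod_word (g i) w)"
  by (induction I rule: infinite_finite_induct) (simp_all add: coprod_word_zero coprod_word_add)

lemma coprod_diff: "coprod (\<lambda>l r. g l r - h l r) v = coprod g v - coprod h v"
  by (rule lin_eqI[where v = v]) (auto intro!: lin_rules lin_coprod simp: coprod_word_diff)

lemma coprod_sum: "coprod (\<lambda>l r. \<Sum>i\<in>I. g i l r) v = (\<Sum>i\<in>I. coprod (g i) v)"
  by (rule lin_eqI[where v = v]) (auto intro!: lin_rules lin_coprod simp: coprod_word_sum)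

lemma coprod_word_J:
  assumes "bilin g" "\<And>l r. length l + length r = length w \<Longrightarrow> g (word l) (word r) \<in> J q"
  shows "coprod_word g w \<in> J q"
  using assms
proof (induction w arbitrary: g)
  case Nil
  then show ?case by (simp add: one_word)
next
  case (Cons x w)
  have "coprod_word (\<lambda>l r. g (gen x * l) r) w \<in> J q"
    using Cons.prems(2)[of "x # _"]
    by (intro Cons.IH bilin_left[OF Cons.prems(1)] lin_rules) (simp flip: word_Cons)
  moreover have "coprod_word (\<lambda>l r. g (Kx q x l) (gen x * r)) w \<in> J q"
  proof (intro Cons.IH bilin_comp[OF Cons.prems(1)] lin_rules)
    fix l r :: "letter list" assume "length l + length r = length w"
    then have "g (word l) (word (x # r)) \<in> J q"
      by (intro Cons.prems(2)) simp
    moreover have "lin (\<lambda>l. g l (word (x # r)))"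
      using Cons.prems(1) by (simp add: bilin_def)
    ultimately show "g (Kx q x (word l)) (gen x * word r) \<in> J q"
      by (simp add: lin_scale[of "\<lambda>l. g l (word (x # r))"] J_scale flip: word_Cons)
  qed
  ultimately show ?case by (simp add: J_add)
qed

lemma coprod_J:
  assumes "v \<in> tot n" "bilin g" "\<And>l r. length l + length r = n \<Longrightarrow> g (word l) (word r) \<in> J q"
  shows "coprod g v \<in> J q"
  by (rule supported_induct[OF assms(1) subspace_J lin_coprod]) (auto intro: coprod_word_J assms)

text \<open>A letter \<open>x\<close> placed in the right factor leaves \<open>Kx q x\<close> on the
  left one, and \<open>dl_Kx\<close> then yields exactly the scalar \<open>pw q X x\<close> that
  \<open>dl_L\<close> produces when the derivation passes \<open>x\<close>.\<close>

lemma coprod_dl: "bilin g \<Longrightarrow> coprod (\<lambda>l r. g (dl q X l) r) v = coprod g (dl q X v)"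
proof (rule lin_eqI[OF lin_coprod lin_comp[OF lin_coprod lin_dl]])
  fix w assume "bilin g"
  then show "coprod (\<lambda>l r. g (dl q X l) r) (word w) = coprod g (dl q X (word w))"
  proof (induction w arbitrary: g)
    case Nil
    then have "g 0 1 = 0"
      using lin_zero[of "\<lambda>l. g l 1"] by (simp add: bilin_def)
    then show ?case by (simp add: lin_zero[OF lin_coprod])
  next
    case (Cons x w)
    let ?g1 = "\<lambda>l r. g (gen x * l) r" and ?g2 = "\<lambda>l r. g (Kx q x l) (gen x * r)"
    have b1: "bilin ?g1" and b2: "bilin ?g2"
      by (intro bilin_left[OF Cons.prems] bilin_comp[OF Cons.prems] lin_rules)+
    have lg: "lin (\<lambda>l. g l r)" for r using Cons.prems by (simp add: bilin_def)
    have e1: "(\<lambda>l r. g (dl q X (gen x * l)) r) =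
        (\<lambda>l r. (if x = X then g l r else 0) + pw q X x \<cdot> ?g1 (dl q X l) r)"
      by (intro ext) (simp add: dl_L lin_add[OF lg] lin_scale[OF lg] lin_zero[OF lg])
    have e2: "(\<lambda>l r. g (dl q X (Kx q x l)) (gen x * r)) = (\<lambda>l r. pw q X x \<cdot> ?g2 (dl q X l) r)"
      by (intro ext) (simp add: dl_Kx lin_scale[OF lg])
    have "coprod_word (\<lambda>l r. g (dl q X (gen x * l)) r) w =
        (if x = X then coprod_word g w else 0) + pw q X x \<cdot> coprod ?g1 (dl q X (word w))"
      unfolding e1 using Cons.IH[OF b1]
      by (simp add: coprod_word_add coprod_word_lin[OF lin_scale_map[OF lin_id]] coprod_word_zero)
    moreover have "coprod_word (\<lambda>l r. g (dl q X (Kx q x l)) (gen x * r)) w = pw q X x \<cdot> coprod ?g2 (dl q X (word w))"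
      unfolding e2 using Cons.IH[OF b2]
      by (simp add: coprod_word_lin[OF lin_scale_map[OF lin_id]])
    ultimately show ?case
      by (auto simp: coprod_L lin_add[OF lin_coprod] lin_scale[OF lin_coprod] lin_zero[OF lin_coprod] scale_add)
  qed
qed

text \<open>As \<open>dl q y\<close> is adjoint to shuffling by \<open>y\<close> from the left,
  \<open>eps (dls ys v)\<close> is the word form of \<open>v\<close> with the shuffle product of the
  letters of \<open>ys\<close>. The radical of this pairing turns out to be
  \<open>J\<close>.\<close>

primrec dls :: "letter list \<Rightarrow> 'k VV \<Rightarrow> 'k VV"
  where "dls [] v = v" | "dls (y # ys) v = dls ys (dl q y v)"

lemma lin_dls: "lin (dls ys)"
proof (induction ys)
  case Nil
  show ?case by (simp add: lin_def)
next
  case (Cons y ys)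
  then show ?case using lin_comp[OF Cons lin_dl] by (simp add: fun_eq_iff lin_def)
qed

lemma coprod_dls: "bilin g \<Longrightarrow> coprod (\<lambda>l r. g (dls ys l) r) v = coprod g (dls ys v)"
proof (induction ys arbitrary: v)
  case (Cons y ys)
  then show ?case
    using coprod_dl[OF bilin_left[OF Cons.prems lin_dls[of ys]], where X = y and v = v] by simp
qed simp

lemma eps_Kx [simp]: "eps (Kx q X v) = eps v"
proof -
  have "subspace {v. eps (Kx q X v) = eps v}"
    by (auto simp: free_alg.subspace_def lookup_add)
  from subspace_UNIV_I[OF this, of v] show ?thesis
    by (simp add: lookup_word)
qed

lemma coprod_eps_left: "lin h \<Longrightarrow> coprod (\<lambda>l r. eps l \<cdot> h r) v = h v"
proof (rule lin_eqI[OF lin_coprod])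
  fix w assume "lin h"
  then have "coprod_word (\<lambda>l r. eps l \<cdot> h r) w = h (word w)"
  proof (induction w arbitrary: h)
    case Nil
    then show ?case by (simp add: one_word lookup_word)
  next
    case (Cons x w)
    from Cons.IH[OF lin_comp[OF Cons.prems lin_mult_left[OF lin_id]]] show ?case
      by (simp add: coprod_word_zero word_Cons)
  qed
  then show "coprod (\<lambda>l r. eps l \<cdot> h r) (word w) = h (word w)" by simp
qed

lemma coprod_eps_right: "lin h \<Longrightarrow> coprod (\<lambda>l r. eps r \<cdot> h l) v = h v"
proof (rule lin_eqI[OF lin_coprod])
  fix w assume "lin h"
  then have "coprod_word (\<lambda>l r. eps r \<cdot> h l) w = h (word w)"
  proof (induction w arbitrary: h)
    case Nil
    then show ?case by (simp add: one_word lookup_word)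
  next
    case (Cons x w)
    from Cons.IH[OF lin_comp[OF Cons.prems lin_mult_left[OF lin_id]]] show ?case
      by (simp add: coprod_word_zero word_Cons)
  qed
  then show "coprod (\<lambda>l r. eps r \<cdot> h l) (word w) = h (word w)" by simp
qed

section \<open>The braided antipode\<close>

primrec antipode_word :: "letter list \<Rightarrow> 'k VV"
  where "antipode_word [] = 1" | "antipode_word (x # w) = - (Kx q x (antipode_word w) * gen x)"

definition antipode :: "'k VV \<Rightarrow> 'k VV" where "antipode = lin_ext antipode_word"

lemma lin_antipode: "lin antipode"
  by (simp add: antipode_def lin_lin_ext)

lemma antipode_word_eq [simp]: "antipode (word w) = antipode_word w"
  by (simp add: antipode_def)

lemma antipode_one [simp]: "antipode 1 = 1"
  by (metis antipode_word.simps(1) antipode_word_eq one_word)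

lemma antipode_L: "antipode (gen x * v) = - (Kx q x (antipode v) * gen x)"
proof -
  have L: "lin (\<lambda>v. (- 1) \<cdot> (Kx q x (antipode v) * gen x))"
    by (intro lin_rules lin_antipode)
  have "antipode (gen x * v) = (- 1) \<cdot> (Kx q x (antipode v) * gen x)"
    by (rule lin_eqI[OF lin_comp[OF lin_antipode lin_mult_left[OF lin_id]] L])
       (simp add: scale_minus flip: word_Cons)
  then show ?thesis by (simp add: scale_minus)
qed

text \<open>Prefixing a letter \<open>x\<close> applies \<open>ad x\<close> to the whole
  convolution, and \<open>ad x\<close> kills the value 1 that belongs to the empty word.\<close>

lemma coprod_antipode: "w \<noteq> [] \<Longrightarrow> coprod_word (\<lambda>l r. l * antipode r) w = 0"
proof -
  have *: "coprod_word (\<lambda>l r. l * antipode r) (x # w) = ad x (coprod_word (\<lambda>l r. l * antipode r) w)" for x w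
  proof -
    have "ad x (l * antipode r) = gen x * l * antipode r + Kx q x l * antipode (gen x * r)" for l r
      unfolding ad_mult by (simp add: ad_def antipode_L algebra_simps)
    then show ?thesis
      by (simp add: coprod_word_add flip: coprod_word_lin[OF lin_ad])
  qed
  assume "w \<noteq> []"
  then show ?thesis
    by (induction w rule: list_nonempty_induct) (simp_all only: *, simp_all)
qed

text \<open>The exponent is the sum of \<open>pairing\<close> over all unordered pairs of positions:
  the quadratic form of the content is 2 (a - b)^2, the diagonal contributes 2 (a + b), and half the
  difference remains.\<close>

lemma antipode_content:
  "content X a b w \<Longrightarrow>
    antipode_word w = ((- 1) ^ (a + b) * q powi ((int a - int b)\<^sup>2 - int (a + b))) \<cdot> word (rev w)"
proof (induction w arbitrary: a b)
  case Nil
  then show ?case by (simp add: content_def one_word)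
next
  case (Cons x w)
  have exp: "q powi ((m + 1)\<^sup>2 - (n + 1)) = q powi (2 * m) * q powi (m\<^sup>2 - n)"
    "q powi ((m - 1)\<^sup>2 - (n + 1)) = q powi (- (2 * m)) * q powi (m\<^sup>2 - n)" for m n :: int
    by (simp_all add: power2_eq_square algebra_simps flip: power_int_add)
  show ?case
  proof (cases "x = X")
    case True
    then obtain a' where a: "a = Suc a'" and c: "content X a' b w"
      using Cons.prems by (auto simp: content_def)
    show ?thesis
      using exp(1)[of "int a' - int b" "int a' + int b"] True
      by (simp add: a Cons.IH[OF c] weight_content[OF c] scale_scale scale_minus algebra_simps
          flip: word_snoc)
  next
    case False
    then have x: "x = other X" using letter_cases by blast
    then obtain b' where b: "b = Suc b'" and c: "content X a b' w"
      using Cons.prems by (cases b) (auto simp: content_def)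
    show ?thesis
      using exp(2)[of "int a - int b'" "int a + int b'"]
      by (simp add: b x Cons.IH[OF c] weight_content[OF c] scale_scale scale_minus algebra_simps
          flip: word_snoc)
  qed
qed

lemma antipode_J: "v \<in> J q \<Longrightarrow> antipode v \<in> J q"
proof -
  define f where "f w = (let a = count_list w LA; b = count_list w LB in
    (- 1) ^ (a + b) * q powi ((int a - int b)\<^sup>2 - int (a + b)))" for w
  assume v: "v \<in> J q"
  have "antipode v = revV (diag f v)"
    by (rule lin_eqI[OF lin_antipode lin_comp[OF lin_revV lin_diag]])
       (simp add: f_def Let_def antipode_content[of LA "count_list _ LA" "count_list _ LB"] content_def)
  then show ?thesis
    using J_revV[OF J_diag[OF v, of f]] by (simp add: f_def)
qed

lemma eps_dls: "v \<in> tot n \<Longrightarrow> n \<noteq> length ys \<Longrightarrow> eps (dls ys v) = 0"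
proof (induction ys arbitrary: n v)
  case Nil
  then show ?case by (auto simp: supported_def)
next
  case (Cons y ys)
  show ?case
  proof (cases n)
    case 0
    then show ?thesis using dl_tot_0[of v q y] Cons.prems lin_zero[OF lin_dls] by simp
  next
    case (Suc m)
    then show ?thesis using Cons.IH[OF dl_tot[of v m q y]] Cons.prems by simp
  qed
qed

lemma dls_J: "v \<in> J q \<Longrightarrow> dls ys v \<in> J q"
  by (induction ys arbitrary: v) (auto intro: J_dl)

text \<open>The map \<open>\<Psi>\<close> lists the pairing values, and by hypothesis its kernel in
  degree \<open>k\<close> lies in \<open>J\<close>. With a linear right inverse \<open>T\<close> of
  \<open>\<Psi>\<close> on that degree, the values of \<open>T\<close> on words serve as dual
  elements, since \<open>v - T (\<Psi> v)\<close> is in the kernel.\<close>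

lemma dual_basis:
  assumes nondeg: "\<And>v. v \<in> tot k \<Longrightarrow> (\<And>ys. length ys = k \<Longrightarrow> eps (dls ys v) = 0) \<Longrightarrow> v \<in> J q"
  shows "\<exists>e. \<forall>v\<in>tot k. v - (\<Sum>ys | length ys = k. eps (dls ys v) \<cdot> e ys) \<in> J q"
proof -
  define \<Psi> where "\<Psi> v = (\<Sum>ys | length ys = k. eps (dls ys v) \<cdot> word ys)" for v
  have lin: "lin \<Psi>"
    unfolding \<Psi>_def by (intro lin_sum_map lin_comp[OF lin_coeff_scale lin_dls])
  have lookup: "lookup (\<Psi> v) ys = eps (dls ys v)" if "length ys = k" for v ys
    using that by (simp add: \<Psi>_def lookup_sum lookup_word finite_words if_distrib sum.If_cases cong: if_cong)
  interpret vector_space_pair "scale :: 'k \<Rightarrow> 'k VV \<Rightarrow> 'k VV" "scale :: 'k \<Rightarrow> 'k VV \<Rightarrow> 'k VV"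
    by unfold_locales
  obtain T where T: "range T \<subseteq> tot k" "lin T" "\<And>v. v \<in> tot k \<Longrightarrow> \<Psi> (T (\<Psi> v)) = \<Psi> v"
    using linear_exists_right_inverse_on[OF lin[unfolded lin_iff_linear] subspace_supported, of "\<lambda>w. length w = k"]
    by (auto simp: lin_iff_linear)
  have "v - (\<Sum>ys | length ys = k. eps (dls ys v) \<cdot> T (word ys)) \<in> J q" if v: "v \<in> tot k" for v
  proof -
    have "v - T (\<Psi> v) \<in> J q"
    proof (rule nondeg)
      show "v - T (\<Psi> v) \<in> tot k"
        using T(1) v by (intro subspace_diff subspace_supported) auto
      fix ys :: "letter list" assume "length ys = k"
      then have "eps (dls ys (v - T (\<Psi> v))) = lookup (\<Psi> (v - T (\<Psi> v))) ys"
        by (simp add: lookup)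
      also have "\<dots> = 0"
        by (simp add: lin_diff[OF lin] T(3)[OF v])
      finally show "eps (dls ys (v - T (\<Psi> v))) = 0" .
    qed
    then show ?thesis
      by (simp add: \<Psi>_def lin_sum[OF T(2)] lin_scale[OF T(2)])
  qed
  then show ?thesis by (intro exI[of _ "\<lambda>ys. T (word ys)"] ballI)
qed

text \<open>Modulo \<open>J\<close> the braided coproduct of a singular vector \<open>v\<close> is \<open>v \<otimes> 1 + 1 \<otimes> v\<close>, so the antipode
  axiom gives \<open>v + S v = 0\<close>.\<close>

lemma antipode_singular:
  assumes v: "v \<in> tot n" "n > 0" and sing: "\<And>Z. dl q Z v \<in> J q"
    and nondeg: "\<And>k u. 0 < k \<Longrightarrow> k < n \<Longrightarrow> u \<in> tot k \<Longrightarrow>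
      (\<And>ys. length ys = k \<Longrightarrow> eps (dls ys u) = 0) \<Longrightarrow> u \<in> J q"
  shows "v + antipode v \<in> J q"
proof -
  have "\<forall>k. \<exists>e. 0 < k \<longrightarrow> k < n \<longrightarrow>
      (\<forall>v\<in>tot k. v - (\<Sum>ys | length ys = k. eps (dls ys v) \<cdot> e ys) \<in> J q)"
    (is "\<forall>k. \<exists>e. ?P k e")
  proof
    fix k
    show "\<exists>e. ?P k e"
    proof (cases "0 < k \<and> k < n")
      case True
      have "\<exists>e. \<forall>v\<in>tot k. v - (\<Sum>ys | length ys = k. eps (dls ys v) \<cdot> e ys) \<in> J q"
      proof (rule dual_basis)
        fix u assume "u \<in> tot k" "\<And>ys. length ys = k \<Longrightarrow> eps (dls ys u) = 0"
        then show "u \<in> J q" using True by (intro nondeg[of k u]) simp_all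
      qed
      then obtain e where "\<forall>v\<in>tot k. v - (\<Sum>ys | length ys = k. eps (dls ys v) \<cdot> e ys) \<in> J q" ..
      then show ?thesis by (intro exI[of _ e] impI)
    qed auto
  qed
  from choice[OF this] obtain e where "\<forall>k. ?P k (e k)" ..
  then have e: "v - (\<Sum>ys | length ys = k. eps (dls ys v) \<cdot> e k ys) \<in> J q"
    if "0 < k" "k < n" "v \<in> tot k" for k v
    using that by simp
  let ?M = "\<lambda>k ys l r. eps (dls ys l) \<cdot> (e k ys * antipode r)"
  \<comment> \<open>From the antipode convolution \<open>?g\<close> subtracts the two boundary terms
    and, for each intermediate degree of \<open>l\<close>, the expansion of \<open>l\<close> along
    the dual elements. What remains is in \<open>J\<close> on every pair of words of total length
    \<open>n\<close>, so the intermediate part of the coproduct of \<open>v\<close> need not be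
    computed.\<close>
  let ?g = "\<lambda>l r. l * antipode r - eps l \<cdot> antipode r - eps r \<cdot> l
    - (\<Sum>k\<in>{0<..<n}. \<Sum>ys | length ys = k. ?M k ys l r)"
  have bM: "bilin (\<lambda>l r. eps l \<cdot> (e k ys * antipode r))" for k ys
    by (intro bilin_eps lin_rules lin_antipode)
  have bil: "bilin ?g"
    by (intro bilin_diff bilin_sum bilin_eps lin_antipode lin_id bilin_comp[OF bilin_mult lin_id]
        bilin_left[OF bM lin_dls])
  have g0: "coprod (\<lambda>l r. l * antipode r) v = 0"
  proof -
    have "coprod (\<lambda>l r. l * antipode r) v \<in> {0}"
      using \<open>n > 0\<close> by (intro supported_induct[OF v(1) _ lin_coprod]) (auto intro!: coprod_antipode)
    then show ?thesis by simp
  qed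
  \<comment> \<open>The derivatives in the left slot are moved onto \<open>v\<close>, after which
    the counit removes the slot. Since \<open>v\<close> is singular, each of these products will lie
    in \<open>J\<close>.\<close>
  have gM: "coprod (?M k ys) v = e k ys * antipode (dls ys v)" for k ys
    unfolding coprod_dls[OF bM] by (rule coprod_eps_left) (intro lin_rules lin_antipode)
  have "coprod ?g v = 0 - antipode v - v - (\<Sum>k\<in>{0<..<n}. \<Sum>ys | length ys = k. e k ys * antipode (dls ys v))"
    unfolding coprod_diff coprod_sum g0 gM coprod_eps_left[OF lin_antipode] coprod_eps_right[OF lin_id] ..
  moreover have "coprod ?g v \<in> J q"
  proof (rule coprod_J[OF v(1) bil])
    fix l r :: "letter list" assume len: "length l + length r = n"
    have inner: "(\<Sum>ys | length ys = k. ?M k ys (word l) (word r)) =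
        (if k = length l then (\<Sum>ys | length ys = k. eps (dls ys (word l)) \<cdot> e k ys) * antipode (word r) else 0)" for k
      using eps_dls[of "word l" "length l"] by (auto simp: sum_distrib_right intro!: sum.neutral)
    have mid: "(\<Sum>k\<in>{0<..<n}. \<Sum>ys | length ys = k. ?M k ys (word l) (word r)) =
        (if 0 < length l \<and> length l < n then
          (\<Sum>ys | length ys = length l. eps (dls ys (word l)) \<cdot> e (length l) ys) * antipode (word r) else 0)"
      unfolding inner by (simp add: sum.delta)
    consider "l = []" "r \<noteq> []" | "l \<noteq> []" "r = []" | "l \<noteq> []" "r \<noteq> []"
      using len \<open>n > 0\<close> by auto
    then show "?g (word l) (word r) \<in> J q"
    proof cases
      case 1
      then show ?thesis unfolding mid by (simp add: lookup_word flip: one_word)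
    next
      case 2
      then show ?thesis unfolding mid using len by (simp add: lookup_word flip: one_word)
    next
      case 3
      then have l: "0 < length l" "length l < n" using len by auto
      from J_mult(2)[OF e[OF l, of "word l"], of "antipode (word r)"] show ?thesis
        unfolding mid using 3 l by (simp add: lookup_word left_diff_distrib)
    qed
  qed
  moreover have "(\<Sum>k\<in>{0<..<n}. \<Sum>ys | length ys = k. e k ys * antipode (dls ys v)) \<in> J q"
  proof (intro J_sum J_mult antipode_J)
    fix k and ys :: "letter list" assume "k \<in> {0<..<n}" "ys \<in> {ys. length ys = k}"
    then obtain y ys' where "ys = y # ys'" by (cases ys) auto
    then show "dls ys v \<in> J q" by (simp add: dls_J sing)
  qed
  ultimately have "- antipode v - v \<in> J q"
    using J_add[of "coprod ?g v" q "\<Sum>k\<in>{0<..<n}. \<Sum>ys | length ys = k. e k ys * antipode (dls ys v)"]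
    by simp
  from J_neg[OF this] show ?thesis by simp
qed

lemma singular_equal:
  assumes v: "v \<in> homog X a a" "a > 0" and S: "v + antipode v \<in> J q"
  shows "v \<in> J q"
proof -
  \<comment> \<open>The antipode scalar at equal content: the square in the exponent vanishes and
    the total degree is even. Applying reversal a second time brings in
    \<open>c * c\<close>.\<close>
  define c where "c = inverse (q ^ (2 * a))"
  have "antipode v - c \<cdot> revV v \<in> {0}"
    by (rule supported_induct[OF v(1)])
       (auto intro!: lin_rules lin_antipode simp: antipode_content c_def power_int_def
         power_inverse mult_2 simp flip: of_nat_add)
  then have "v + c \<cdot> revV v \<in> J q"
    using S by simp
  moreover from J_scale[OF J_revV[OF this], of c] have "c \<cdot> revV v + (c * c) \<cdot> v \<in> J q"
    by (simp add: scale_add scale_scale)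
  ultimately have "(1 - c * c) \<cdot> v \<in> J q"
    using J_diff[of "v + c \<cdot> revV v" q "c \<cdot> revV v + (c * c) \<cdot> v"] by (simp add: scale_diff)
  moreover have "1 - c * c \<noteq> 0"
    using not_root[of "4 * a"] v(2) by (simp add: c_def field_simps flip: power_add)
  ultimately show ?thesis by (simp add: J_scale_iff)
qed

section \<open>Nondegeneracy of \<open>\<V>/J\<close>\<close>

definition nondeg_at :: "nat \<Rightarrow> bool"
  where "nondeg_at n \<longleftrightarrow> (\<forall>X a b v. a + b = n \<longrightarrow> v \<in> homog X a b \<longrightarrow> (\<forall>Z. dl q Z v \<in> J q) \<longrightarrow> v \<in> J q)"

lemma J_dl_proj: "(\<And>Z. dl q Z v \<in> J q) \<Longrightarrow> dl q Z (proj X a b v) \<in> J q"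
proof -
  assume v: "\<And>Z. dl q Z v \<in> J q"
  have 1: "proj X a b v = proj (other X) b a v"
    by (simp add: proj_def content_other)
  consider "Z = X" | "Z = other X" using letter_cases by blast
  then show ?thesis
  proof cases
    case 1
    then show ?thesis using v by (simp add: dl_proj J_proj split: nat.split)
  next
    case 2
    then show ?thesis unfolding 1 using v by (simp add: dl_proj J_proj split: nat.split)
  qed
qed

lemma tot_proj_sum: "v \<in> tot n \<Longrightarrow> v = (\<Sum>(a, b)\<in>{(a, b). a + b = n}. proj LA a b v)"
proof (rule proj_sum)
  show "finite {(a, b). a + b = n}"
    by (rule finite_subset[of _ "{..n} \<times> {..n}"]) auto
  fix w assume "v \<in> tot n" "lookup v w \<noteq> 0"
  then show "(count_list w LA, count_list w (other LA)) \<in> {(a, b). a + b = n}"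
    using content_length[of LA "count_list w LA" "count_list w LB" w] by (auto simp: supported_def content_def)
qed

lemma nondeg_at_tot:
  assumes "nondeg_at n" "v \<in> tot n" "\<And>Z. dl q Z v \<in> J q"
  shows "v \<in> J q"
proof -
  have "proj LA a b v \<in> J q" if "a + b = n" for a b
    using assms(1) that J_dl_proj[OF assms(3)] proj_homog unfolding nondeg_at_def by blast
  then have "(\<Sum>(a, b)\<in>{(a, b). a + b = n}. proj LA a b v) \<in> J q"
    by (intro J_sum) auto
  then show ?thesis using tot_proj_sum[OF assms(2)] by simp
qed

text \<open>The first letter of \<open>ys\<close> can be charged to \<open>v\<close>, so the
  hypothesis passes to the derivatives of \<open>v\<close>, one degree lower.\<close>

lemma pairing_nondeg:
  assumes "\<And>m. 0 < m \<Longrightarrow> m \<le> n \<Longrightarrow> nondeg_at m"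
    and "v \<in> tot n" "\<And>ys. length ys = n \<Longrightarrow> eps (dls ys v) = 0"
  shows "v \<in> J q"
  using assms
proof (induction n arbitrary: v)
  case 0
  then show ?case using eps_supported[of v] by simp
next
  case (Suc n)
  have "dl q Z v \<in> J q" for Z
  proof (rule Suc.IH[OF _ dl_tot])
    fix ys :: "letter list" assume "length ys = n"
    then show "eps (dls ys (dl q Z v)) = 0"
      using Suc.prems(3)[of "Z # ys"] by simp
  qed (use Suc.prems in auto)
  from nondeg_at_tot[OF Suc.prems(1)[OF _ order_refl] Suc.prems(2) this] show ?case
    by simp
qed

lemma dr_homog_0: "v \<in> homog X 0 b \<Longrightarrow> dr q X v = 0"
  by (simp add: dr_def dl_homog_0[OF revV_homog])

lemma dr_eq_dl: "v \<in> tot 1 \<Longrightarrow> dr q X v = dl q X v"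
proof -
  assume v: "v \<in> tot 1"
  have "dr q X v - dl q X v \<in> {0}"
    by (rule supported_induct[OF v]) (auto intro!: lin_rules simp: length_Suc_conv dr_word_Cons)
  then show ?thesis by simp
qed

theorem nondeg: "n > 0 \<Longrightarrow> nondeg_at n"
proof (induction n rule: less_induct)
  case (less n)
  show ?case
    unfolding nondeg_at_def
  proof (intro allI impI)
    fix X a b v
    assume ab: "a + b = n" and v: "v \<in> homog X a b" and sing: "\<forall>Z. dl q Z v \<in> J q"
    \<comment> \<open>Left and right derivations commute, so the left derivatives of
      \<open>dr q Z v\<close> lie in \<open>J\<close> and the induction applies to it. Degree one is
      separate: its derivatives are constants, and nondegeneracy fails for constants, but there
      \<open>dr\<close> and \<open>dl\<close> agree.\<close>
    have dr0: "dr q Z v \<in> J q" if "v \<in> homog Z a b" "a + b = n" for Z a b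
    proof (cases a)
      case 0
      then show ?thesis using dr_homog_0 that by auto
    next
      case (Suc a')
      show ?thesis
      proof (cases "n = 1")
        case True
        then show ?thesis using dr_eq_dl homog_tot[OF that(1)] that(2) sing by metis
      next
        case False
        then have "nondeg_at (a' + b)"
          using that(2) Suc by (intro less.IH) auto
        moreover have "dr q Z v \<in> homog Z a' b" using that(1) Suc by (intro dr_homog) simp
        moreover have "dl q Y (dr q Z v) \<in> J q" for Y
          using sing by (simp add: dl_dr J_dr)
        ultimately show ?thesis unfolding nondeg_at_def by blast
      qed
    qed
    have v': "v \<in> homog (other X) b a" using v by (simp add: homog_other)
    consider "a > b" | "b > a" | "a = b" by linarith
    then show "v \<in> J q"
    proof cases
      case 1
      show ?thesis
        using singular_unequal[OF v 1] dr0[OF v ab] sing by blast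
    next
      case 2
      show ?thesis
        using singular_unequal[OF v' 2] dr0[OF v'] ab sing by (simp add: add.commute)
    next
      case 3
      have "v + antipode v \<in> J q"
      proof (rule antipode_singular)
        show "v \<in> tot n" using homog_tot[OF v] ab by simp
        \<comment> \<open>The induction hypothesis supplies the dual elements in the degrees below
          \<open>n\<close> that the antipode argument uses.\<close>
        fix k u assume "k < n" "u \<in> tot k" "\<And>ys. length ys = k \<Longrightarrow> eps (dls ys u) = 0"
        then show "u \<in> J q"
          by (intro pairing_nondeg[of k u] less.IH) simp_all
      qed (use less.prems sing in auto)
      then show ?thesis
        using v 3 ab less.prems by (intro singular_equal[of v X a]) auto
    qed
  qed
qed

lemma pairing_kernel: "v \<in> tot n \<Longrightarrow> (\<And>ys. length ys = n \<Longrightarrow> eps (dls ys v) = 0) \<Longrightarrow> v \<in> J q"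
  by (rule pairing_nondeg[OF nondeg])

end

section \<open>The operators of the eight rules\<close>

lemma exhaust_type_4: fixes i :: 4 shows "i = 0 \<or> i = 1 \<or> i = 2 \<or> i = 3"
proof (induct i)
  case (of_int z)
  then have "z = 0 \<or> z = 1 \<or> z = 2 \<or> z = 3" by auto
  then show ?case by auto
qed

lemma arith_type_4 [simp]:
  "(0 :: 4) \<noteq> 2" "(0 :: 4) \<noteq> 3" "(1 :: 4) \<noteq> 2" "(1 :: 4) \<noteq> 3" "(2 :: 4) \<noteq> 3"
  "(1 :: 4) \<noteq> 0" "(2 :: 4) \<noteq> 0" "(3 :: 4) \<noteq> 0" "(2 :: 4) \<noteq> 1" "(3 :: 4) \<noteq> 1" "(3 :: 4) \<noteq> 2"
  "(1 :: 4) + 1 = 2" "(2 :: 4) + 1 = 3" "(3 :: 4) + 1 = 0" "(1 :: 4) + 2 = 3" "(2 :: 4) + 2 = 0" "(3 :: 4) + 2 = 1"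
  by simp_all

context generic_q
begin

subsection \<open>Rotation of words\<close>

text \<open>Moving all letters of \<open>w\<close> to the other end, one at a time and each swapped, multiplies by \<open>q powi (-2)\<close> per letter:
  the remaining exponents cancel in pairs by symmetry of \<^const>\<open>pairing\<close>. Doing it twice restores \<open>w\<close>.\<close>

lemma rotation:
  fixes F :: "letter list \<Rightarrow> 'k VV"
  assumes S: "subspace S"
    and F: "\<And>X u. F (X # u) - q powi (weight X u - 2) \<cdot> F (u @ [other X]) \<in> S"
    and "w \<noteq> []"
  shows "F w \<in> S"
proof -
  have sum_weight: "(\<Sum>y\<leftarrow>u. weight y (z @ [other x])) = (\<Sum>y\<leftarrow>u. weight y z) - weight x u" for u z x
    by (induction u) (simp_all add: pairing_other pairing_commute[of _ x])
  have step: "F (u @ z) - q powi ((\<Sum>x\<leftarrow>u. weight x z) - 2 * int (length u)) \<cdot> F (z @ map other u) \<in> S" for u z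
  proof (induction u arbitrary: z)
    case Nil
    show ?case using S by (simp add: subspace_0)
  next
    case (Cons x u)
    define a b where "a = q powi (weight x (u @ z) - 2)"
      and "b = q powi ((\<Sum>x\<leftarrow>u. weight x z) - weight x u - 2 * int (length u))"
    have "F (x # u @ z) - a \<cdot> F (u @ z @ [other x]) \<in> S"
      using F[of x "u @ z"] by (simp add: a_def)
    moreover have "a \<cdot> (F (u @ z @ [other x]) - b \<cdot> F (z @ other x # map other u)) \<in> S"
      using Cons[of "z @ [other x]"] unfolding sum_weight by (intro subspace_scale[OF S]) (simp add: b_def)
    ultimately have "F (x # u @ z) - (a * b) \<cdot> F (z @ other x # map other u) \<in> S"
      by (auto dest: subspace_add[OF S] simp: scale_diff scale_scale)
    moreover have "a * b = q powi ((\<Sum>x\<leftarrow>x # u. weight x z) - 2 * int (length (x # u)))"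
      by (simp add: a_def b_def algebra_simps flip: power_int_add)
    ultimately show ?case by simp
  qed
  define c where "c = q powi (- 2 * int (length w))"
  have "F w - c \<cdot> F (map other w) \<in> S"
    using step[of w "[]"] by (simp add: c_def)
  moreover have "c \<cdot> (F (map other w) - c \<cdot> F w) \<in> S"
    using step[of "map other w" "[]"] by (intro subspace_scale[OF S]) (simp add: c_def o_def)
  ultimately have "(F w - c \<cdot> F (map other w)) + c \<cdot> (F (map other w) - c \<cdot> F w) \<in> S"
    by (rule subspace_add[OF S])
  then have "(1 - c * c) \<cdot> F w \<in> S"
    by (simp add: scale_diff scale_scale)
  then have "inverse (1 - c * c) \<cdot> (1 - c * c) \<cdot> F w \<in> S"
    by (rule subspace_scale[OF S])
  moreover have "1 - c * c \<noteq> 0"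
    using powi_eq_1_iff[of "- 4 * int (length w)"] assms(3) q0 by (auto simp: c_def simp flip: power_int_add)
  ultimately show ?thesis by (simp only: scale_scale) simp
qed

subsection \<open>The \<open>q\<close>-Serre relations for operators\<close>

definition serre_op :: "('k VV \<Rightarrow> 'k VV) \<Rightarrow> ('k VV \<Rightarrow> 'k VV) \<Rightarrow> 'k VV \<Rightarrow> 'k VV"
  where "serre_op y z v = y (y (y (z v))) - qthree q \<cdot> y (y (z (y v))) + qthree q \<cdot> y (z (y (y v))) - z (y (y (y v)))"

lemma lin_serre_op: "lin y \<Longrightarrow> lin z \<Longrightarrow> lin (serre_op y z)"
  by (simp add: lin_def serre_op_def scale_add scale_diff scale_scale mult.commute)

lemma serre_scalars:
  assumes "s * t = 1" "s = q\<^sup>2 \<or> s = inverse (q\<^sup>2)"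
  shows "t * (1 + s + s\<^sup>2) = qthree q" "qthree q * s\<^sup>2 * t = 1 + s + s\<^sup>2"
    "1 - qthree q * s + qthree q * s\<^sup>2 - s ^ 3 = 0"
proof -
  define p where "p = q\<^sup>2"
  have p: "p \<noteq> 0" "qthree q = p + 1 + inverse p" using q0 by (simp_all add: p_def qthree_eq)
  have t: "t = inverse s" using assms(1) by (metis inverse_unique)
  consider "s = p" "t = inverse p" | "s = inverse p" "t = p"
    using assms(2) t by (auto simp: p_def)
  note cases = this
  show "t * (1 + s + s\<^sup>2) = qthree q"
    unfolding p(2) using p(1)
    by (cases rule: cases; hypsubst) (simp_all add: field_simps power2_eq_square)
  show "qthree q * s\<^sup>2 * t = 1 + s + s\<^sup>2"
    unfolding p(2) using p(1)
    by (cases rule: cases; hypsubst) (simp_all add: field_simps power2_eq_square)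
  show "1 - qthree q * s + qthree q * s\<^sup>2 - s ^ 3 = 0"
    unfolding p(2) using p(1)
    by (cases rule: cases; hypsubst) (simp_all add: field_simps power2_eq_square power3_eq_cube)
qed

text \<open>Pulling \<open>L\<close> out through the four operators leaves correction terms with
  three of them. Their coefficients are the expressions of \<open>serre_scalars\<close> and a
  multiple of \<open>1 - s * t\<close>, so they vanish whatever \<open>c\<close> and
  \<open>d\<close> are.\<close>

lemma serre_op_commute:
  assumes "lin y" "lin z" "lin L"
    and y: "\<And>v. y (L v) = s \<cdot> L (y v) + c \<cdot> v" and z: "\<And>v. z (L v) = t \<cdot> L (z v) + d \<cdot> v"
    and st: "s * t = 1" "s = q\<^sup>2 \<or> s = inverse (q\<^sup>2)"
  shows "serre_op y z (L v) = s\<^sup>2 \<cdot> L (serre_op y z v)"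
proof -
  note lins = lin_add[OF assms(1)] lin_scale[OF assms(1)] lin_diff[OF assms(1)]
    lin_add[OF assms(2)] lin_scale[OF assms(2)] lin_diff[OF assms(2)]
    lin_add[OF assms(3)] lin_scale[OF assms(3)] lin_diff[OF assms(3)]
  let ?h = "qthree q"
  have "serre_op y z (L v) = (s ^ 3 * t) \<cdot> L (serre_op y z v)
      + (c * (t * (1 + s + s\<^sup>2) - ?h)) \<cdot> y (y (z v)) + (?h * c * (1 + s) * (1 - s * t)) \<cdot> y (z (y v))
      + (c * (?h * s\<^sup>2 * t - (1 + s + s\<^sup>2))) \<cdot> z (y (y v))
      + (d * (1 - ?h * s + ?h * s\<^sup>2 - s ^ 3)) \<cdot> y (y (y v))"
    unfolding serre_op_def
    by (simp add: y z lins scale_add scale_left_add scale_diff scale_scale algebra_simps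
        power2_eq_square power3_eq_cube)
  moreover have "s ^ 3 * t = s\<^sup>2"
    using st(1) by (simp add: power3_eq_cube power2_eq_square mult.assoc)
  ultimately show ?thesis
    by (simp only: serre_scalars[OF st] st(1)) simp
qed

text \<open>The mirror image of the preceding computation, for operators that are known by how a
  derivation passes them.\<close>

lemma serre_op_commute':
  assumes "lin y" "lin z" "lin D"
    and y: "\<And>v. D (y v) = s \<cdot> y (D v) + c \<cdot> v" and z: "\<And>v. D (z v) = t \<cdot> z (D v) + d \<cdot> v"
    and st: "s * t = 1" "s = q\<^sup>2 \<or> s = inverse (q\<^sup>2)"
  shows "D (serre_op y z v) = s\<^sup>2 \<cdot> serre_op y z (D v)"
proof -
  note lins = lin_add[OF assms(1)] lin_scale[OF assms(1)] lin_diff[OF assms(1)]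
    lin_add[OF assms(2)] lin_scale[OF assms(2)] lin_diff[OF assms(2)]
    lin_add[OF assms(3)] lin_scale[OF assms(3)] lin_diff[OF assms(3)]
  let ?h = "qthree q"
  have "D (serre_op y z v) = (s ^ 3 * t) \<cdot> serre_op y z (D v)
      + (c * (1 + s + s\<^sup>2 - ?h * s\<^sup>2 * t)) \<cdot> y (y (z v)) + (?h * c * (1 + s) * (s * t - 1)) \<cdot> y (z (y v))
      + (c * (?h - t * (1 + s + s\<^sup>2))) \<cdot> z (y (y v))
      - (d * (1 - ?h * s + ?h * s\<^sup>2 - s ^ 3)) \<cdot> y (y (y v))"
    unfolding serre_op_def
    by (simp add: y z lins scale_add scale_left_add scale_diff scale_scale algebra_simps
        power2_eq_square power3_eq_cube)
  moreover have "s ^ 3 * t = s\<^sup>2"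
    using st(1) by (simp add: power3_eq_cube power2_eq_square mult.assoc)
  ultimately show ?thesis
    by (simp only: serre_scalars[OF st] st(1)) simp
qed

section \<open>The operators x_1, x_3 of rule I and x_0, x_2 of rule II\<close>

definition x1I :: "letter \<Rightarrow> 'k VV \<Rightarrow> 'k VV"
  where "x1I X v = (1 - q\<^sup>2) \<cdot> (dl q X v - dr q (other X) (Kx q X v))"

definition x0II :: "letter \<Rightarrow> 'k VV \<Rightarrow> 'k VV"
  where "x0II X v = (1 - q\<^sup>2) \<cdot> (gen X * v - Kx q X (v * gen (other X)))"

lemma lin_x1I: "lin (x1I X)" and lin_x0II: "lin (x0II X)"
  unfolding x1I_def x0II_def by (intro lin_rules)+

lemma x1I_L: "x1I X (gen X * v) = q\<^sup>2 \<cdot> (gen X * x1I X v) + (1 - q\<^sup>2) \<cdot> v"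
  unfolding x1I_def
  by (simp add: dl_L dr_L Kx_L scale_add scale_diff scale_scale right_diff_distrib mult.commute)

text \<open>Here the constant comes from the right derivation, because \<open>Kx q (other X)\<close>
  undoes \<open>Kx q X\<close>. The factor 1 - q^2 makes each constant equal to 1 minus the
  commutation scalar, as the relations between neighbouring generators require.\<close>

lemma x1I_L_other: "x1I X (gen (other X) * v) = inverse (q\<^sup>2) \<cdot> (gen (other X) * x1I X v) + (1 - inverse (q\<^sup>2)) \<cdot> v"
proof -
  have "(1 - q\<^sup>2) * inverse (q\<^sup>2) = - (1 - inverse (q\<^sup>2))" by (simp add: field_simps)
  then show ?thesis
    unfolding x1I_def
    by (simp add: dl_L dr_L Kx_L Kx_other scale_add scale_diff scale_scale right_diff_distrib mult.commute scale_minus)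
qed

lemma dl_x0II: "dl q X (x0II X v) = q\<^sup>2 \<cdot> x0II X (dl q X v) + (1 - q\<^sup>2) \<cdot> v"
  unfolding x0II_def
  by (simp add: dl_L dl_R dl_Kx scale_add scale_diff scale_scale mult.commute)

lemma dl_x0II_other: "dl q X (x0II (other X) v) = inverse (q\<^sup>2) \<cdot> x0II (other X) (dl q X v) + (1 - inverse (q\<^sup>2)) \<cdot> v"
proof -
  have "(1 - q\<^sup>2) * inverse (q\<^sup>2) = - (1 - inverse (q\<^sup>2))" by (simp add: field_simps)
  then show ?thesis
    unfolding x0II_def
    by (simp add: dl_L dl_R dl_Kx Kx_other scale_add scale_diff scale_scale mult.commute scale_minus)
qed

text \<open>The Serre combination passes each letter up to a scalar, so its vanishing at
  \<open>1\<close> spreads to all words.\<close>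

lemma serre_op_zero:
  assumes "lin y" "lin z" "y 1 = 0" "z 1 = 0"
    and y: "\<And>x v. y (gen x * v) = s x \<cdot> (gen x * y v) + c x \<cdot> v"
    and z: "\<And>x v. z (gen x * v) = inverse (s x) \<cdot> (gen x * z v) + d x \<cdot> v"
    and s: "\<And>x. s x = q\<^sup>2 \<or> s x = inverse (q\<^sup>2)"
  shows "serre_op y z v = 0"
proof (rule mult_induct_left[OF lin_serre_op[OF assms(1,2)] lin_const_zero])
  show "serre_op y z 1 = 0"
    using assms(1-4) by (simp add: serre_op_def lin_zero[of y] lin_zero[of z])
  fix x v assume IH: "serre_op y z v = 0"
  have "s x * inverse (s x) = 1" using s[of x] q0 by auto
  from serre_op_commute[OF assms(1,2) lin_mult_left[OF lin_id] y z this s, of v] IH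
  show "serre_op y z (gen x * v) = 0" by simp
qed

lemma serre_op_x1I: "serre_op (x1I X) (x1I (other X)) v = 0"
proof (rule serre_op_zero[where s = "\<lambda>x. pw q X x" and c = "\<lambda>x. 1 - pw q X x" and d = "\<lambda>x. 1 - inverse (pw q X x)"])
  show "x1I X 1 = 0" "x1I (other X) 1 = 0"
    by (simp_all add: x1I_def)
  fix x v
  consider "x = X" | "x = other X" using letter_cases by blast
  note cases = this
  show "x1I X (gen x * v) = pw q X x \<cdot> (gen x * x1I X v) + (1 - pw q X x) \<cdot> v"
    by (cases rule: cases) (simp_all add: x1I_L x1I_L_other)
  show "x1I (other X) (gen x * v) = inverse (pw q X x) \<cdot> (gen x * x1I (other X) v) + (1 - inverse (pw q X x)) \<cdot> v"
    using x1I_L[of "other X" v] x1I_L_other[of "other X" v] by (cases rule: cases) simp_all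
  show "pw q X x = q\<^sup>2 \<or> pw q X x = inverse (q\<^sup>2)" by (cases rule: cases) simp_all
qed (rule lin_x1I)+

lemma serre_op_dl: "serre_op (dl q X) (dl q (other X)) v = 0"
proof (rule serre_op_zero[where s = "\<lambda>x. pw q X x" and c = "\<lambda>x. if x = X then 1 else 0" and d = "\<lambda>x. if x = other X then 1 else 0"])
  fix x v
  consider "x = X" | "x = other X" using letter_cases by blast
  note cases = this
  show "dl q X (gen x * v) = pw q X x \<cdot> (gen x * dl q X v) + (if x = X then 1 else 0) \<cdot> v"
    "dl q (other X) (gen x * v) = inverse (pw q X x) \<cdot> (gen x * dl q (other X) v) + (if x = other X then 1 else 0) \<cdot> v"
    by (cases rule: cases; simp add: dl_L)+
  show "pw q X x = q\<^sup>2 \<or> pw q X x = inverse (q\<^sup>2)" by (cases rule: cases) simp_all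
qed (simp_all add: lin_dl)

lemma serre_op_L: "serre_op ((*) (gen X)) ((*) (gen (other X))) v \<in> J q"
proof -
  have "serre_op ((*) (gen X)) ((*) (gen (other X))) v = serre q X * v"
    by (simp add: serre_op_def qSerre_def algebra_simps power2_eq_square power3_eq_cube mult.assoc)
  then show ?thesis by simp
qed

lemma x0II_tot: "v \<in> tot n \<Longrightarrow> x0II X v \<in> tot (Suc n)"
proof (erule supported_induct[OF _ subspace_supported lin_x0II])
  fix w :: "letter list" assume "length w = n"
  then show "x0II X (word w) \<in> tot (Suc n)"
    unfolding x0II_def
    by (auto simp flip: word_Cons word_snoc intro!: subspace_scale subspace_diff subspace_supported)
qed

lemma x0II_J: "v \<in> J q \<Longrightarrow> x0II X v \<in> J q" and x1I_J: "v \<in> J q \<Longrightarrow> x1I X v \<in> J q"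
  by (simp_all add: x0II_def x1I_def J_scale J_diff J_Kx J_dl J_dr)

text \<open>These operators do not kill \<open>1\<close>, so the vanishing cannot be spread from
  there. Instead, each derivative of the combination at \<open>v\<close> is a multiple of the
  combination at a derivative of \<open>v\<close>; induction on the degree puts it in
  \<open>J\<close>, and nondegeneracy applies because the combination raises the degree by
  four.\<close>

lemma serre_op_x0II: "serre_op (x0II X) (x0II (other X)) v \<in> J q"
proof -
  let ?T = "serre_op (x0II X) (x0II (other X))"
  have lin: "lin ?T" by (intro lin_serre_op lin_x0II)
  have dl_T: "\<exists>c. dl q Z (?T v) = c \<cdot> ?T (dl q Z v)" for Z v
  proof -
    consider "Z = X" | "Z = other X" using letter_cases by blast
    then show ?thesis
    proof cases
      case 1
      from serre_op_commute'[OF lin_x0II lin_x0II lin_dl dl_x0II dl_x0II_other, of X]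
      show ?thesis unfolding 1 by auto
    next
      case 2
      from serre_op_commute'[OF lin_x0II lin_x0II lin_dl dl_x0II_other dl_x0II, of "other X"]
      show ?thesis unfolding 2 by auto
    qed
  qed
  have "?T v \<in> J q" if "v \<in> tot n" for n v
    using that
  proof (induction n arbitrary: v)
    case (0 v)
    then have "?T v \<in> tot (Suc (Suc (Suc (Suc 0))))"
      unfolding serre_op_def by (intro subspace_add subspace_diff subspace_scale subspace_supported x0II_tot)
    moreover have "dl q Z (?T v) \<in> J q" for Z
      using dl_T[of Z v] dl_tot_0[OF 0] by (auto simp: lin_zero[OF lin])
    ultimately show ?case by (rule nondeg_at_tot[OF nondeg, rotated]) simp
  next
    case (Suc n)
    then have "?T v \<in> tot (Suc (Suc (Suc (Suc (Suc n)))))"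
      unfolding serre_op_def by (intro subspace_add subspace_diff subspace_scale subspace_supported x0II_tot)
    moreover have "dl q Z (?T v) \<in> J q" for Z
      using dl_T[of Z v] J_scale[OF Suc.IH[OF dl_tot[OF Suc.prems, of q Z]]] by auto
    ultimately show ?case by (rule nondeg_at_tot[OF nondeg, rotated]) simp
  qed
  then have W: "?T (word w) \<in> J q" for w by simp
  have "v \<in> {v. ?T v \<in> J q}"
    by (rule subspace_UNIV_I[OF subspace_vimage[OF lin subspace_J]]) (simp add: W)
  then show ?thesis by simp
qed

end

section \<open>The \<open>\<box>\<^sub>q\<close>-modules on \<open>\<V>/J\<close>\<close>

abbreviation rta :: "('g, 'k::field) free_alg ring" where "rta \<equiv> ring_of_type_algebra"

abbreviation coset :: "('g, 'k::field) free_alg set \<Rightarrow> ('g, 'k) free_alg \<Rightarrow> ('g, 'k) free_alg set"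
  where "coset I a \<equiv> a_r_coset rta I a"

lemma rta_simps [simp]: "carrier rta = UNIV" "monoid.mult rta = (*)" "monoid.one rta = 1" "ring.zero rta = 0"
  "ring.add rta = (+)"
  by (simp_all add: ring_of_type_algebra_def)

lemma coset_eq: "coset I a = {i + a | i. i \<in> I}"
  by (auto simp: a_r_coset_def r_coset_def)

lemma coset_eq_iff: "is_ideal I \<Longrightarrow> coset I a = coset I b \<longleftrightarrow> a - b \<in> I"
proof
  assume I: "is_ideal I" and eq: "coset I a = coset I b"
  have "a \<in> coset I a"
    using I subspace_0[of I] by (force simp: coset_eq is_ideal_def)
  then show "a - b \<in> I"
    unfolding eq by (auto simp: coset_eq)
next
  assume I: "is_ideal I" and ab: "a - b \<in> I"
  have "\<exists>j. i + a = j + b \<and> j \<in> I" if "i \<in> I" for i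
    using subspace_add[OF _ that ab] I by (intro exI[of _ "i + (a - b)"]) (simp add: is_ideal_def)
  moreover have "\<exists>j. i + b = j + a \<and> j \<in> I" if "i \<in> I" for i
    using subspace_diff[OF _ that ab] I by (intro exI[of _ "i - (a - b)"]) (simp add: is_ideal_def)
  ultimately show "coset I a = coset I b"
    unfolding coset_eq by auto
qed

lemma
  assumes I: "is_ideal I"
  shows Quot_carrier: "carrier (rta Quot I) = range (coset I)"
    and Quot_zero: "\<zero>\<^bsub>rta Quot I\<^esub> = coset I 0"
    and Quot_one: "\<one>\<^bsub>rta Quot I\<^esub> = coset I 1"
    and Quot_add: "coset I a \<oplus>\<^bsub>rta Quot I\<^esub> coset I b = coset I (a + b)"
    and Quot_mult: "coset I a \<otimes>\<^bsub>rta Quot I\<^esub> coset I b = coset I (a * b)"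
    and Quot_ring: "ring (rta Quot I)"
proof -
  interpret ideal I rta using I by (simp add: is_ideal_iff)
  show "carrier (rta Quot I) = range (coset I)"
    by (auto simp: FactRing_def A_RCOSETS_def')
  show "\<zero>\<^bsub>rta Quot I\<^esub> = coset I 0"
    by (simp add: FactRing_def coset_eq)
  show "\<one>\<^bsub>rta Quot I\<^esub> = coset I 1"
    by (simp add: FactRing_def)
  show "coset I a \<oplus>\<^bsub>rta Quot I\<^esub> coset I b = coset I (a + b)"
    using a_rcos_sum[of a b] by (simp add: FactRing_def)
  show "coset I a \<otimes>\<^bsub>rta Quot I\<^esub> coset I b = coset I (a * b)"
    using rcoset_mult_add[of a b] by (simp add: FactRing_def)
  show "ring (rta Quot I)"
    by (rule quotient_is_ring)
qed

lemma is_ideal_box: "is_ideal (box_ideal q)"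
  unfolding box_ideal_def by (rule is_ideal_gen_ideal)

lemmas box_carrier = Quot_carrier[OF is_ideal_box, folded box_def box_class_def]
  and box_one = Quot_one[OF is_ideal_box, folded box_def box_class_def]
  and box_zero = Quot_zero[OF is_ideal_box, folded box_def box_class_def]
  and box_add = Quot_add[OF is_ideal_box, folded box_def box_class_def]
  and box_mult = Quot_mult[OF is_ideal_box, folded box_def box_class_def]
  and box_ring = Quot_ring[OF is_ideal_box, folded box_def]
  and box_class_eq_iff = coset_eq_iff[OF is_ideal_box, folded box_class_def]

lemmas VJ_carrier = Quot_carrier[OF is_ideal_J, folded VJ_def VJ_class_def]
  and VJ_zero = Quot_zero[OF is_ideal_J, folded VJ_def VJ_class_def]
  and VJ_add = Quot_add[OF is_ideal_J, folded VJ_def VJ_class_def]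
  and VJ_ring = Quot_ring[OF is_ideal_J, folded VJ_def]
  and VJ_class_eq_iff = coset_eq_iff[OF is_ideal_J, folded VJ_class_def]

text \<open>Everything a rule has to provide, stated on representatives: the relations modulo
  \<open>J\<close>, the class of \<open>1\<close> as NIL vector, and generation in terms of
  subspaces that contain \<open>J\<close>.\<close>

locale box_rep = generic_q q for q :: "'k::field" +
  fixes X :: "4 \<Rightarrow> 'k VV \<Rightarrow> 'k VV"
  assumes lin_X: "lin (X i)"
    and X_J: "v \<in> J q \<Longrightarrow> X i v \<in> J q"
    and weyl: "q \<cdot> X i (X (i + 1) v) - inverse q \<cdot> X (i + 1) (X i v) - (q - inverse q) \<cdot> v \<in> J q"
    and serre: "serre_op (X i) (X (i + 2)) v \<in> J q"
    and nil: "X 1 1 \<in> J q" "X 3 1 \<in> J q"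
    and cyclic: "subspace S \<Longrightarrow> J q \<subseteq> S \<Longrightarrow> 1 \<in> S \<Longrightarrow> (\<And>i v. v \<in> S \<Longrightarrow> X i v \<in> S) \<Longrightarrow> v \<in> S"
begin

definition act :: "(4, 'k) free_alg \<Rightarrow> 'k VV \<Rightarrow> 'k VV"
  where "act p v = lin_ext (\<lambda>w. foldr X w v) p"

lemma act_word: "act (word w) v = foldr X w v"
  by (simp add: act_def)

lemma lin_act_left: "lin (\<lambda>p. act p v)"
  by (simp add: act_def lin_lin_ext)

lemma act_one [simp]: "act 1 v = v"
  by (simp add: one_word act_word)

lemma act_gen_mult: "act (gen i * p) v = X i (act p v)"
  by (rule lin_eqI[where v = p])
     (auto intro: lin_comp[OF lin_act_left lin_mult_left[OF lin_id]] lin_comp[OF lin_X lin_act_left]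
       simp: act_word simp flip: word_Cons)

lemma act_gen: "act (gen i) v = X i v"
  using act_gen_mult[of i 1 v] by simp

lemma act_mult: "act (p * r) v = act p (act r v)"
  by (rule mult_induct_left[where v = p])
     (auto intro: lin_comp[OF lin_act_left lin_mult_right[OF lin_id]] lin_act_left simp: act_gen_mult mult.assoc)

lemma lin_act: "lin (act p)"
proof -
  have "lin (\<lambda>v. foldr X w v)" for w
    by (induction w) (auto intro: lin_id lin_comp[OF lin_X])
  then show ?thesis
    unfolding act_def lin_ext_def by (intro lin_sum_map lin_scale_map)
qed

lemmas act_left_simps = lin_add[OF lin_act_left] lin_scale[OF lin_act_left] lin_diff[OF lin_act_left] lin_zero[OF lin_act_left]

lemma act_J: "v \<in> J q \<Longrightarrow> act p v \<in> J q"
proof -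
  assume v: "v \<in> J q"
  have "foldr X w v \<in> J q" for w
    by (induction w) (auto intro: v X_J)
  then show ?thesis
    unfolding act_def lin_ext_def by (intro J_sum J_scale)
qed

lemma act_box_ideal: "p \<in> box_ideal q \<Longrightarrow> act p v \<in> J q"
proof -
  let ?N = "{p. \<forall>v. act p v \<in> J q}"
  have "is_ideal ?N"
    by (auto simp: is_ideal_def free_alg.subspace_def act_left_simps act_mult act_J intro: J_add J_scale)
  moreover have "box_relators q \<subseteq> ?N"
  proof -
    have qq: "q - inverse q \<noteq> 0"
      using q0 q2 by (auto simp: field_simps power2_eq_square)
    have "act ((1 / (q - q powi - 1)) \<cdot> (q \<cdot> (gen i * gen (i + 1)) - q powi - 1 \<cdot> (gen (i + 1) * gen i)) - 1) v =
        (1 / (q - inverse q)) \<cdot> (q \<cdot> X i (X (i + 1) v) - inverse q \<cdot> X (i + 1) (X i v) - (q - inverse q) \<cdot> v)" for i v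
      using qq by (simp add: act_left_simps act_mult act_gen scale_diff scale_scale power_int_minus
          diff_divide_distrib[symmetric] left_diff_distrib flip: scale_diff(2))
    moreover have "act (qSerre q (gen i) (gen (i + 2))) v = serre_op (X i) (X (i + 2)) v" for i v
      by (simp add: qSerre_def serre_op_def act_left_simps act_mult act_gen power2_eq_square power3_eq_cube)
    ultimately show ?thesis
      unfolding box_relators_def by (auto intro!: J_scale weyl serre)
  qed
  ultimately have "box_ideal q \<subseteq> ?N"
    unfolding box_ideal_def by (rule gen_ideal_minimal)
  then show "p \<in> box_ideal q \<Longrightarrow> act p v \<in> J q" by auto
qed

text \<open>The action uses chosen representatives of both cosets; \<open>act_box_ideal\<close> and
  \<open>act_J\<close> make the result independent of the choices, which gives
  \<open>VJ_smult\<close>.\<close>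

definition VJ_module :: "((4, 'k) free_alg set, 'k VV set) module"
  where "VJ_module = \<lparr>carrier = carrier (VJ q), monoid.mult = monoid.mult (VJ q), monoid.one = \<one>\<^bsub>VJ q\<^esub>,
    ring.zero = \<zero>\<^bsub>VJ q\<^esub>, ring.add = ring.add (VJ q),
    module.smult = (\<lambda>a x. VJ_class q (act (SOME p. box_class q p = a) (SOME v. VJ_class q v = x)))\<rparr>"

lemma VJ_module_simps [simp]: "carrier VJ_module = range (VJ_class q)" "\<zero>\<^bsub>VJ_module\<^esub> = VJ_class q 0"
    "VJ_class q u \<oplus>\<^bsub>VJ_module\<^esub> VJ_class q v = VJ_class q (u + v)"
  by (simp_all add: VJ_module_def VJ_carrier VJ_zero VJ_add)

lemma VJ_smult [simp]: "box_class q p \<odot>\<^bsub>VJ_module\<^esub> VJ_class q v = VJ_class q (act p v)"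
proof -
  define p' where "p' = (SOME p'. box_class q p' = box_class q p)"
  define v' where "v' = (SOME v'. VJ_class q v' = VJ_class q v)"
  have p: "p' - p \<in> box_ideal q"
    using someI[of "\<lambda>p'. box_class q p' = box_class q p" p] by (simp add: p'_def box_class_eq_iff)
  have v: "v' - v \<in> J q"
    using someI[of "\<lambda>v'. VJ_class q v' = VJ_class q v" v] by (simp add: v'_def VJ_class_eq_iff)
  have "act (p' - p) v' + act p (v' - v) \<in> J q"
    by (intro J_add act_box_ideal act_J p v)
  then have "act p' v' - act p v \<in> J q"
    by (simp add: act_left_simps lin_diff[OF lin_act])
  then have "VJ_class q (act p' v') = VJ_class q (act p v)"
    by (simp only: VJ_class_eq_iff)
  then show ?thesis
    unfolding p'_def v'_def by (simp add: VJ_module_def)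
qed

lemma box_module_VJ: "box_module q VJ_module"
proof -
  have "abelian_group VJ_module"
  proof (rule abelian_groupI)
    fix x assume "x \<in> carrier VJ_module"
    then obtain v where v: "x = VJ_class q v" by auto
    show "\<exists>y\<in>carrier VJ_module. y \<oplus>\<^bsub>VJ_module\<^esub> x = \<zero>\<^bsub>VJ_module\<^esub>"
      by (rule bexI[of _ "VJ_class q (- v)"]) (simp_all add: v)
  qed (auto simp: add_ac)
  then show ?thesis
    by (intro left_module.intro left_module_axioms.intro box_ring)
       (auto simp: box_carrier box_add box_mult box_one act_left_simps act_mult lin_add[OF lin_act])
qed

lemma act_const: "act (const c) v = c \<cdot> v"
proof -
  have "const c = c \<cdot> (1 :: (4, 'k) free_alg)" by (simp add: scale_def)
  then show ?thesis by (simp add: act_left_simps)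
qed

lemma box_module_on_VJ: "box_module_on_VJ q (X 0) (X 1) (X 2) (X 3) VJ_module"
  unfolding box_module_on_VJ_def
  by (simp add: box_module_VJ act_const act_gen VJ_module_def[THEN arg_cong[of _ _ "ring.add"]])
     (simp add: VJ_module_def VJ_carrier VJ_zero)

lemma NIL_module_VJ: "NIL_module q VJ_module"
proof -
  have "NIL_vector q VJ_module (VJ_class q 1)"
    unfolding NIL_vector_def using nil one_notin_J[of q] by (auto simp: act_gen VJ_class_eq_iff)
  moreover have "W = carrier VJ_module" if W: "submodule W (box q) VJ_module" "VJ_class q 1 \<in> W" for W
  proof -
    interpret submodule W "box q" VJ_module by fact
    let ?S = "{v. VJ_class q v \<in> W}"
    have act: "VJ_class q (act p v) \<in> W" if "VJ_class q v \<in> W" for p v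
      using smult_closed[OF _ that, of "box_class q p"] by (simp add: box_carrier)
    have add: "VJ_class q (u + v) \<in> W" if "VJ_class q u \<in> W" "VJ_class q v \<in> W" for u v
      using m_closed[OF that] by simp
    have S: "subspace ?S"
      unfolding free_alg.subspace_def
      using add one_closed act[of _ "const _"] by (auto simp: act_const)
    have "v \<in> ?S" for v
    proof (rule cyclic[OF S])
      show "J q \<subseteq> ?S"
      proof
        fix v assume "v \<in> J q"
        then have "VJ_class q v = VJ_class q 0" by (simp add: VJ_class_eq_iff)
        then show "v \<in> ?S" using subspace_0[OF S] by simp
      qed
      show "X i v \<in> ?S" if "v \<in> ?S" for i v
        using act[of v "gen i"] that by (simp add: act_gen)
    qed (use W in simp)
    then show ?thesis using subset by auto
  qed
  ultimately show ?thesis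
    unfolding NIL_module_def using box_module_VJ by blast
qed

end

subsection \<open>The eight rules\<close>

lemma numeral_type_4 [simp]: "(4 :: 4) = 0" "(5 :: 4) = 1"
  by simp_all

context generic_q
begin

text \<open>\<open>Z = LA\<close> is rule I; \<open>Z = LB\<close> shifts the indices by two and is
  rule IT.\<close>

definition opsI :: "letter \<Rightarrow> 4 \<Rightarrow> 'k VV \<Rightarrow> 'k VV"
  where "opsI Z i = (if i = 0 then (*) (gen Z) else if i = 1 then x1I Z
    else if i = 2 then (*) (gen (other Z)) else x1I (other Z))"

definition opsII :: "letter \<Rightarrow> 4 \<Rightarrow> 'k VV \<Rightarrow> 'k VV"
  where "opsII Z i = (if i = 0 then x0II Z else if i = 1 then dl q Z
    else if i = 2 then x0II (other Z) else dl q (other Z))"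

lemma opsI_simps [simp]: "opsI Z 0 = (*) (gen Z)" "opsI Z 1 = x1I Z" "opsI Z 2 = (*) (gen (other Z))"
    "opsI Z 3 = x1I (other Z)"
  and opsII_simps [simp]: "opsII Z 0 = x0II Z" "opsII Z 1 = dl q Z" "opsII Z 2 = x0II (other Z)"
    "opsII Z 3 = dl q (other Z)"
  by (simp_all add: opsI_def opsII_def)

lemma weyl_scalars:
  "b = q\<^sup>2 \<cdot> a + (1 - q\<^sup>2) \<cdot> v \<Longrightarrow> q \<cdot> a - inverse q \<cdot> b - (q - inverse q) \<cdot> v = 0"
  "b = inverse (q\<^sup>2) \<cdot> a + (1 - inverse (q\<^sup>2)) \<cdot> v \<Longrightarrow> q \<cdot> b - inverse q \<cdot> a - (q - inverse q) \<cdot> v = 0"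
  using q0 by (simp_all add: poly_mapping_eq_iff fun_eq_iff lookup_add lookup_minus field_simps power2_eq_square)

lemma box_rep_I: "box_rep q (opsI Z)"
proof
  fix i v
  have lin_gen: "lin ((*) (gen Z))" for Z by (rule lin_mult_left[OF lin_id])
  show "lin (opsI Z i)"
    using exhaust_type_4[of i] by (elim disjE) (simp_all add: lin_x1I lin_gen)
  show "v \<in> J q \<Longrightarrow> opsI Z i v \<in> J q"
    using exhaust_type_4[of i] by (elim disjE) (simp_all add: x1I_J)
  show "q \<cdot> opsI Z i (opsI Z (i + 1) v) - inverse q \<cdot> opsI Z (i + 1) (opsI Z i v) - (q - inverse q) \<cdot> v \<in> J q"
    using weyl_scalars(1)[OF x1I_L[of Z v]] weyl_scalars(1)[OF x1I_L[of "other Z" v]]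
      weyl_scalars(2)[OF x1I_L_other[of Z v]] weyl_scalars(2)[OF x1I_L_other[of "other Z" v]]
      exhaust_type_4[of i] by (elim disjE) simp_all
  show "serre_op (opsI Z i) (opsI Z (i + 2)) v \<in> J q"
    using serre_op_L[of Z v] serre_op_L[of "other Z" v] serre_op_x1I[of Z v] serre_op_x1I[of "other Z" v]
      exhaust_type_4[of i] by (elim disjE) simp_all
  show "opsI Z 1 1 \<in> J q" "opsI Z 3 1 \<in> J q"
    by (simp_all add: x1I_def)
  fix S assume S: "subspace S" "1 \<in> S" "\<And>i v. v \<in> S \<Longrightarrow> opsI Z i v \<in> S"
  have gen: "gen x * v \<in> S" if "v \<in> S" for x v
    using letter_cases[of x Z] S(3)[OF that, of 0] S(3)[OF that, of 2] by auto
  show "v \<in> S"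
    using mult_closed_left[OF S(1) gen S(2), of v] by simp
qed

lemma box_rep_II: "box_rep q (opsII Z)"
proof
  fix i v
  show "lin (opsII Z i)"
    using exhaust_type_4[of i] by (elim disjE) (simp_all add: lin_x0II lin_dl)
  show "v \<in> J q \<Longrightarrow> opsII Z i v \<in> J q"
    using exhaust_type_4[of i] by (elim disjE) (simp_all add: x0II_J J_dl)
  show "q \<cdot> opsII Z i (opsII Z (i + 1) v) - inverse q \<cdot> opsII Z (i + 1) (opsII Z i v) - (q - inverse q) \<cdot> v \<in> J q"
    using weyl_scalars(1)[OF dl_x0II[of Z v]] weyl_scalars(1)[OF dl_x0II[of "other Z" v]]
      weyl_scalars(2)[OF dl_x0II_other[of Z v]] weyl_scalars(2)[OF dl_x0II_other[of "other Z" v]]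
      exhaust_type_4[of i] by (elim disjE) simp_all
  show "serre_op (opsII Z i) (opsII Z (i + 2)) v \<in> J q"
    using serre_op_x0II[of Z v] serre_op_x0II[of "other Z" v] serre_op_dl[of Z v] serre_op_dl[of "other Z" v]
      exhaust_type_4[of i] by (elim disjE) simp_all
  show "opsII Z 1 1 \<in> J q" "opsII Z 3 1 \<in> J q"
    by simp_all
  fix S assume S: "subspace S" "1 \<in> S" "\<And>i v. v \<in> S \<Longrightarrow> opsII Z i v \<in> S"
  have x0: "x0II x v \<in> S" if "v \<in> S" for x v
    using letter_cases[of x Z] S(3)[OF that, of 0] S(3)[OF that, of 2] by auto
  have "word w \<in> S" for w
  proof (induction "length w" arbitrary: w)
    case 0
    then show ?case using S(2) by (simp add: one_word)
  next
    case (Suc n w)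
    \<comment> \<open>The induction hypothesis covers only words \<open>u\<close> of length
      \<open>n\<close>, while \<open>rotation\<close> quantifies over all words. Setting
      \<open>F\<close> to zero outside length \<open>Suc n\<close> reconciles the two.\<close>
    define F where "F u = (if length u = Suc n then word u else (0 :: 'k VV))" for u
    have "F w \<in> S"
    proof (rule rotation[OF S(1)])
      fix x u
      show "F (x # u) - q powi (weight x u - 2) \<cdot> F (u @ [other x]) \<in> S"
      proof (cases "length u = n")
        case True
        then have "x0II x (word u) \<in> S" using Suc(1) by (intro x0) simp
        from subspace_scale[OF S(1) this, of "inverse (1 - q\<^sup>2)"] q2 show ?thesis
          using True by (simp add: F_def x0II_def scale_scale pairing_def flip: word_Cons word_snoc)
      qed (simp add: F_def subspace_0[OF S(1)])
    qed (use Suc in auto)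
    then show ?case using Suc(2) by (simp add: F_def)
  qed
  then show "v \<in> S" by (rule subspace_UNIV_I[OF S(1)])
qed

text \<open>Reversal is a linear involution that fixes \<open>1\<close> and preserves
  \<open>J\<close>, so every requirement is transported.\<close>

lemma box_rep_revV:
  assumes "box_rep q X"
  shows "box_rep q (\<lambda>i v. revV (X i (revV v)))"
proof -
  interpret box_rep q X by fact
  show ?thesis
  proof
    fix i v
    show "lin (\<lambda>v. revV (X i (revV v)))"
      by (intro lin_comp[OF lin_revV] lin_comp[OF lin_X] lin_revV)
    show "v \<in> J q \<Longrightarrow> revV (X i (revV v)) \<in> J q"
      by (intro J_revV X_J)
    show "q \<cdot> revV (X i (revV (revV (X (i + 1) (revV v))))) -
        inverse q \<cdot> revV (X (i + 1) (revV (revV (X i (revV v))))) - (q - inverse q) \<cdot> v \<in> J q"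
      using J_revV[OF weyl[of i "revV v"]] by simp
    show "serre_op (\<lambda>v. revV (X i (revV v))) (\<lambda>v. revV (X (i + 2) (revV v))) v \<in> J q"
      using J_revV[OF serre[of i "revV v"]] by (simp add: serre_op_def)
    show "revV (X 1 (revV 1)) \<in> J q" "revV (X 3 (revV 1)) \<in> J q"
      using J_revV nil by simp_all
    fix S assume S: "subspace S" "J q \<subseteq> S" "1 \<in> S" "\<And>i v. v \<in> S \<Longrightarrow> revV (X i (revV v)) \<in> S"
    have "revV v \<in> {v. revV v \<in> S}"
    proof (rule cyclic)
      show "subspace {v. revV v \<in> S}"
        by (rule subspace_vimage[OF lin_revV S(1)])
      show "X i v \<in> {v. revV v \<in> S}" if "v \<in> {v. revV v \<in> S}" for i v
        using S(4)[of "revV v" i] that by simp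
    qed (use S(2,3) J_revV in auto)
    then show "v \<in> S" by simp
  qed
qed

end

section \<open>Uniqueness of the NIL module\<close>

lemma eps_dr: "q \<noteq> 0 \<Longrightarrow> eps (dr q X v) = eps (dl q X v)"
proof -
  assume q: "q \<noteq> 0"
  have "eps (dr q X (word w)) = eps (dl q X (word w))" for w
    by (cases w) (auto simp: lookup_add lookup_word dr_word_Nil[OF q] dr_word_Cons[OF q])
  then have W: "word w \<in> {v. eps (dr q X v) = eps (dl q X v)}" for w by simp
  have "subspace {v. eps (dr q X v) = eps (dl q X v)}"
    by (auto simp: free_alg.subspace_def lookup_add)
  from subspace_UNIV_I[OF this W, of v] show ?thesis by simp
qed

abbreviation tot_le :: "nat \<Rightarrow> 'k::field VV set" where "tot_le n \<equiv> supported (\<lambda>w. length w \<le> n)"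

lemma revV_tot: "v \<in> tot n \<Longrightarrow> revV v \<in> tot n"
  by (erule supported_induct[OF _ subspace_supported lin_revV]) simp

lemma tot_le_exhaust: "\<exists>n. v \<in> tot_le n"
proof -
  have "finite (length ` keys v)" by simp
  then obtain n where "\<forall>m\<in>length ` keys v. m \<le> n" using finite_nat_set_iff_bounded_le by auto
  then show ?thesis by (intro exI[of _ n]) (auto simp: supported_def in_keys_iff)
qed

context generic_q
begin

lemma dls_append: "dls (u @ w) v = dls w (dls u v)"
  by (induction u arbitrary: v) simp_all

lemma dls_dr: "dls u (dr q Y v) = dr q Y (dls u v)"
  by (induction u arbitrary: v) (simp_all add: dl_dr)

lemma dls_Kx: "dls u (Kx q X v) = q powi weight X u \<cdot> Kx q X (dls u v)"
  by (induction u arbitrary: v)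
     (simp_all add: dl_Kx lin_scale[OF lin_dls] scale_scale power_int_add pairing_commute)

lemma eps_dls_upto: "v \<in> tot_le n \<Longrightarrow> n < length ys \<Longrightarrow> eps (dls ys v) = 0"
proof -
  assume v: "v \<in> tot_le n" and n: "n < length ys"
  have "v \<in> {v. eps (dls ys v) = 0}"
  proof (rule supported_induct[OF v _ lin_id])
    show "subspace {v. eps (dls ys v) = 0}"
      by (auto simp: free_alg.subspace_def lin_add[OF lin_dls] lin_scale[OF lin_dls] lin_zero[OF lin_dls] lookup_add)
    fix w :: "letter list" assume "length w \<le> n"
    then show "word w \<in> {v. eps (dls ys v) = 0}"
      using eps_dls[of "word w" "length w" ys] n by simp
  qed
  then show ?thesis by simp
qed

text \<open>Words of the maximal length \<open>Suc n\<close> see only the top component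
  \<open>T v\<close>, because derivatives of that order annihilate the lower part up to constant
  term. So \<open>T v\<close> lies in \<open>J\<close> and can be removed.\<close>

lemma pairing_kernel_const:
  assumes "\<And>w. w \<noteq> [] \<Longrightarrow> eps (dls w v) = 0"
  shows "v - eps v \<cdot> 1 \<in> J q"
proof -
  obtain n where "v \<in> tot_le n" using tot_le_exhaust by blast
  then show ?thesis
    using assms
  proof (induction n arbitrary: v)
    case 0
    then show ?case using eps_supported[of v] by simp
  next
    case (Suc n)
    define T :: "'k VV \<Rightarrow> 'k VV" where "T = diag (\<lambda>w. if length w = Suc n then 1 else 0)"
    have lin: "lin T" by (simp add: T_def lin_diag)
    have t: "T v \<in> tot (Suc n)"
      by (rule supported_induct[OF Suc.prems(1) subspace_supported lin])
         (simp add: T_def subspace_0[OF subspace_supported])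
    have u: "v - T v \<in> tot_le n"
      by (rule supported_induct[OF Suc.prems(1) subspace_supported lin_minus[OF lin_id lin]])
         (auto simp: T_def subspace_0[OF subspace_supported])
    have tJ: "T v \<in> J q"
    proof (rule pairing_kernel[OF t])
      fix ys :: "letter list" assume ys: "length ys = Suc n"
      then have "eps (dls ys v) = 0" by (intro Suc.prems(2)) auto
      then show "eps (dls ys (T v)) = 0"
        using eps_dls_upto[OF u, of ys] ys by (simp add: lin_diff[OF lin_dls] lookup_minus)
    qed
    have "v - T v - eps (v - T v) \<cdot> 1 \<in> J q"
    proof (rule Suc.IH[OF u])
      fix w :: "letter list" assume "w \<noteq> []"
      then show "eps (dls w (v - T v)) = 0"
        using Suc.prems(2)[of w] eps_J[OF dls_J[OF tJ], of w] by (simp add: lin_diff[OF lin_dls] lookup_minus)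
    qed
    from J_add[OF this tJ] show ?case
      using eps_J[OF tJ] by (simp add: lookup_minus)
  qed
qed

text \<open>The hypothesis equates a left derivative by one letter with a twisted right derivative
  by the other. Under \<open>eps\<close> a right derivative acts as a left derivative taken last, so
  the pairing values obey the rule required by \<open>rotation\<close>.\<close>

lemma x1I_kernel:
  assumes "\<And>Z. x1I Z v \<in> J q"
  shows "v - eps v \<cdot> 1 \<in> J q"
proof (rule pairing_kernel_const)
  fix w :: "letter list" assume w: "w \<noteq> []"
  \<comment> \<open>The scalar is carried by \<open>1\<close> because \<open>rotation\<close>
    concerns vector-valued functions; the zero subspace turns its congruence into an
    equation.\<close>
  have "eps (dls w v) \<cdot> (1 :: 'k VV) \<in> {0}"
  proof (rule rotation[OF _ _ w])
    show "subspace {0 :: 'k VV}" by (simp add: free_alg.subspace_def)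
    fix X u
    have "dl q X v - dr q (other X) (Kx q X v) \<in> J q"
      using assms[of X] q2 by (simp add: x1I_def J_scale_iff)
    then have "eps (dls u (dl q X v)) = eps (dls u (dr q (other X) (Kx q X v)))"
      using eps_J[OF dls_J[of _ u]] by (fastforce simp: lin_diff[OF lin_dls] lookup_minus)
    also have "\<dots> = q powi (weight X u - 2) * eps (dls (u @ [other X]) v)"
      by (simp add: dls_dr dls_Kx dr_Kx eps_dr dls_append lin_scale[OF lin_dls] power_int_diff field_simps)
    finally show "eps (dls (X # u) v) \<cdot> (1 :: 'k VV) -
        q powi (weight X u - 2) \<cdot> eps (dls (u @ [other X]) v) \<cdot> 1 \<in> {0}"
      by (simp add: scale_scale)
  qed
  then show "eps (dls w v) = 0"
    using const_in_J_iff[of "eps (dls w v)" q] by simp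
qed

lemma x1I_upto: "v \<in> tot_le (Suc n) \<Longrightarrow> x1I Z v \<in> tot_le n"
proof (erule supported_induct[OF _ subspace_supported lin_x1I])
  fix w :: "letter list" assume w: "length w \<le> Suc n"
  show "x1I Z (word w) \<in> tot_le n"
  proof (cases w)
    case Nil
    then show ?thesis by (simp add: x1I_def subspace_0[OF subspace_supported] flip: one_word)
  next
    case (Cons x u)
    then have "(word w :: 'k VV) \<in> tot (Suc (length u))" by simp
    then have "dl q Y (word w) \<in> tot (length u)" "dr q Y (word w) \<in> tot (length u)" for Y
      unfolding dr_def by (intro dl_tot revV_tot; assumption)+
    then have "x1I Z (word w) \<in> tot (length u)"
      unfolding x1I_def by (auto intro!: subspace_scale subspace_diff subspace_supported)
    then show ?thesis using w Cons by (auto simp: supported_def)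
  qed
qed

end

section \<open>Comparison of \<V>/J with an arbitrary NIL module\<close>

definition emb :: "letter \<Rightarrow> 4" where "emb x = (case x of LA \<Rightarrow> 0 | LB \<Rightarrow> 2)"

lemma emb_other: "emb (other x) = emb x + 2"
  by (cases x) (simp_all add: emb_def)

definition \<sigma> :: "'k::field VV \<Rightarrow> (4, 'k) free_alg" where "\<sigma> = lin_ext (\<lambda>w. word (map emb w))"

lemma lin_sigma: "lin \<sigma>"
  by (simp add: \<sigma>_def lin_lin_ext)

lemmas sigma_simps = lin_add[OF lin_sigma] lin_scale[OF lin_sigma] lin_diff[OF lin_sigma] lin_zero[OF lin_sigma]

lemma sigma_word: "\<sigma> (word w) = word (map emb w)"
  by (simp add: \<sigma>_def)

lemma sigma_one [simp]: "\<sigma> 1 = 1"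
  by (simp add: one_word sigma_word)

lemma sigma_L: "\<sigma> (gen x * v) = gen (emb x) * \<sigma> v"
  by (rule lin_eqI[OF lin_comp[OF lin_sigma lin_mult_left[OF lin_id]] lin_mult_left[OF lin_sigma]])
     (simp add: sigma_word flip: word_Cons)

lemma sigma_mult: "\<sigma> (u * v) = \<sigma> u * \<sigma> v"
  by (rule mult_induct_left[where v = u, OF lin_comp[OF lin_sigma lin_mult_right[OF lin_id]] lin_mult_right[OF lin_sigma]])
     (simp_all add: mult.assoc sigma_L)

lemma sigma_gen: "\<sigma> (gen x) = gen (emb x)"
  using sigma_L[of x 1] by simp

lemma box_ideal_relators: "box_relators q \<subseteq> box_ideal q"
  unfolding box_ideal_def by (rule gen_ideal_superset)

lemma box_ideal_mult: "p \<in> box_ideal q \<Longrightarrow> r * p \<in> box_ideal q" "p \<in> box_ideal q \<Longrightarrow> p * r \<in> box_ideal q"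
  using is_ideal_box[of q] by (auto simp: is_ideal_def)

lemma subspace_box_ideal: "subspace (box_ideal q)"
  using is_ideal_box[of q] by (simp add: is_ideal_def)

lemma sigma_J: "v \<in> J q \<Longrightarrow> \<sigma> v \<in> box_ideal q"
proof (erule J_induct[OF _ lin_sigma subspace_box_ideal])
  fix u X w
  have "\<sigma> (serre q X) = qSerre q (gen (emb X)) (gen (emb X + 2))"
    by (simp add: qSerre_def sigma_simps sigma_mult sigma_gen power2_eq_square power3_eq_cube emb_other)
  also have "\<dots> \<in> box_ideal q"
    by (rule subsetD[OF box_ideal_relators]) (auto simp: box_relators_def)
  finally show "\<sigma> (word u * serre q X * word w) \<in> box_ideal q"
    by (simp add: sigma_mult box_ideal_mult)
qed

text \<open>Such a left ideal is the preimage in the free algebra of the annihilator of a NIL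
  vector; \<open>1 \<notin> N\<close> says that this vector is nonzero.\<close>

definition nil_ideal :: "'k::field \<Rightarrow> (4, 'k) free_alg set \<Rightarrow> bool"
  where "nil_ideal q N \<longleftrightarrow> subspace N \<and> (\<forall>p. \<forall>r\<in>N. p * r \<in> N) \<and> box_ideal q \<subseteq> N \<and>
    gen 1 \<in> N \<and> gen 3 \<in> N \<and> 1 \<notin> N"

context generic_q
begin

lemma box_relation: "q \<cdot> (gen i * gen (i + 1)) - inverse q \<cdot> (gen (i + 1) * gen i) - (q - inverse q) \<cdot> 1 \<in> box_ideal q"
proof -
  have qq: "q - inverse q \<noteq> 0"
    using q0 q2 by (auto simp: field_simps power2_eq_square)
  have "(1 / (q - q powi - 1)) \<cdot> (q \<cdot> (gen i * gen (i + 1)) - q powi - 1 \<cdot> (gen (i + 1) * gen i)) - 1 \<in> box_ideal q"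
    by (rule subsetD[OF box_ideal_relators]) (auto simp: box_relators_def)
  from subspace_scale[OF subspace_box_ideal this, of "q - inverse q"] show ?thesis
    using qq by (simp add: scale_diff(1) scale_scale power_int_minus)
qed

lemma box_relation_left:
  "gen (i + 1) * gen i - q\<^sup>2 \<cdot> (gen i * gen (i + 1)) - (1 - q\<^sup>2) \<cdot> 1 \<in> box_ideal q"
  using subspace_scale[OF subspace_box_ideal box_relation[of i], of "- q"] q0
  by (simp add: scale_diff scale_scale scale_minus power2_eq_square algebra_simps)

lemma box_relation_right:
  "gen i * gen (i + 1) - inverse (q\<^sup>2) \<cdot> (gen (i + 1) * gen i) - (1 - inverse (q\<^sup>2)) \<cdot> 1 \<in> box_ideal q"
  using subspace_scale[OF subspace_box_ideal box_relation[of i], of "inverse q"] q0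
  by (simp add: scale_diff scale_scale scale_minus power2_eq_square algebra_simps)

context
  fixes N :: "(4, 'k) free_alg set"
  assumes N: "nil_ideal q N"
begin

lemma nil_subspace: "subspace N" and nil_mult: "p \<in> N \<Longrightarrow> r * p \<in> N" and nil_box: "p \<in> box_ideal q \<Longrightarrow> p \<in> N"
  and nil_gen: "gen (emb Z + 1) \<in> N" and nil_one: "1 \<notin> N"
  using N by (auto simp: nil_ideal_def emb_def split: letter.split)

text \<open>Moving x_1 or x_3 to the right through a word in x_0 and x_2 follows the same recursion
  as \<open>x1I\<close>, and at the right end the generator falls into \<open>N\<close>. The
  operators of rule I are thus forced; \<open>emb Z + 1\<close> is x_1 for \<open>LA\<close> and x_3
  for \<open>LB\<close>.\<close>

lemma sigma_x1I: "gen (emb Z + 1) * \<sigma> v - \<sigma> (x1I Z v) \<in> N"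
proof -
  let ?k = "emb Z + 1"
  have lin: "lin (\<lambda>v. gen ?k * \<sigma> v - \<sigma> (x1I Z v))"
    by (intro lin_minus lin_mult_left lin_sigma lin_comp[OF lin_sigma lin_x1I])
  have step: "gen ?k * \<sigma> (gen x * v) - \<sigma> (x1I Z (gen x * v)) \<in> N"
    if IH: "gen ?k * \<sigma> v - \<sigma> (x1I Z v) \<in> N"
      and rel: "gen ?k * gen (emb x) - c \<cdot> (gen (emb x) * gen ?k) - d \<cdot> 1 \<in> box_ideal q"
      and x1: "x1I Z (gen x * v) = c \<cdot> (gen x * x1I Z v) + d \<cdot> v" for x v c d
  proof -
    have "(gen ?k * gen (emb x) - c \<cdot> (gen (emb x) * gen ?k) - d \<cdot> 1) * \<sigma> v +
        c \<cdot> (gen (emb x) * (gen ?k * \<sigma> v - \<sigma> (x1I Z v))) \<in> N"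
      by (intro subspace_add[OF nil_subspace] subspace_scale[OF nil_subspace] nil_mult nil_box box_ideal_mult rel IH)
    then show ?thesis
      by (simp add: x1 sigma_simps sigma_L left_diff_distrib right_diff_distrib scale_diff mult.assoc algebra_simps)
  qed
  have W: "gen ?k * \<sigma> (word w) - \<sigma> (x1I Z (word w)) \<in> N" for w
  proof (induction w)
    case Nil
    have "x1I Z 1 = 0" by (simp add: x1I_def)
    then show ?case using nil_gen by (simp add: sigma_simps flip: one_word)
  next
    case (Cons x w)
    consider "x = Z" | "x = other Z" using letter_cases by blast
    then show ?case
    proof cases
      case 1
      show ?thesis
        unfolding word_Cons 1 by (rule step[OF Cons box_relation_left x1I_L])
    next
      case 2
      \<comment> \<open>On the cycle \<open>?k\<close> stands between the two letters, so this one
        uses the relation indexed by \<open>?k\<close> rather than by \<open>emb Z\<close>, which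
        inverts the scalar.\<close>
      have "emb (other Z) = ?k + 1" by (cases Z) (simp_all add: emb_def)
      then show ?thesis
        unfolding word_Cons 2 using step[OF Cons _ x1I_L_other] box_relation_right[of ?k] by simp
    qed
  qed
  have "v \<in> {v. gen ?k * \<sigma> v - \<sigma> (x1I Z v) \<in> N}"
    by (rule subspace_UNIV_I[OF subspace_vimage[OF lin nil_subspace]]) (simp add: W)
  then show ?thesis by simp
qed

text \<open>The sum of \<open>N\<close> and the image of \<open>\<sigma>\<close> is stable under all
  four generators: the even ones lengthen a word, the odd ones act through
  \<open>x1I\<close>.\<close>

lemma sigma_surj: "\<exists>v. p - \<sigma> v \<in> N"
proof -
  let ?S = "{p. \<exists>v. p - \<sigma> v \<in> N}"
  have S: "subspace ?S"
    unfolding free_alg.subspace_def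
  proof (intro conjI ballI allI CollectI)
    show "\<exists>v. 0 - \<sigma> v \<in> N"
      using subspace_0[OF nil_subspace] by (intro exI[of _ 0]) (simp add: sigma_simps)
    show "\<exists>v. p + r - \<sigma> v \<in> N" if pr: "p \<in> ?S" "r \<in> ?S" for p r
    proof -
      from pr obtain u v where uv: "p - \<sigma> u \<in> N" "r - \<sigma> v \<in> N" by blast
      show ?thesis
        using subspace_add[OF nil_subspace uv] by (intro exI[of _ "u + v"]) (simp add: sigma_simps algebra_simps)
    qed
    show "\<exists>v. c \<cdot> p - \<sigma> v \<in> N" if p: "p \<in> ?S" for c p
    proof -
      from p obtain u where u: "p - \<sigma> u \<in> N" by blast
      show ?thesis
        using subspace_scale[OF nil_subspace u, of c] by (intro exI[of _ "c \<cdot> u"]) (simp add: sigma_simps scale_diff)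
    qed
  qed
  have W: "word w \<in> ?S" for w
  proof (induction w)
    case Nil
    show ?case
      using subspace_0[OF nil_subspace] by (auto intro!: exI[of _ 1] simp flip: one_word)
  next
    case (Cons i w)
    then obtain v where v: "word w - \<sigma> v \<in> N" by blast
    have iv: "gen i * word w - gen i * \<sigma> v \<in> N"
      using nil_mult[OF v, of "gen i"] by (simp add: right_diff_distrib)
    have "\<exists>u. gen i * \<sigma> v - \<sigma> u \<in> N"
    proof -
      consider (x) x where "i = emb x" | (Z) Z where "i = emb Z + 1"
      proof -
        have "emb LA = 0" "emb LA + 1 = 1" "emb LB = 2" "emb LB + 1 = 3" by (simp_all add: emb_def)
        then show ?thesis using exhaust_type_4[of i] that by metis
      qed
      then show ?thesis
      proof cases
        case x
        show ?thesis
          using subspace_0[OF nil_subspace] by (intro exI[of _ "gen x * v"]) (simp add: sigma_L x)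
      next
        case Z
        show ?thesis unfolding Z using sigma_x1I by blast
      qed
    qed
    then obtain u where "gen i * \<sigma> v - \<sigma> u \<in> N" ..
    from subspace_add[OF nil_subspace iv this] show ?case
      by (auto simp: word_Cons)
  qed
  have "p \<in> ?S"
    by (rule subspace_UNIV_I[OF S W])
  then show ?thesis by simp
qed

text \<open>Along with \<open>\<sigma> v\<close>, the ideal contains
  \<open>\<sigma> (x1I Z v)\<close>, of lower degree. By induction \<open>x1I_kernel\<close> applies
  and leaves a constant, which must be zero as \<open>1\<close> is not in \<open>N\<close>.\<close>

lemma sigma_kernel: "\<sigma> v \<in> N \<Longrightarrow> v \<in> J q"
proof -
  have const: "c = 0" if "\<sigma> (c \<cdot> 1) \<in> N" for c
  proof (rule ccontr)
    assume "c \<noteq> 0"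
    then show False
      using subspace_scale[OF nil_subspace that, of "inverse c"] nil_one by (simp add: sigma_simps scale_scale)
  qed
  have "\<sigma> v \<in> N \<Longrightarrow> v \<in> J q" if "v \<in> tot_le n" for n v
    using that
  proof (induction n arbitrary: v)
    case 0
    then have "v = eps v \<cdot> 1" by (intro eps_supported) simp
    then show ?case using const[of "eps v"] 0 by simp
  next
    case (Suc n)
    have x1: "\<sigma> (x1I Z v) \<in> N" for Z
      using subspace_diff[OF nil_subspace nil_mult[OF Suc.prems(1), of "gen (emb Z + 1)"] sigma_x1I[of Z v]] by simp
    have "v - eps v \<cdot> 1 \<in> J q"
      by (rule x1I_kernel) (rule Suc.IH[OF x1 x1I_upto[OF Suc.prems(2)]])
    moreover from subspace_diff[OF nil_subspace Suc.prems(1) nil_box[OF sigma_J[OF this]]] have "eps v = 0"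
      by (intro const) (simp add: sigma_simps)
    ultimately show ?case by simp
  qed
  then show "\<sigma> v \<in> N \<Longrightarrow> v \<in> J q" using tot_le_exhaust by blast
qed

end

lemma nil_ideal_unique:
  assumes "nil_ideal q N" "nil_ideal q N'"
  shows "N = N'"
proof -
  have "N \<subseteq> N'" if N: "nil_ideal q N" and N': "nil_ideal q N'" for N N'
  proof
    fix p assume p: "p \<in> N"
    \<comment> \<open>Reducing modulo the intersection yields one \<open>v\<close> that represents
      \<open>p\<close> for both ideals at once.\<close>
    have "nil_ideal q (N \<inter> N')"
      using N N' by (auto simp: nil_ideal_def intro: free_alg.subspace_inter)
    from sigma_surj[OF this] obtain v where v: "p - \<sigma> v \<in> N \<inter> N'" by blast
    then have "\<sigma> v \<in> N"
      using subspace_diff[OF nil_subspace[OF N] p, of "p - \<sigma> v"] by simp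
    then have "\<sigma> v \<in> N'"
      by (intro nil_box[OF N'] sigma_J sigma_kernel[OF N])
    then show "p \<in> N'"
      using v subspace_add[OF nil_subspace[OF N'], of "p - \<sigma> v" "\<sigma> v"] by simp
  qed
  then show ?thesis using assms by blast
qed

end

text \<open>Here \<open>e\<close> is the orbit map of a NIL vector, taken on the free algebra so
  that two modules can be compared through kernels in one common algebra.\<close>

definition presents :: "'k::field \<Rightarrow> ((4, 'k) free_alg set, 'u, 'm) module_scheme \<Rightarrow> ((4, 'k) free_alg \<Rightarrow> 'u) \<Rightarrow> bool"
  where "presents q U e \<longleftrightarrow> range e = carrier U \<and> (\<forall>p r. e (p + r) = e p \<oplus>\<^bsub>U\<^esub> e r) \<and>
    (\<forall>p r. e (p * r) = box_class q p \<odot>\<^bsub>U\<^esub> e r) \<and>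
    (\<forall>p r. e p = e r \<longleftrightarrow> p - r \<in> {p. e p = \<zero>\<^bsub>U\<^esub>}) \<and> nil_ideal q {p. e p = \<zero>\<^bsub>U\<^esub>}"

lemma NIL_module_presentation:
  assumes "NIL_module q U"
  shows "\<exists>e. presents q U e"
proof -
  from assms obtain \<xi> where mod: "box_module q U" and \<xi>: "NIL_vector q U \<xi>"
    and gen: "\<And>W. submodule W (box q) U \<Longrightarrow> \<xi> \<in> W \<Longrightarrow> W = carrier U"
    by (auto simp: NIL_module_def)
  interpret left_module "box q" U by (rule mod)
  have \<xi>c: "\<xi> \<in> carrier U" using \<xi> by (simp add: NIL_vector_def)
  have bc: "box_class q p \<in> carrier (box q)" for p by (simp add: box_carrier)
  define e where "e p = box_class q p \<odot>\<^bsub>U\<^esub> \<xi>" for p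
  have ec: "e p \<in> carrier U" for p by (simp add: e_def smult_closed bc \<xi>c)
  have add: "e (p + r) = e p \<oplus>\<^bsub>U\<^esub> e r" for p r
    by (simp add: e_def smult_l_distr[OF bc bc \<xi>c] flip: box_add)
  have mult: "e (p * r) = box_class q p \<odot>\<^bsub>U\<^esub> e r" for p r
    by (simp add: e_def smult_assoc1[OF bc bc \<xi>c] flip: box_mult)
  have null: "x = \<zero>\<^bsub>U\<^esub>" if "x \<oplus>\<^bsub>U\<^esub> x = x" "x \<in> carrier U" for x
    using that M.add.r_cancel_one by auto
  have e0: "e 0 = \<zero>\<^bsub>U\<^esub>" using add[of 0 0] ec by (intro null) simp_all
  have smult0: "a \<odot>\<^bsub>U\<^esub> \<zero>\<^bsub>U\<^esub> = \<zero>\<^bsub>U\<^esub>" if "a \<in> carrier (box q)" for a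
    using smult_r_distr[OF that M.zero_closed M.zero_closed] that
    by (intro null) (simp_all add: smult_closed)
  have eq: "e p = e r \<longleftrightarrow> p - r \<in> {p. e p = \<zero>\<^bsub>U\<^esub>}" for p r
    using add[of "p - r" r] ec M.add.r_cancel_one[of "e r" "e (p - r)"] by auto
  \<comment> \<open>The orbit of \<open>\<xi>\<close> is a submodule containing
    \<open>\<xi>\<close>, so generation by \<open>\<xi>\<close> makes \<open>e\<close>
    surjective.\<close>
  have "submodule (range e) (box q) U"
  proof (intro submodule.intro submodule_axioms.intro)
    show "subgroup (range e) (add_monoid U)"
    proof (rule group.subgroupI[OF M.a_group])
      fix x assume "x \<in> range e"
      then obtain p where p: "x = e p" by blast
      have "e (- p) \<oplus>\<^bsub>U\<^esub> e p = \<zero>\<^bsub>U\<^esub>" by (simp add: e0 flip: add)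
      then have "\<ominus>\<^bsub>U\<^esub> x = e (- p)" unfolding p by (intro M.minus_equality ec)
      then show "inv\<^bsub>add_monoid U\<^esub> x \<in> range e" by (simp add: a_inv_def)
    next
      fix x y assume "x \<in> range e" "y \<in> range e"
      then show "x \<otimes>\<^bsub>add_monoid U\<^esub> y \<in> range e" by (auto simp flip: add)
    qed (use ec in auto)
    show "a \<odot>\<^bsub>U\<^esub> x \<in> range e" if "a \<in> carrier (box q)" "x \<in> range e" for a x
      using that by (auto simp: box_carrier simp flip: mult)
  qed
  moreover have e1: "e 1 = \<xi>" by (simp add: e_def smult_one \<xi>c flip: box_one)
  ultimately have range: "range e = carrier U" by (intro gen) auto
  have "nil_ideal q {p. e p = \<zero>\<^bsub>U\<^esub>}"
    unfolding nil_ideal_def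
  proof (intro conjI)
    have "e (c \<cdot> p) = \<zero>\<^bsub>U\<^esub>" if "e p = \<zero>\<^bsub>U\<^esub>" for c p
      unfolding scale_def mult using that by (simp add: smult0 bc)
    then show "subspace {p. e p = \<zero>\<^bsub>U\<^esub>}"
      by (simp add: free_alg.subspace_def e0 add)
    show "\<forall>p. \<forall>r\<in>{p. e p = \<zero>\<^bsub>U\<^esub>}. p * r \<in> {p. e p = \<zero>\<^bsub>U\<^esub>}"
      by (simp add: mult smult0 bc)
    show "box_ideal q \<subseteq> {p. e p = \<zero>\<^bsub>U\<^esub>}"
    proof
      fix p assume "p \<in> box_ideal q"
      then have "box_class q p = box_class q 0" by (simp add: box_class_eq_iff)
      then show "p \<in> {p. e p = \<zero>\<^bsub>U\<^esub>}" using e0 by (simp add: e_def)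
    qed
  qed (use \<xi> e1 in \<open>simp_all add: NIL_vector_def e_def\<close>)
  with range add mult eq show ?thesis unfolding presents_def by (intro exI[of _ e]) blast
qed

lemma (in generic_q) NIL_modules_isomorphic:
  assumes "NIL_module q M" "NIL_module q U"
  shows "module_isomorphic (box q) M U"
proof -
  obtain e where "presents q M e" using NIL_module_presentation[OF assms(1)] ..
  then have e: "range e = carrier M" "\<And>p r. e (p + r) = e p \<oplus>\<^bsub>M\<^esub> e r"
    "\<And>p r. e (p * r) = box_class q p \<odot>\<^bsub>M\<^esub> e r" "\<And>p r. e p = e r \<longleftrightarrow> p - r \<in> {p. e p = \<zero>\<^bsub>M\<^esub>}"
    "nil_ideal q {p. e p = \<zero>\<^bsub>M\<^esub>}" unfolding presents_def by blast+
  obtain d where "presents q U d" using NIL_module_presentation[OF assms(2)] ..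
  then have d: "range d = carrier U" "\<And>p r. d (p + r) = d p \<oplus>\<^bsub>U\<^esub> d r"
    "\<And>p r. d (p * r) = box_class q p \<odot>\<^bsub>U\<^esub> d r" "\<And>p r. d p = d r \<longleftrightarrow> p - r \<in> {p. d p = \<zero>\<^bsub>U\<^esub>}"
    "nil_ideal q {p. d p = \<zero>\<^bsub>U\<^esub>}" unfolding presents_def by blast+
  have eq: "e p = e r \<longleftrightarrow> d p = d r" for p r
    unfolding e(4) d(4) nil_ideal_unique[OF e(5) d(5)] ..
  \<comment> \<open>The choice is harmless because both presentations have the same kernel.\<close>
  define f where "f x = d (SOME p. e p = x)" for x
  have f: "f (e p) = d p" for p
    unfolding f_def using someI[of "\<lambda>r. e r = e p" p] eq by simp
  show ?thesis
    unfolding module_isomorphic_def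
  proof (intro exI[of _ f] conjI ballI)
    show "bij_betw f (carrier M) (carrier U)"
      unfolding bij_betw_def inj_on_def e(1)[symmetric] d(1)[symmetric]
      by (auto simp: f eq image_image)
    fix x assume x: "x \<in> carrier M"
    then obtain p where p: "x = e p" using e(1) by blast
    show "f (x \<oplus>\<^bsub>M\<^esub> y) = f x \<oplus>\<^bsub>U\<^esub> f y" if "y \<in> carrier M" for y
    proof -
      from that obtain r where r: "y = e r" using e(1) by blast
      show ?thesis unfolding p r by (simp add: f d(2) flip: e(2))
    qed
  next
    fix a x assume "a \<in> carrier (box q)" "x \<in> carrier M"
    then obtain p r where "a = box_class q p" "x = e r" unfolding box_carrier e(1)[symmetric] by blast
    then show "f (a \<odot>\<^bsub>M\<^esub> x) = a \<odot>\<^bsub>U\<^esub> f x" by (simp add: f d(3) flip: e(3))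
  qed
qed

lemma (in box_rep) realizes_NIL:
  "\<exists>M. box_module_on_VJ q (X 0) (X 1) (X 2) (X 3) M \<and> NIL_module q M \<and>
    (\<forall>U :: ((4, 'k) free_alg set, 'u) module. NIL_module q U \<longrightarrow> module_isomorphic (box q) M U)"
  using box_module_on_VJ NIL_module_VJ NIL_modules_isomorphic by blast

theorem theorem1p1:
  fixes q :: "'k::field"
  assumes "q \<noteq> 0" and "\<forall>n>0. q ^ n \<noteq> 1"
  shows
    "let Q = (\<lambda>T v. (1 - q^2) \<cdot> T v);
         A\<^sub>L = mulL LA; B\<^sub>L = mulL LB; A\<^sub>R = mulR LA; B\<^sub>R = mulR LB;
         A\<^sub>l' = adj (shL q LA); B\<^sub>l' = adj (shL q LB);
         A\<^sub>r' = adj (shR q LA); B\<^sub>r' = adj (shR q LB);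
         K = K q; K' = Kinv q
     in \<forall>(X0, X1, X2, X3) \<in>
          {(A\<^sub>L, Q (A\<^sub>l' - (B\<^sub>r' \<circ> K)), B\<^sub>L, Q (B\<^sub>l' - (A\<^sub>r' \<circ> K'))),
           (A\<^sub>R, Q (A\<^sub>r' - (B\<^sub>l' \<circ> K)), B\<^sub>R, Q (B\<^sub>r' - (A\<^sub>l' \<circ> K'))),
           (B\<^sub>L, Q (B\<^sub>l' - (A\<^sub>r' \<circ> K')), A\<^sub>L, Q (A\<^sub>l' - (B\<^sub>r' \<circ> K))),
           (B\<^sub>R, Q (B\<^sub>r' - (A\<^sub>l' \<circ> K')), A\<^sub>R, Q (A\<^sub>r' - (B\<^sub>l' \<circ> K))),
           (Q (A\<^sub>L - (K \<circ> B\<^sub>R)), A\<^sub>l', Q (B\<^sub>L - (K' \<circ> A\<^sub>R)), B\<^sub>l'),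
           (Q (A\<^sub>R - (K \<circ> B\<^sub>L)), A\<^sub>r', Q (B\<^sub>R - (K' \<circ> A\<^sub>L)), B\<^sub>r'),
           (Q (B\<^sub>L - (K' \<circ> A\<^sub>R)), B\<^sub>l', Q (A\<^sub>L - (K \<circ> B\<^sub>R)), A\<^sub>l'),
           (Q (B\<^sub>R - (K' \<circ> A\<^sub>L)), B\<^sub>r', Q (A\<^sub>R - (K \<circ> B\<^sub>L)), A\<^sub>r')}.
        \<exists>M. box_module_on_VJ q X0 X1 X2 X3 M \<and> NIL_module q M \<and>
          (\<forall>U :: ((4, 'k) free_alg set, 'u) module.
            NIL_module q U \<longrightarrow> module_isomorphic (box q) M U)"
proof -
  interpret generic_q q using assms by unfold_locales auto
  note ops = adj_shL[OF assms(1)] adj_shR[OF assms(1)] K_eq[OF assms(1)] Kinv_eq[OF assms(1)]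
  have mul: "mulL Z = (*) (gen Z)" for Z by (simp add: mulL_def fun_eq_iff)
  have mulR: "(\<lambda>v. revV (gen Z * revV v)) = mulR Z" for Z by (simp add: mulR_def fun_eq_iff revV_L)
  have x1: "x1I LA = (\<lambda>v. (1 - q\<^sup>2) \<cdot> (dl q LA - (dr q LB \<circ> Kx q LA)) v)"
    "x1I LB = (\<lambda>v. (1 - q\<^sup>2) \<cdot> (dl q LB - (dr q LA \<circ> Kx q LB)) v)"
    "(\<lambda>v. revV (x1I LA (revV v))) = (\<lambda>v. (1 - q\<^sup>2) \<cdot> (dr q LA - (dl q LB \<circ> Kx q LA)) v)"
    "(\<lambda>v. revV (x1I LB (revV v))) = (\<lambda>v. (1 - q\<^sup>2) \<cdot> (dr q LB - (dl q LA \<circ> Kx q LB)) v)"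
    by (simp_all add: fun_eq_iff x1I_def dr_def revV_Kx)
  have x0: "x0II LA = (\<lambda>v. (1 - q\<^sup>2) \<cdot> (mulL LA - (Kx q LA \<circ> mulR LB)) v)"
    "x0II LB = (\<lambda>v. (1 - q\<^sup>2) \<cdot> (mulL LB - (Kx q LB \<circ> mulR LA)) v)"
    "(\<lambda>v. revV (x0II LA (revV v))) = (\<lambda>v. (1 - q\<^sup>2) \<cdot> (mulR LA - (Kx q LA \<circ> mulL LB)) v)"
    "(\<lambda>v. revV (x0II LB (revV v))) = (\<lambda>v. (1 - q\<^sup>2) \<cdot> (mulR LB - (Kx q LB \<circ> mulL LA)) v)"
    by (simp_all add: fun_eq_iff x0II_def mulL_def mulR_def revV_Kx revV_L revV_R)
  have dr: "(\<lambda>v. revV (dl q Z (revV v))) = dr q Z" for Z by (simp add: fun_eq_iff dr_def)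
  \<comment> \<open>In order: I, IT, IS, IST, then II, IIT, IIS, IIST.\<close>
  note rules = box_rep.realizes_NIL[OF box_rep_I[of LA]] box_rep.realizes_NIL[OF box_rep_I[of LB]]
    box_rep.realizes_NIL[OF box_rep_revV[OF box_rep_I[of LA]]]
    box_rep.realizes_NIL[OF box_rep_revV[OF box_rep_I[of LB]]]
    box_rep.realizes_NIL[OF box_rep_II[of LA]] box_rep.realizes_NIL[OF box_rep_II[of LB]]
    box_rep.realizes_NIL[OF box_rep_revV[OF box_rep_II[of LA]]]
    box_rep.realizes_NIL[OF box_rep_revV[OF box_rep_II[of LB]]]
  note rules' = rules[unfolded opsI_simps opsII_simps other.simps, unfolded mulR dr x1(3,4) x0(3,4),
      unfolded x1(1,2) x0(1,2), folded mul]
  show ?thesis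
    unfolding Let_def ops
    by (simp only: Set.ball_simps prod.case simp_thms) (intro conjI rules')
qed

end
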